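(* Let $(A,C,\psi)$ be an entwining structure over $k=\mathbb C$ and let $g\in Z^n_\lambda(A,C,\psi)$. Then the following are equivalent: (1) $g\in B^n_\lambda(A,C,\psi)$. (2) $g$ is the character of an $n$-dimensional entwined vanishing cycle over $(A,C,\psi)$.
   Context: Let $k=\mathbb C$; $\otimes$ and $Hom$ are over $k$. An entwining structure $(A,C,\psi)$ over $k$ consists of a unital associative $k$-algebra $A$ with product $\theta$, a counital coassociative $k$-coalgebra $C$ (coproduct $\Delta$, counit $\varepsilon$), and a $k$-linear map $\psi:C\otimes A\to A\otimes C$, written $\psi(c\otimes a)=a_\psi\otimes c^\psi$ with summation suppressed, such that: (i) $\psi\circ(id_C\otimes\theta)=(\theta\otimes id_C)\circ(id_A\otimes\psi)\circ(\psi\otimes id_A)$; (ii) $(id_A\otimes\Delta)\circ\psi=(\psi\otimes id_C)\circ(id_C\otimes\psi)\circ(\Delta\otimes id_A)$; (iii) $a_\psi\,\varepsilon(c^\psi)=\varepsilon(c)a$; (iv) $1_\psi\otimes c^\psi=1\otimes c$. For a non-unital algebra, "entwining structure" means (i)–(iii) only. Let $\mathscr C^n(A,C,\psi)=Hom(C\otimes A^{\otimes n+1},k)$, $n\ge0$, with $$\delta^n(g)(c,a_1,\dots,a_{n+2})=g(c^\psi,a_2,\dots,a_{n+1},a_{n+2}a_{1\psi})+\sum_{i=1}^{n+1}(-1)^i g(c,a_1,\dots,a_ia_{i+1},\dots,a_{n+2}).$$ $\mathscr C^n_\lambda(A,C,\psi)$ is the subspace of all $g$ with $g(c,a_1,\dots,a_{n+1})=(-1)^n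 g(c^\psi,a_2,\dots,a_{n+1},a_{1\psi})$; it is a subcomplex, whose cocycles and coboundaries are $Z^n_\lambda(A,C,\psi)$ and $B^n_\lambda(A,C,\psi)$. A dg-entwining structure $((R^\bullet,D^\bullet),C,\Psi^\bullet)$ consists of a non-negatively graded, not necessarily unital, differential graded $k$-algebra $(R^\bullet,D^\bullet)$ (differential of degree $+1$), a counital coalgebra $C$ and a degree-zero $k$-linear map $\Psi^\bullet:C\otimes R^\bullet\to R^\bullet\otimes C$, written $\Psi(c\otimes r)=r_\Psi\otimes c^\Psi$, with $(D\otimes id_C)\circ\Psi=\Psi\circ(id_C\otimes D)$ and such that $(R,C,\Psi)$ is an entwining structure (in the possibly non-unital sense). It is a dg-entwining structure over $(A,C,\psi)$ when equipped with a (not necessarily unital) $k$-algebra morphism $\rho:A\to R^0$ satisfying $(\rho\otimes id_C)\circ\psi=\Psi^0\circ(id_C\otimes\rho)$. An $n$-dimensional closed graded entwined trace on it is a linear map $T:C\otimes R^n\to k$ with $T(c\otimes D(r))=0$ for $r\in R^{n-1}$, and $T(c\otimes rr')=(-1)^{ij}T(c^\Psi\otimes r'r_\Psi)$ for $r\in R^i$, $r'\in R^j$, $i+j=n$. An $n$-dimensional entwined cycle over $(A,C,\psi)$ is a tuple $((R^\bullet,D^\bullet),C,\Psi^\bullet,T,\rho)$ consisting of a dg-entwining structure over $(A,C,\psi)$ and such a $T$. Its character is $g(c\otimes a_1\otimes\cdots\otimes a_{n+1})=T(c\otimes(\rho(a_1)\cdot D(\rho(a_2))\cdots D(\rho(a_{n+1}))))$.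 For an entwining structure $(B,C,\psi)$ with $B$ unital, extend $\psi$ entrywise to $M_2(B)=B\otimes M_2(k)$, $\psi(c\otimes(b\otimes u))=(b_\psi\otimes u)\otimes c^\psi$, and let $\mathbb U_\psi(M_2(B))$ be the set of units $x$ of $M_2(B)$ with $\psi(c\otimes x)=x\otimes c$ for all $c\in C$. An entwined cycle $((R^\bullet,D^\bullet),C,\Psi^\bullet,T,\rho)$ is vanishing if $R^0$ is a unital $k$-algebra, $\Psi^0(c\otimes1_{R^0})=1_{R^0}\otimes c$ for all $c\in C$, and there exist a (not necessarily unital) algebra morphism $\nu:R^0\to R^0$ and $X\in\mathbb U_{\Psi^0}(M_2(R^0))$ such that $(\nu\otimes id_C)\circ\Psi^0=\Psi^0\circ(id_C\otimes\nu)$ and $X\begin{pmatrix}a&0\\0&\nu(a)\end{pmatrix}X^{-1}=\begin{pmatrix}0&0\\0&\nu(a)\end{pmatrix}$ for all $a\in R^0$. *)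

theory Defs
  imports
    "HOL-Library.Poly_Mapping"
    "HOL-Analysis.Finite_Cartesian_Product"
begin

section \<open>Complex vector spaces\<close>

class complex_vector = ab_group_add +
  fixes scaleC :: "complex \<Rightarrow> 'a \<Rightarrow> 'a"  (infixr \<open>*\<^sub>C\<close> 75)
  assumes scaleC_add_right: "k *\<^sub>C (x + y) = k *\<^sub>C x + k *\<^sub>C y"
    and scaleC_add_left: "(k + l) *\<^sub>C x = k *\<^sub>C x + l *\<^sub>C x"
    and scaleC_scaleC: "k *\<^sub>C l *\<^sub>C x = (k * l) *\<^sub>C x"
    and scaleC_one: "1 *\<^sub>C x = x"

text \<open>Unital associative algebras.  The class \<^class>\<open>ring_1\<close> is avoided because it
  excludes the zero algebra.\<close>

class complex_algebra_1 = complex_vector + ring + monoid_mult +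
  assumes mult_scaleC_left: "(k *\<^sub>C x) * y = k *\<^sub>C (x * y)"
    and mult_scaleC_right: "x * (k *\<^sub>C y) = k *\<^sub>C (x * y)"

global_interpretation cvs: vector_space "scaleC :: complex \<Rightarrow> 'a \<Rightarrow> 'a::complex_vector"
  by unfold_locales (auto simp: scaleC_add_right scaleC_add_left scaleC_scaleC scaleC_one)

global_interpretation cvs_pair: vector_space_pair
  "scaleC :: complex \<Rightarrow> 'a \<Rightarrow> 'a::complex_vector" "scaleC :: complex \<Rightarrow> 'b \<Rightarrow> 'b::complex_vector"
  by unfold_locales

instantiation complex :: complex_vector
begin
definition scaleC_complex :: "complex \<Rightarrow> complex \<Rightarrow> complex" where
  "scaleC_complex k x = k * x"
instance by standard (auto simp: scaleC_complex_def algebra_simps)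
end

instantiation vec :: (complex_vector, finite) complex_vector
begin
definition scaleC_vec :: "complex \<Rightarrow> ('a, 'b) vec \<Rightarrow> ('a, 'b) vec" where
  "scaleC_vec k x = (\<chi> i. k *\<^sub>C x $ i)"
instance by standard
  (auto simp: scaleC_vec_def vec_eq_iff scaleC_add_right scaleC_add_left scaleC_scaleC scaleC_one)
end

instantiation poly_mapping :: (type, complex_vector) complex_vector
begin
definition scaleC_poly_mapping :: "complex \<Rightarrow> ('a \<Rightarrow>\<^sub>0 'b) \<Rightarrow> 'a \<Rightarrow>\<^sub>0 'b" where
  "scaleC_poly_mapping k = Poly_Mapping.map (scaleC k)"
lemma lookup_scaleC: "Poly_Mapping.lookup (k *\<^sub>C p) x = k *\<^sub>C Poly_Mapping.lookup p x"
  by (auto simp: scaleC_poly_mapping_def Poly_Mapping.map.rep_eq when_def)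
instance by standard
  (auto intro!: poly_mapping_eqI simp: lookup_scaleC lookup_add
     scaleC_add_right scaleC_add_left scaleC_scaleC scaleC_one)
end

definition clinear_on :: "'v::complex_vector set \<Rightarrow> ('v \<Rightarrow> 'u::complex_vector) \<Rightarrow> bool" where
  "clinear_on V f \<longleftrightarrow>
     (\<forall>x\<in>V. \<forall>y\<in>V. f (x + y) = f x + f y) \<and> (\<forall>k. \<forall>x\<in>V. f (k *\<^sub>C x) = k *\<^sub>C f x)"

definition cbilinear_on ::
  "'v::complex_vector set \<Rightarrow> 'w::complex_vector set \<Rightarrow> ('v \<Rightarrow> 'w \<Rightarrow> 'u::complex_vector) \<Rightarrow> bool" where
  "cbilinear_on V W \<beta> \<longleftrightarrow>
     (\<forall>w\<in>W. clinear_on V (\<lambda>v. \<beta> v w)) \<and> (\<forall>v\<in>V. clinear_on W (\<beta> v))"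


section \<open>Tensor products\<close>

text \<open>The tensor product is the free vector space on pairs modulo the bilinearity relations.\<close>

definition tensor_relations :: "('v::complex_vector \<times> 'w::complex_vector \<Rightarrow>\<^sub>0 complex) set" where
  "tensor_relations = (let s = (\<lambda>v w. Poly_Mapping.single (v, w) 1) in
     {s (v + v') w - s v w - s v' w | v v' w. True} \<union>
     {s v (w + w') - s v w - s v w' | v w w'. True} \<union>
     {s (k *\<^sub>C v) w - k *\<^sub>C s v w | k v w. True} \<union>
     {s v (k *\<^sub>C w) - k *\<^sub>C s v w | k v w. True})"

definition tensor_eq ::
  "('v::complex_vector \<times> 'w::complex_vector \<Rightarrow>\<^sub>0 complex) \<Rightarrow> ('v \<times> 'w \<Rightarrow>\<^sub>0 complex) \<Rightarrow> bool" where
  "tensor_eq p q \<longleftrightarrow> p - q \<in> cvs.span tensor_relations"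

lemma equivp_tensor_eq:
  "equivp (tensor_eq :: ('a::complex_vector \<times> 'b::complex_vector \<Rightarrow>\<^sub>0 complex) \<Rightarrow> _)"
proof (rule equivpI)
  show "reflp (tensor_eq :: ('a \<times> 'b \<Rightarrow>\<^sub>0 complex) \<Rightarrow> _)" by (auto intro!: reflpI simp: tensor_eq_def cvs.span_zero)
  show "symp (tensor_eq :: ('a \<times> 'b \<Rightarrow>\<^sub>0 complex) \<Rightarrow> _)"
  proof (rule sympI)
    fix p q :: "'a \<times> 'b \<Rightarrow>\<^sub>0 complex"
    assume "tensor_eq p q"
    then show "tensor_eq q p" unfolding tensor_eq_def using cvs.span_neg[of "p - q"] by simp
  qed
  show "transp (tensor_eq :: ('a \<times> 'b \<Rightarrow>\<^sub>0 complex) \<Rightarrow> _)"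
  proof (rule transpI)
    fix p q r :: "'a \<times> 'b \<Rightarrow>\<^sub>0 complex"
    assume "tensor_eq p q" "tensor_eq q r"
    then show "tensor_eq p r"
      unfolding tensor_eq_def using cvs.span_add[of "p - q" _ "q - r"] by simp
  qed
qed

quotient_type (overloaded) ('v, 'w) tensor =
  "'v::complex_vector \<times> 'w::complex_vector \<Rightarrow>\<^sub>0 complex" / tensor_eq
  by (rule equivp_tensor_eq)

instantiation tensor :: (complex_vector, complex_vector) complex_vector
begin
lift_definition zero_tensor :: "('a, 'b) tensor" is 0 .
lift_definition plus_tensor :: "('a, 'b) tensor \<Rightarrow> ('a, 'b) tensor \<Rightarrow> ('a, 'b) tensor" is "(+)"
  unfolding tensor_eq_def add_diff_add by (rule cvs.span_add)
lift_definition minus_tensor :: "('a, 'b) tensor \<Rightarrow> ('a, 'b) tensor \<Rightarrow> ('a, 'b) tensor" is "(-)"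
proof -
  fix p p' q q' :: "'a \<times> 'b \<Rightarrow>\<^sub>0 complex"
  assume "tensor_eq p p'" "tensor_eq q q'"
  moreover have "(p - q) - (p' - q') = (p - p') - (q - q')" by simp
  ultimately show "tensor_eq (p - q) (p' - q')"
    unfolding tensor_eq_def by (simp only: cvs.span_diff)
qed
lift_definition uminus_tensor :: "('a, 'b) tensor \<Rightarrow> ('a, 'b) tensor" is uminus
  unfolding tensor_eq_def minus_diff_minus by (rule cvs.span_neg)
lift_definition scaleC_tensor :: "complex \<Rightarrow> ('a, 'b) tensor \<Rightarrow> ('a, 'b) tensor" is "scaleC"
  unfolding tensor_eq_def cvs.scale_right_diff_distrib[symmetric] by (rule cvs.span_scale)
instance
proof
  have eq: "p = q \<Longrightarrow> tensor_eq p q" for p q :: "'a \<times> 'b \<Rightarrow>\<^sub>0 complex"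
    by (simp add: tensor_eq_def cvs.span_zero)
  fix x y z :: "('a, 'b) tensor" and k l :: complex
  show "x + y + z = x + (y + z)" by transfer (rule eq, rule add.assoc)
  show "x + y = y + x" by transfer (rule eq, rule add.commute)
  show "0 + x = x" by transfer (rule eq, simp)
  show "- x + x = 0" by transfer (rule eq, simp)
  show "x - y = x + - y" by transfer (rule eq, simp)
  show "k *\<^sub>C (x + y) = k *\<^sub>C x + k *\<^sub>C y" by transfer (rule eq, rule scaleC_add_right)
  show "(k + l) *\<^sub>C x = k *\<^sub>C x + l *\<^sub>C x" by transfer (rule eq, rule scaleC_add_left)
  show "k *\<^sub>C l *\<^sub>C x = (k * l) *\<^sub>C x" by transfer (rule eq, rule scaleC_scaleC)
  show "1 *\<^sub>C x = x" by transfer (rule eq, rule scaleC_one)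
qed
end

lift_definition tens :: "'v::complex_vector \<Rightarrow> 'w::complex_vector \<Rightarrow> ('v, 'w) tensor"
    (infix \<open>\<otimes>\<close> 72)
  is "\<lambda>v w. Poly_Mapping.single (v, w) 1" .

text \<open>For subspaces \<open>V\<close>, \<open>W\<close> the tensor product \<open>V \<otimes> W\<close> is identified with its image in the
  tensor product of the ambient spaces (the canonical map is injective over a field).\<close>

definition tensor_on ::
  "'v::complex_vector set \<Rightarrow> 'w::complex_vector set \<Rightarrow> ('v, 'w) tensor set" where
  "tensor_on V W = cvs.span {v \<otimes> w | v w. v \<in> V \<and> w \<in> W}"

text \<open>\<open>tlift V W \<beta>\<close> is the linear map \<open>V \<otimes> W \<rightarrow> U\<close> induced by a map \<open>\<beta>\<close> that is bilinear on
  \<open>V \<times> W\<close>; see \<open>tlift_eq\<close> below.  It renders Sweedler-type notation: for instance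
  \<open>f(a\<^sub>\<psi>, c\<^sup>\<psi>)\<close> is \<open>tlift V UNIV f (\<psi> (c \<otimes> a))\<close>.\<close>

definition tlift ::
  "'v::complex_vector set \<Rightarrow> 'w::complex_vector set \<Rightarrow> ('v \<Rightarrow> 'w \<Rightarrow> 'u::complex_vector)
     \<Rightarrow> ('v, 'w) tensor \<Rightarrow> 'u" where
  "tlift V W \<beta> t = (THE u. \<exists>ps. set ps \<subseteq> V \<times> W \<and>
      t = (\<Sum>(v, w)\<leftarrow>ps. v \<otimes> w) \<and> u = (\<Sum>(v, w)\<leftarrow>ps. \<beta> v w))"

definition tensor_map ::
  "'v::complex_vector set \<Rightarrow> 'w::complex_vector set \<Rightarrow> ('v \<Rightarrow> 'x::complex_vector)
     \<Rightarrow> ('w \<Rightarrow> 'y::complex_vector) \<Rightarrow> ('v, 'w) tensor \<Rightarrow> ('x, 'y) tensor" where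
  "tensor_map V W f h = tlift V W (\<lambda>v w. f v \<otimes> h w)"

lemma tens_bilinear:
  "(v + v') \<otimes> w = v \<otimes> w + v' \<otimes> w" "v \<otimes> (w + w') = v \<otimes> w + v \<otimes> w'"
  "(k *\<^sub>C v) \<otimes> w = k *\<^sub>C (v \<otimes> w)" "v \<otimes> (k *\<^sub>C w) = k *\<^sub>C (v \<otimes> w)"
  by (transfer; unfold tensor_eq_def diff_diff_eq[symmetric]; rule cvs.span_base;
      unfold tensor_relations_def Let_def; blast)+

lemma tensor_sum_respects:
  fixes \<beta> :: "'v::complex_vector \<Rightarrow> 'w::complex_vector \<Rightarrow> 'u::complex_vector"
  assumes V: "cvs.subspace V" and W: "cvs.subspace W" and \<beta>: "cbilinear_on V W \<beta>"
    and ps: "set ps \<subseteq> V \<times> W" and qs: "set qs \<subseteq> V \<times> W"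
    and eq: "(\<Sum>(v, w)\<leftarrow>ps. v \<otimes> w) = (\<Sum>(v, w)\<leftarrow>qs. v \<otimes> w)"
  shows "(\<Sum>(v, w)\<leftarrow>ps. \<beta> v w) = (\<Sum>(v, w)\<leftarrow>qs. \<beta> v w)"
proof -
  have proj: "\<exists>P. Vector_Spaces.linear scaleC scaleC P \<and> range P \<subseteq> S \<and> (\<forall>x\<in>S. P x = x)"
    if S: "cvs.subspace S" for S :: "'x::complex_vector set"
  proof -
    obtain g where "range g \<subseteq> S" "Vector_Spaces.linear scaleC scaleC g" "\<forall>x\<in>S. g (id x) = x"
      using cvs_pair.linear_exists_left_inverse_on[OF cvs.linear_id S] by auto
    then show ?thesis by auto
  qed
  obtain P where P: "Vector_Spaces.linear scaleC scaleC P" "range P \<subseteq> V" "\<And>x. x \<in> V \<Longrightarrow> P x = x"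
    using proj[OF V] by blast
  obtain Q where Q: "Vector_Spaces.linear scaleC scaleC Q" "range Q \<subseteq> W" "\<And>x. x \<in> W \<Longrightarrow> Q x = x"
    using proj[OF W] by blast
  define \<gamma> where "\<gamma> v w = \<beta> (P v) (Q w)" for v w
  have PV: "P x \<in> V" and QW: "Q y \<in> W" for x y using P Q by auto
  note lin = Vector_Spaces.linear.axioms(3)[OF P(1)] Vector_Spaces.linear.axioms(3)[OF Q(1)]
  have g1: "\<gamma> (v + v') w = \<gamma> v w + \<gamma> v' w" "\<gamma> (k *\<^sub>C v) w = k *\<^sub>C \<gamma> v w"
    "\<gamma> v (w + w') = \<gamma> v w + \<gamma> v w'" "\<gamma> v (k *\<^sub>C w) = k *\<^sub>C \<gamma> v w" for v v' w w' k
    using \<beta> PV QW lin[THEN module_hom.add] lin[THEN module_hom.scale]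
    by (auto simp: \<gamma>_def cbilinear_on_def clinear_on_def)
  define L where "L p = (\<Sum>x\<in>Poly_Mapping.keys p. Poly_Mapping.lookup p x *\<^sub>C \<gamma> (fst x) (snd x))"
    for p :: "'v \<times> 'w \<Rightarrow>\<^sub>0 complex"
  have L': "L p = (\<Sum>x\<in>K. Poly_Mapping.lookup p x *\<^sub>C \<gamma> (fst x) (snd x))"
    if "finite K" "Poly_Mapping.keys p \<subseteq> K" for p K
    unfolding L_def using that by (intro sum.mono_neutral_left) (auto simp: in_keys_iff)
  have Ladd: "L (p + q) = L p + L q" for p q
    using L'[of "Poly_Mapping.keys p \<union> Poly_Mapping.keys q"] Poly_Mapping.keys_add[of p q]
    by (simp add: lookup_add scaleC_add_left sum.distrib)
  have Lscale: "L (k *\<^sub>C p) = k *\<^sub>C L p" for k p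
  proof -
    have "Poly_Mapping.keys (k *\<^sub>C p) \<subseteq> Poly_Mapping.keys p"
      by (auto simp: in_keys_iff lookup_scaleC)
    then show ?thesis
      using L'[of "Poly_Mapping.keys p" "k *\<^sub>C p"] L'[of "Poly_Mapping.keys p" p]
      by (simp add: lookup_scaleC scaleC_scaleC cvs.scale_sum_right scaleC_complex_def)
  qed
  interpret L: module_hom scaleC scaleC L
    by unfold_locales (simp_all add: Ladd Lscale)
  have Ls: "L (Poly_Mapping.single (v, w) 1) = \<gamma> v w" for v w
    unfolding L_def by (simp add: scaleC_one)
  have L0: "L r = 0" if "r \<in> cvs.span tensor_relations" for r
    using that
  proof (induction rule: cvs.span_induct_alt)
    case (step k r s)
    from step(1) have "L r = 0"
      by (auto simp: tensor_relations_def L.diff Ls g1 Lscale)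
    with step show ?case by (simp add: Ladd Lscale)
  qed (simp add: L.zero)
  define F where "F xs = (\<Sum>(v, w)\<leftarrow>xs. Poly_Mapping.single (v, w) (1::complex))" for xs :: "('v \<times> 'w) list"
  have absF: "(\<Sum>(v, w)\<leftarrow>xs. v \<otimes> w) = abs_tensor (F xs)" for xs
    by (induction xs) (auto simp: F_def zero_tensor.abs_eq tens.abs_eq plus_tensor.abs_eq)
  have LF: "L (F xs) = (\<Sum>(v, w)\<leftarrow>xs. \<beta> v w)" if "set xs \<subseteq> V \<times> W" for xs
    using that by (induction xs) (auto simp: F_def L.zero Ladd Ls \<gamma>_def P(3) Q(3))
  have "L (F ps - F qs) = 0"
    using eq L0 by (simp add: absF tensor.abs_eq_iff tensor_eq_def)
  then show ?thesis using LF[OF ps] LF[OF qs] by (simp add: L.diff)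
qed

lemma tlift_eq:
  assumes "cvs.subspace V" "cvs.subspace W" "cbilinear_on V W \<beta>" "set ps \<subseteq> V \<times> W"
  shows "tlift V W \<beta> (\<Sum>(v, w)\<leftarrow>ps. v \<otimes> w) = (\<Sum>(v, w)\<leftarrow>ps. \<beta> v w)"
  unfolding tlift_def
proof (rule the_equality)
  show "\<exists>qs. set qs \<subseteq> V \<times> W \<and> (\<Sum>(v, w)\<leftarrow>ps. v \<otimes> w) = (\<Sum>(v, w)\<leftarrow>qs. v \<otimes> w) \<and>
      (\<Sum>(v, w)\<leftarrow>ps. \<beta> v w) = (\<Sum>(v, w)\<leftarrow>qs. \<beta> v w)"
    using assms(4) by blast
qed (use tensor_sum_respects[OF assms(1-3) _ assms(4)] in metis)

lemma tensor_on_eq: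
  assumes V: "cvs.subspace V" and W: "cvs.subspace W"
  shows "tensor_on V W = {\<Sum>(v, w)\<leftarrow>ps. v \<otimes> w | ps. set ps \<subseteq> V \<times> W}"
proof (intro subset_antisym subsetI)
  fix t assume "t \<in> tensor_on V W"
  then show "t \<in> {\<Sum>(v, w)\<leftarrow>ps. v \<otimes> w | ps. set ps \<subseteq> V \<times> W}"
    unfolding tensor_on_def
  proof (induction rule: cvs.span_induct_alt)
    case base
    show ?case by (auto intro!: exI[of _ "[]"])
  next
    case (step k x y)
    then obtain v w ps where x: "x = v \<otimes> w" "v \<in> V" "w \<in> W"
      and y: "y = (\<Sum>(v, w)\<leftarrow>ps. v \<otimes> w)" "set ps \<subseteq> V \<times> W" by auto
    then show ?case
      using cvs.subspace_scale[OF V]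
      by (auto intro!: exI[of _ "(k *\<^sub>C v, w) # ps"] simp: tens_bilinear)
  qed
next
  fix t assume "t \<in> {\<Sum>(v, w)\<leftarrow>ps. v \<otimes> w | ps. set ps \<subseteq> V \<times> W}"
  then obtain ps where "t = (\<Sum>(v, w)\<leftarrow>ps. v \<otimes> w)" "set ps \<subseteq> V \<times> W" by auto
  then show "t \<in> tensor_on V W"
    unfolding tensor_on_def
  proof (induction ps arbitrary: t)
    case (Cons p ps)
    then show ?case
      by (cases p) (auto intro!: cvs.span_add intro: cvs.span_base)
  qed (simp add: cvs.span_zero)
qed

section \<open>Algebras, coalgebras and entwining structures\<close>

text \<open>Possibly non-unital associative algebras are carried by a subspace \<open>V\<close> of an ambient
  complex vector space.\<close>

definition algebra_on :: "'v::complex_vector set \<Rightarrow> ('v \<Rightarrow> 'v \<Rightarrow> 'v) \<Rightarrow> bool" where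
  "algebra_on V m \<longleftrightarrow> cvs.subspace V \<and> cbilinear_on V V m \<and>
     (\<forall>x\<in>V. \<forall>y\<in>V. m x y \<in> V) \<and>
     (\<forall>x\<in>V. \<forall>y\<in>V. \<forall>z\<in>V. m (m x y) z = m x (m y z))"

definition unit_on :: "'v set \<Rightarrow> ('v \<Rightarrow> 'v \<Rightarrow> 'v) \<Rightarrow> 'v \<Rightarrow> bool" where
  "unit_on V m e \<longleftrightarrow> e \<in> V \<and> (\<forall>x\<in>V. m e x = x \<and> m x e = x)"

definition algebra_hom_on ::
  "'v::complex_vector set \<Rightarrow> ('v \<Rightarrow> 'v \<Rightarrow> 'v) \<Rightarrow> 'w::complex_vector set \<Rightarrow> ('w \<Rightarrow> 'w \<Rightarrow> 'w)
     \<Rightarrow> ('v \<Rightarrow> 'w) \<Rightarrow> bool" where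
  "algebra_hom_on V m W m' f \<longleftrightarrow> clinear_on V f \<and> (\<forall>x\<in>V. f x \<in> W) \<and>
     (\<forall>x\<in>V. \<forall>y\<in>V. f (m x y) = m' (f x) (f y))"

definition coalgebra ::
  "('c::complex_vector \<Rightarrow> ('c, 'c) tensor) \<Rightarrow> ('c \<Rightarrow> complex) \<Rightarrow> bool" where
  "coalgebra \<Delta> \<epsilon> \<longleftrightarrow> clinear_on UNIV \<Delta> \<and> clinear_on UNIV \<epsilon> \<and>
     (\<forall>c. tlift UNIV UNIV (\<lambda>c1 c2. tlift UNIV UNIV (\<lambda>c11 c12. c11 \<otimes> (c12 \<otimes> c2)) (\<Delta> c1)) (\<Delta> c)
        = tensor_map UNIV UNIV id \<Delta> (\<Delta> c)) \<and>
     (\<forall>c. tlift UNIV UNIV (\<lambda>c1 c2. \<epsilon> c1 *\<^sub>C c2) (\<Delta> c) = c) \<and>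
     (\<forall>c. tlift UNIV UNIV (\<lambda>c1 c2. \<epsilon> c2 *\<^sub>C c1) (\<Delta> c) = c)"

text \<open>Entwining structure in the possibly non-unital sense.  The last three conjuncts are the
  compatibilities of \<open>\<psi>\<close> with the product, the coproduct and the counit, evaluated on elementary
  tensors; iterated tensor products are bracketed to the right.\<close>

definition entwining ::
  "'v::complex_vector set \<Rightarrow> ('v \<Rightarrow> 'v \<Rightarrow> 'v)
     \<Rightarrow> ('c::complex_vector \<Rightarrow> ('c, 'c) tensor) \<Rightarrow> ('c \<Rightarrow> complex)
     \<Rightarrow> (('c, 'v) tensor \<Rightarrow> ('v, 'c) tensor) \<Rightarrow> bool" where
  "entwining V m \<Delta> \<epsilon> \<psi> \<longleftrightarrow>
     algebra_on V m \<and> coalgebra \<Delta> \<epsilon> \<and>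
     clinear_on (tensor_on UNIV V) \<psi> \<and> \<psi> ` tensor_on UNIV V \<subseteq> tensor_on V UNIV \<and>
     (\<forall>c. \<forall>a\<in>V. \<forall>b\<in>V. \<psi> (c \<otimes> m a b) =
        tlift V UNIV (\<lambda>a' c'. tlift V UNIV (\<lambda>b' c''. m a' b' \<otimes> c'') (\<psi> (c' \<otimes> b))) (\<psi> (c \<otimes> a))) \<and>
     (\<forall>c. \<forall>a\<in>V. tensor_map V UNIV id \<Delta> (\<psi> (c \<otimes> a)) =
        tlift UNIV UNIV (\<lambda>c1 c2. tlift V UNIV (\<lambda>a' c2'. tlift V UNIV (\<lambda>a'' c1'. a'' \<otimes> (c1' \<otimes> c2'))
          (\<psi> (c1 \<otimes> a'))) (\<psi> (c2 \<otimes> a))) (\<Delta> c)) \<and>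
     (\<forall>c. \<forall>a\<in>V. tlift V UNIV (\<lambda>a' c'. \<epsilon> c' *\<^sub>C a') (\<psi> (c \<otimes> a)) = \<epsilon> c *\<^sub>C a)"

definition entwining_structure ::
  "('c::complex_vector \<Rightarrow> ('c, 'c) tensor) \<Rightarrow> ('c \<Rightarrow> complex)
     \<Rightarrow> (('c, 'a::complex_algebra_1) tensor \<Rightarrow> ('a, 'c) tensor) \<Rightarrow> bool" where
  "entwining_structure \<Delta> \<epsilon> \<psi> \<longleftrightarrow>
     entwining UNIV (*) \<Delta> \<epsilon> \<psi> \<and> (\<forall>c. \<psi> (c \<otimes> 1) = 1 \<otimes> c)"


section \<open>The complex of entwined cyclic cochains\<close>

text \<open>An element of \<open>Hom(C \<otimes> A\<^sup>\<otimes>\<^sup>n\<^sup>+\<^sup>1, \<complex>)\<close> is a function of \<open>c\<close> and a list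
  \<open>[a\<^sub>1, \<dots>, a\<^sub>n\<^sub>+\<^sub>1]\<close> that is linear in each argument, with value \<open>0\<close> on lists of any other length.\<close>

definition cochains :: "nat \<Rightarrow> ('c::complex_vector \<Rightarrow> 'a::complex_algebra_1 list \<Rightarrow> complex) set" where
  "cochains n = {g.
     (\<forall>as. length as = n + 1 \<longrightarrow> clinear_on UNIV (\<lambda>c. g c as)) \<and>
     (\<forall>c as i. length as = n + 1 \<longrightarrow> i < n + 1 \<longrightarrow> clinear_on UNIV (\<lambda>a. g c (as[i := a]))) \<and>
     (\<forall>c as. length as \<noteq> n + 1 \<longrightarrow> g c as = 0)}"

text \<open>In the \<open>i\<close>-th summand, the list \<open>as\<close> being indexed from \<open>0\<close>, the factors \<open>a\<^sub>i\<close>, \<open>a\<^sub>i\<^sub>+\<^sub>1\<close> are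
  \<open>as ! (i - 1)\<close> and \<open>as ! i\<close>.\<close>

definition coboundary_map ::
  "(('c::complex_vector, 'a::complex_algebra_1) tensor \<Rightarrow> ('a, 'c) tensor) \<Rightarrow> nat
     \<Rightarrow> ('c \<Rightarrow> 'a list \<Rightarrow> complex) \<Rightarrow> ('c \<Rightarrow> 'a list \<Rightarrow> complex)" where
  "coboundary_map \<psi> n g = (\<lambda>c as. if length as = n + 2 then
      tlift UNIV UNIV (\<lambda>a' c'. g c' (butlast (tl as) @ [last as * a'])) (\<psi> (c \<otimes> hd as))
      + (\<Sum>i = 1..n + 1. (- 1) ^ i * g c (take (i - 1) as @ [as ! (i - 1) * as ! i] @ drop (i + 1) as))
    else 0)"

definition cyclic_cochains ::
  "(('c::complex_vector, 'a::complex_algebra_1) tensor \<Rightarrow> ('a, 'c) tensor) \<Rightarrow> nat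
     \<Rightarrow> ('c \<Rightarrow> 'a list \<Rightarrow> complex) set" where
  "cyclic_cochains \<psi> n = {g \<in> cochains n. \<forall>c as. length as = n + 1 \<longrightarrow>
      g c as = (- 1) ^ n * tlift UNIV UNIV (\<lambda>a' c'. g c' (tl as @ [a'])) (\<psi> (c \<otimes> hd as))}"

definition cyclic_cocycles ::
  "(('c::complex_vector, 'a::complex_algebra_1) tensor \<Rightarrow> ('a, 'c) tensor) \<Rightarrow> nat
     \<Rightarrow> ('c \<Rightarrow> 'a list \<Rightarrow> complex) set" where
  "cyclic_cocycles \<psi> n = {g \<in> cyclic_cochains \<psi> n. coboundary_map \<psi> n g = (\<lambda>c as. 0)}"

fun cyclic_coboundaries ::
  "(('c::complex_vector, 'a::complex_algebra_1) tensor \<Rightarrow> ('a, 'c) tensor) \<Rightarrow> nat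
     \<Rightarrow> ('c \<Rightarrow> 'a list \<Rightarrow> complex) set" where
  "cyclic_coboundaries \<psi> 0 = {\<lambda>c as. 0}"
| "cyclic_coboundaries \<psi> (Suc n) = coboundary_map \<psi> n ` cyclic_cochains \<psi> n"


section \<open>Entwined cycles and their characters\<close>

text \<open>A graded algebra is carried by the sum of subspaces \<open>piece R n\<close> of an ambient vector
  space; the sum is required to be direct in \<open>dg_algebra\<close>.\<close>

record 'r dga =
  piece :: "nat \<Rightarrow> 'r set"
  mul :: "'r \<Rightarrow> 'r \<Rightarrow> 'r"
  diff :: "'r \<Rightarrow> 'r"

definition total :: "('r::complex_vector, 'z) dga_scheme \<Rightarrow> 'r set" where
  "total R = cvs.span (\<Union>n. piece R n)"

definition dg_algebra :: "('r::complex_vector, 'z) dga_scheme \<Rightarrow> bool" where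
  "dg_algebra R \<longleftrightarrow>
     (\<forall>n. cvs.subspace (piece R n)) \<and>
     (\<forall>N x. (\<forall>i\<le>N. x i \<in> piece R i) \<longrightarrow> (\<Sum>i\<le>N. x i) = 0 \<longrightarrow> (\<forall>i\<le>N::nat. x i = 0)) \<and>
     algebra_on (total R) (mul R) \<and>
     (\<forall>i j. \<forall>r\<in>piece R i. \<forall>r'\<in>piece R j. mul R r r' \<in> piece R (i + j)) \<and>
     clinear_on (total R) (diff R) \<and>
     (\<forall>i. \<forall>r\<in>piece R i. diff R r \<in> piece R (i + 1)) \<and>
     (\<forall>r\<in>total R. diff R (diff R r) = 0) \<and>
     (\<forall>i j. \<forall>r\<in>piece R i. \<forall>r'\<in>piece R j. diff R (mul R r r') =
        mul R (diff R r) r' + (- 1) ^ i *\<^sub>C mul R r (diff R r'))"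

definition dg_entwining ::
  "('r::complex_vector, 'z) dga_scheme
     \<Rightarrow> ('c::complex_vector \<Rightarrow> ('c, 'c) tensor) \<Rightarrow> ('c \<Rightarrow> complex)
     \<Rightarrow> (('c, 'r) tensor \<Rightarrow> ('r, 'c) tensor) \<Rightarrow> bool" where
  "dg_entwining R \<Delta> \<epsilon> \<Psi> \<longleftrightarrow>
     dg_algebra R \<and> entwining (total R) (mul R) \<Delta> \<epsilon> \<Psi> \<and>
     (\<forall>n. \<Psi> ` tensor_on UNIV (piece R n) \<subseteq> tensor_on (piece R n) UNIV) \<and>
     (\<forall>t\<in>tensor_on UNIV (total R). tensor_map (total R) UNIV (diff R) id (\<Psi> t) =
        \<Psi> (tensor_map UNIV (total R) id (diff R) t))"

definition dg_entwining_over ::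
  "(('c::complex_vector, 'a::complex_algebra_1) tensor \<Rightarrow> ('a, 'c) tensor)
     \<Rightarrow> ('r::complex_vector, 'z) dga_scheme
     \<Rightarrow> ('c \<Rightarrow> ('c, 'c) tensor) \<Rightarrow> ('c \<Rightarrow> complex)
     \<Rightarrow> (('c, 'r) tensor \<Rightarrow> ('r, 'c) tensor) \<Rightarrow> ('a \<Rightarrow> 'r) \<Rightarrow> bool" where
  "dg_entwining_over \<psi> R \<Delta> \<epsilon> \<Psi> \<rho> \<longleftrightarrow>
     dg_entwining R \<Delta> \<epsilon> \<Psi> \<and> algebra_hom_on UNIV (*) (piece R 0) (mul R) \<rho> \<and>
     (\<forall>t. tensor_map UNIV UNIV \<rho> id (\<psi> t) = \<Psi> (tensor_map UNIV UNIV id \<rho> t))"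

definition closed_graded_entwined_trace ::
  "nat \<Rightarrow> ('r::complex_vector, 'z) dga_scheme
     \<Rightarrow> (('c::complex_vector, 'r) tensor \<Rightarrow> ('r, 'c) tensor) \<Rightarrow> (('c, 'r) tensor \<Rightarrow> complex)
     \<Rightarrow> bool" where
  "closed_graded_entwined_trace n R \<Psi> T \<longleftrightarrow>
     clinear_on (tensor_on UNIV (piece R n)) T \<and>
     (\<forall>m c. \<forall>r\<in>piece R m. m + 1 = n \<longrightarrow> T (c \<otimes> diff R r) = 0) \<and>
     (\<forall>i j c. \<forall>r\<in>piece R i. \<forall>r'\<in>piece R j. i + j = n \<longrightarrow>
        T (c \<otimes> mul R r r') =
          (- 1) ^ (i * j) * tlift (piece R i) UNIV (\<lambda>s c'. T (c' \<otimes> mul R r' s)) (\<Psi> (c \<otimes> r)))"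

definition entwined_cycle ::
  "nat \<Rightarrow> (('c::complex_vector, 'a::complex_algebra_1) tensor \<Rightarrow> ('a, 'c) tensor)
     \<Rightarrow> ('r::complex_vector, 'z) dga_scheme
     \<Rightarrow> ('c \<Rightarrow> ('c, 'c) tensor) \<Rightarrow> ('c \<Rightarrow> complex)
     \<Rightarrow> (('c, 'r) tensor \<Rightarrow> ('r, 'c) tensor) \<Rightarrow> (('c, 'r) tensor \<Rightarrow> complex)
     \<Rightarrow> ('a \<Rightarrow> 'r) \<Rightarrow> bool" where
  "entwined_cycle n \<psi> R \<Delta> \<epsilon> \<Psi> T \<rho> \<longleftrightarrow>
     dg_entwining_over \<psi> R \<Delta> \<epsilon> \<Psi> \<rho> \<and> closed_graded_entwined_trace n R \<Psi> T"

definition cycle_character ::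
  "nat \<Rightarrow> ('r::complex_vector, 'z) dga_scheme
     \<Rightarrow> (('c::complex_vector, 'r) tensor \<Rightarrow> complex) \<Rightarrow> ('a \<Rightarrow> 'r)
     \<Rightarrow> ('c \<Rightarrow> 'a list \<Rightarrow> complex)" where
  "cycle_character n R T \<rho> = (\<lambda>c as. if length as = n + 1 then
      T (c \<otimes> foldl (mul R) (\<rho> (hd as)) (map (\<lambda>a. diff R (\<rho> a)) (tl as))) else 0)"


section \<open>Vanishing cycles\<close>

definition mat2 :: "'r set \<Rightarrow> ('r^2^2) set" where
  "mat2 V = {x. \<forall>i j. x $ i $ j \<in> V}"

definition mat2_mult :: "('r::comm_monoid_add \<Rightarrow> 'r \<Rightarrow> 'r) \<Rightarrow> 'r^2^2 \<Rightarrow> 'r^2^2 \<Rightarrow> 'r^2^2" where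
  "mat2_mult m x y = (\<chi> i j. \<Sum>k\<in>UNIV. m (x $ i $ k) (y $ k $ j))"

definition mat2_unit :: "2 \<Rightarrow> 2 \<Rightarrow> 'r::zero \<Rightarrow> 'r^2^2" where
  "mat2_unit i j b = (\<chi> i' j'. if i' = i \<and> j' = j then b else 0)"

definition mat2_diag :: "'r \<Rightarrow> 'r \<Rightarrow> 'r::zero^2^2" where
  "mat2_diag a b = (\<chi> i j. if i = j then (if i = 1 then a else b) else 0)"

text \<open>The entrywise extension of \<open>\<psi>\<close> to \<open>C \<otimes> M\<^sub>2(B) \<rightarrow> M\<^sub>2(B) \<otimes> C\<close>, where \<open>B\<close> has carrier \<open>V\<close>
  and \<open>x\<close> is the sum of its entries \<open>x\<^sub>i\<^sub>j\<close> times the matrix units \<open>E\<^sub>i\<^sub>j\<close>: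
  \<open>c \<otimes> x\<close> is sent to the sum of the \<open>((x\<^sub>i\<^sub>j)\<^sub>\<psi> E\<^sub>i\<^sub>j) \<otimes> c\<^sup>\<psi>\<close>.\<close>

definition mat2_entwining ::
  "'r::complex_vector set \<Rightarrow> (('c::complex_vector, 'r) tensor \<Rightarrow> ('r, 'c) tensor)
     \<Rightarrow> ('c, 'r^2^2) tensor \<Rightarrow> ('r^2^2, 'c) tensor" where
  "mat2_entwining V \<psi> = tlift UNIV (mat2 V)
     (\<lambda>c x. \<Sum>i\<in>UNIV. \<Sum>j\<in>UNIV. tensor_map V UNIV (mat2_unit i j) id (\<psi> (c \<otimes> x $ i $ j)))"

definition mat2_inverse_pair ::
  "'r::complex_vector set \<Rightarrow> ('r \<Rightarrow> 'r \<Rightarrow> 'r) \<Rightarrow> 'r \<Rightarrow> 'r^2^2 \<Rightarrow> 'r^2^2 \<Rightarrow> bool" where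
  "mat2_inverse_pair V m e x y \<longleftrightarrow> x \<in> mat2 V \<and> y \<in> mat2 V \<and>
     mat2_mult m x y = mat2_diag e e \<and> mat2_mult m y x = mat2_diag e e"

definition mat2_entwined_units ::
  "'r::complex_vector set \<Rightarrow> ('r \<Rightarrow> 'r \<Rightarrow> 'r) \<Rightarrow> 'r
     \<Rightarrow> (('c::complex_vector, 'r) tensor \<Rightarrow> ('r, 'c) tensor) \<Rightarrow> ('r^2^2) set" where
  "mat2_entwined_units V m e \<psi> = {x. (\<exists>y. mat2_inverse_pair V m e x y) \<and>
     (\<forall>c. mat2_entwining V \<psi> (c \<otimes> x) = x \<otimes> c)}"

text \<open>Vanishing depends only on the degree-zero part of the cycle.\<close>

definition vanishing ::
  "('r::complex_vector, 'z) dga_scheme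
     \<Rightarrow> (('c::complex_vector, 'r) tensor \<Rightarrow> ('r, 'c) tensor) \<Rightarrow> bool" where
  "vanishing R \<Psi> \<longleftrightarrow> (\<exists>e. unit_on (piece R 0) (mul R) e \<and> (\<forall>c. \<Psi> (c \<otimes> e) = e \<otimes> c) \<and>
     (\<exists>\<nu> X Y. algebra_hom_on (piece R 0) (mul R) (piece R 0) (mul R) \<nu> \<and>
        (\<forall>t\<in>tensor_on UNIV (piece R 0). tensor_map (piece R 0) UNIV \<nu> id (\<Psi> t) =
           \<Psi> (tensor_map UNIV (piece R 0) id \<nu> t)) \<and>
        X \<in> mat2_entwined_units (piece R 0) (mul R) e \<Psi> \<and>
        mat2_inverse_pair (piece R 0) (mul R) e X Y \<and>
        (\<forall>a\<in>piece R 0. mat2_mult (mul R) (mat2_mult (mul R) X (mat2_diag a (\<nu> a))) Y =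
           mat2_diag 0 (\<nu> a))))"

text \<open>The type argument is the ambient vector space in which the graded algebra \<open>R\<close> is realised.\<close>

definition is_vanishing_character ::
  "'r::complex_vector itself \<Rightarrow> nat
     \<Rightarrow> ('c::complex_vector \<Rightarrow> ('c, 'c) tensor) \<Rightarrow> ('c \<Rightarrow> complex)
     \<Rightarrow> (('c, 'a::complex_algebra_1) tensor \<Rightarrow> ('a, 'c) tensor)
     \<Rightarrow> ('c \<Rightarrow> 'a list \<Rightarrow> complex) \<Rightarrow> bool" where
  "is_vanishing_character (_ :: 'r itself) n \<Delta> \<epsilon> \<psi> g \<longleftrightarrow>
     (\<exists>(R :: 'r dga) \<Psi> T \<rho>. entwined_cycle n \<psi> R \<Delta> \<epsilon> \<Psi> T \<rho> \<and> vanishing R \<Psi> \<and>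
        g = cycle_character n R T \<rho>)"

text \<open>A quantifier over all cycles involves a quantifier over vector spaces.  The vector space
  below contains a copy of every vector space of dimension at most the cardinality of
  \<open>(nat \<Rightarrow> nat \<Rightarrow> 'a) option list\<close>; in particular, it has room for the differential forms over
  the algebra of infinite matrices with entries in \<open>'a\<close>.\<close>

type_synonym 'a universe = "(nat \<Rightarrow> nat \<Rightarrow> 'a) option list \<Rightarrow>\<^sub>0 complex"

end

theory Submission
  imports Defs "HOL-Analysis.Henstock_Kurzweil_Integration" "HOL-Analysis.Cartesian_Space"
    "HOL-Library.Product_Plus" "HOL-Library.Countable"
begin

text \<open>
  \<^emph>\<open>A vanishing cycle has a coboundary as its character.\<close>  Let \<open>\<nu>\<close> and \<open>X\<close> be as in the definition of
  a vanishing cycle.  The trace of the cycle extends to matrices over it, and the character of a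
  block diagonal homomorphism is the sum of the characters of the blocks.  As \<open>X\<close> conjugates
  \<open>diag(\<rho>, \<nu> \<circ> \<rho>)\<close> into \<open>diag(0, \<nu> \<circ> \<rho>)\<close>, it is enough that conjugate homomorphisms have cohomologous
  characters: then \<open>\<chi>(\<rho>) + \<chi>(\<nu> \<circ> \<rho>)\<close> and \<open>\<chi>(\<nu> \<circ> \<rho>)\<close> differ by a coboundary.  Two conjugate
  homomorphisms \<open>G\<^sub>0\<close>, \<open>G\<^sub>1\<close> can be joined, after enlarging the matrices, by an affine path \<open>G\<^sub>t\<close> of
  homomorphisms with \<open>G\<^sub>t' = [N, G\<^sub>t]\<close> for a constant \<open>N\<close> that the entwining fixes.  The derivative
  of \<open>\<chi>(G\<^sub>t)\<close> is then the coboundary of an explicit cyclic cochain, obtained by inserting \<open>N\<close> into the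
  forms \<open>dG\<^sub>t(a\<^sub>1) \<dots> dG\<^sub>t(a\<^sub>n)\<close>, and integration over \<open>[0, 1]\<close> gives the claim; see
  \<open>path_characters_cohomologous\<close> and \<open>flabby_character_cobounds\<close>.

  \<^emph>\<open>A coboundary is the character of a vanishing cycle.\<close>  Let \<open>g = \<delta> h\<close> with \<open>h\<close> cyclic.  Consider
  words \<open>a\<^sub>0 F a\<^sub>1 F \<dots> F a\<^sub>m\<close> of degree \<open>m\<close> with an endomorphism \<open>x\<close> of a space of countable
  dimension as coefficient, of finite rank if \<open>m > 0\<close>.  The coefficient of the letter \<open>F\<close> is an operator \<open>f\<close>
  of rank one with \<open>f\<^sup>2 = 0\<close>; so \<open>F\<^sup>2 = 0\<close>, and the graded commutator with \<open>F\<close> is a differential.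
  Cyclicity of \<open>h\<close> makes \<open>T(c; x, a\<^sub>0 F \<dots> F a\<^sub>n) = tr(x) h(c\<^sup>\<psi>; a\<^sub>1, \<dots>, a\<^sub>n a\<^sub>0\<^sub>\<psi>)\<close> a graded entwined
  trace (\<open>closing_merge\<close>), which is closed because the differential is a commutator.  Embed \<open>A\<close> by
  \<open>a \<mapsto> e a\<close> for an idempotent \<open>e\<close> with \<open>e f e = e\<close>.  In the expansion of
  \<open>a\<^sub>0 [F, a\<^sub>1] \<dots> [F, a\<^sub>n]\<close> the relation \<open>F\<^sup>2 = 0\<close> leaves one word for every face of the coboundary
  (\<open>form_word\<close>), so that the character is \<open>\<delta> h = g\<close>.  The cycle is vanishing since its degree zero
  part contains all endomorphisms: the infinite repetition of an endomorphism absorbs one more copy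
  of it (\<open>vanishing_wdga\<close>).
\<close>

section \<open>Linear maps and Sweedler notation\<close>

abbreviation lin :: "('v::complex_vector \<Rightarrow> 'w::complex_vector) \<Rightarrow> bool" where
  "lin \<equiv> clinear_on UNIV"

abbreviation bil :: "('v::complex_vector \<Rightarrow> 'w::complex_vector \<Rightarrow> 'u::complex_vector) \<Rightarrow> bool" where
  "bil \<equiv> cbilinear_on UNIV UNIV"

abbreviation sweedler :: "('v::complex_vector \<Rightarrow> 'w::complex_vector \<Rightarrow> 'u::complex_vector)
    \<Rightarrow> ('v, 'w) tensor \<Rightarrow> 'u" where
  "sweedler \<equiv> tlift UNIV UNIV"

lemma linI:
  assumes "\<And>x y. f (x + y) = f x + f y" "\<And>k x. f (k *\<^sub>C x) = k *\<^sub>C f x"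
  shows "lin f"
  using assms by (auto simp: clinear_on_def)

lemma lin_iff_linear: "lin f \<longleftrightarrow> Vector_Spaces.linear scaleC scaleC f"
proof
  assume "lin f"
  then show "Vector_Spaces.linear scaleC scaleC f"
    by unfold_locales (auto simp: clinear_on_def)
next
  assume "Vector_Spaces.linear scaleC scaleC f"
  then interpret Vector_Spaces.linear scaleC scaleC f .
  show "lin f" by (intro linI add scale)
qed

lemma lin_add: "lin f \<Longrightarrow> f (x + y) = f x + f y"
  and lin_scale: "lin f \<Longrightarrow> f (k *\<^sub>C x) = k *\<^sub>C f x"
  by (auto simp: clinear_on_def)

lemma lin_zero: "lin f \<Longrightarrow> f 0 = 0"
  by (metis lin_iff_linear cvs_pair.linear_0)

lemma lin_diff: "lin f \<Longrightarrow> f (x - y) = f x - f y"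
  by (metis lin_iff_linear cvs_pair.linear_diff)

lemma lin_minus: "lin f \<Longrightarrow> f (- x) = - f x"
  by (metis lin_iff_linear cvs_pair.linear_neg)

lemma lin_sum: "lin f \<Longrightarrow> f (sum g S) = (\<Sum>x\<in>S. f (g x))"
  by (metis lin_iff_linear cvs_pair.linear_sum)

lemma bilD1: "bil f \<Longrightarrow> lin (\<lambda>x. f x y)" and bilD2: "bil f \<Longrightarrow> lin (f x)"
  by (auto simp: cbilinear_on_def)

lemma bilI: "(\<And>y. lin (\<lambda>x. f x y)) \<Longrightarrow> (\<And>x. lin (\<lambda>y. f x y)) \<Longrightarrow> bil f"
  by (auto simp: cbilinear_on_def)

lemma cbilinear_on_subset: "cbilinear_on V' W' f \<Longrightarrow> V \<subseteq> V' \<Longrightarrow> W \<subseteq> W' \<Longrightarrow> cbilinear_on V W f"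
  unfolding cbilinear_on_def clinear_on_def by blast

lemma lin_id: "lin (\<lambda>x. x)" and lin_const0: "lin (\<lambda>x. 0)"
  by (auto intro!: linI)

lemma lin_comp: "lin f \<Longrightarrow> lin g \<Longrightarrow> lin (\<lambda>x. f (g x))"
  by (auto intro!: linI simp: lin_add lin_scale)

lemma lin_plus: "lin f \<Longrightarrow> lin g \<Longrightarrow> lin (\<lambda>x. f x + g x)"
  by (auto intro!: linI simp: lin_add lin_scale scaleC_add_right algebra_simps)

lemma lin_scaleC: "lin f \<Longrightarrow> lin (\<lambda>x. k *\<^sub>C f x)"
  by (auto intro!: linI simp: lin_add lin_scale scaleC_add_right scaleC_scaleC mult.commute)

lemma lin_uminus: "lin f \<Longrightarrow> lin (\<lambda>x. - f x)"
  by (auto intro!: linI simp: lin_add lin_scale)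

lemma lin_minus2: "lin f \<Longrightarrow> lin g \<Longrightarrow> lin (\<lambda>x. f x - g x)"
  using lin_plus[OF _ lin_uminus, of f g] by simp

lemma lin_sum': "(\<And>i. i \<in> S \<Longrightarrow> lin (f i)) \<Longrightarrow> lin (\<lambda>x. \<Sum>i\<in>S. f i x)"
  by (auto intro!: linI simp: lin_add lin_scale sum.distrib cvs.scale_sum_right)

lemma lin_mult_const: "lin f \<Longrightarrow> lin (\<lambda>x. f x * (b :: 'b::complex_algebra_1))"
  and lin_const_mult: "lin f \<Longrightarrow> lin (\<lambda>x. (b :: 'b::complex_algebra_1) * f x)"
  by (auto intro!: linI simp: lin_add lin_scale distrib_left distrib_right mult_scaleC_left mult_scaleC_right)

lemma lin_cmult: "lin f \<Longrightarrow> lin (\<lambda>x. (b::complex) * f x)"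
  using lin_scaleC[of f b] by (simp add: scaleC_complex_def)

lemma lin_scaleC_left: "lin f \<Longrightarrow> lin (\<lambda>x. f x *\<^sub>C b)"
  by (auto intro!: linI simp: lin_add lin_scale scaleC_add_left scaleC_scaleC scaleC_complex_def)

lemma lin_tens1: "lin f \<Longrightarrow> lin (\<lambda>x. f x \<otimes> b)" and lin_tens2: "lin g \<Longrightarrow> lin (\<lambda>x. b \<otimes> g x)"
  by (auto intro!: linI simp: lin_add lin_scale tens_bilinear)

lemma scaleC_zero_right [simp]: "k *\<^sub>C 0 = 0" and scaleC_zero_left [simp]: "0 *\<^sub>C x = 0"
  by (rule cvs.scale_zero_right, rule cvs.scale_zero_left)

lemma tens_zero [simp]: "0 \<otimes> w = 0" "v \<otimes> 0 = 0"
  using tens_bilinear(3)[of 0 0 w] tens_bilinear(4)[of v 0 0] by simp_all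

lemma subspace_UNIV: "cvs.subspace UNIV"
  by (simp add: cvs.subspace_def)

lemma poly_mapping_eq_sum_single:
  fixes p :: "'k \<Rightarrow>\<^sub>0 'b::comm_monoid_add"
  shows "p = (\<Sum>k\<in>Poly_Mapping.keys p. Poly_Mapping.single k (Poly_Mapping.lookup p k))"
proof (rule poly_mapping_eqI)
  fix x
  have "(\<Sum>k\<in>Poly_Mapping.keys p. Poly_Mapping.lookup p k when k = x) = Poly_Mapping.lookup p x"
    by (cases "x \<in> Poly_Mapping.keys p") (auto simp: when_def in_keys_iff sum.delta)
  then show "Poly_Mapping.lookup p x = Poly_Mapping.lookup (\<Sum>k\<in>Poly_Mapping.keys p.
      Poly_Mapping.single k (Poly_Mapping.lookup p k)) x"
    by (simp only: lookup_sum lookup_single)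
qed

lemma poly_mapping_single_induct [case_names zero single add]:
  fixes p :: "'k \<Rightarrow>\<^sub>0 'b::comm_monoid_add"
  assumes "P 0" "\<And>k v. P (Poly_Mapping.single k v)" "\<And>p q. P p \<Longrightarrow> P q \<Longrightarrow> P (p + q)"
  shows "P p"
proof -
  have "P (\<Sum>k\<in>K. Poly_Mapping.single k (Poly_Mapping.lookup p k))" for K
    by (induction K rule: infinite_finite_induct) (auto intro: assms)
  from this[of "Poly_Mapping.keys p"] show ?thesis
    by (simp only: poly_mapping_eq_sum_single[symmetric])
qed

lemma tensor_on_UNIV: "tensor_on UNIV UNIV = (UNIV :: ('v::complex_vector, 'w::complex_vector) tensor set)"
proof -
  have "t \<in> tensor_on UNIV UNIV" for t :: "('v, 'w) tensor"
  proof -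
    define p where "p = rep_tensor t"
    have t: "t = abs_tensor p" by (simp add: p_def Quotient3_abs_rep[OF Quotient3_tensor])
    have "abs_tensor (p :: 'v \<times> 'w \<Rightarrow>\<^sub>0 complex) \<in> tensor_on UNIV UNIV"
    proof (induction p rule: poly_mapping_single_induct)
      case (single k v)
      obtain a b where k: "k = (a, b)" by (cases k)
      have *: "abs_tensor (Poly_Mapping.single k v) = v *\<^sub>C (a \<otimes> b)"
        unfolding tens.abs_eq scaleC_tensor.abs_eq k
        by (rule arg_cong[of _ _ abs_tensor]) (auto intro!: poly_mapping_eqI simp: lookup_scaleC lookup_single scaleC_complex_def when_def)
      have "a \<otimes> b \<in> tensor_on UNIV UNIV" unfolding tensor_on_def by (rule cvs.span_base) blast
      then show ?case unfolding * unfolding tensor_on_def by (rule cvs.span_scale)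
    next
      case (add p q)
      then show ?case
        unfolding plus_tensor.abs_eq[symmetric] tensor_on_def by (intro cvs.span_add)
    qed (simp add: zero_tensor.abs_eq[symmetric] tensor_on_def cvs.span_zero)
    then show ?thesis by (simp add: t)
  qed
  then show ?thesis by blast
qed

lemma tens_in: "v \<in> V \<Longrightarrow> w \<in> W \<Longrightarrow> v \<otimes> w \<in> tensor_on V W"
  by (auto simp: tensor_on_def intro!: cvs.span_base)

lemma subspace_tensor_on: "cvs.subspace (tensor_on V W)"
  by (simp add: tensor_on_def)

lemma tlift_tens:
  assumes "cvs.subspace V" "cvs.subspace W" "cbilinear_on V W \<beta>" "v \<in> V" "w \<in> W"
  shows "tlift V W \<beta> (v \<otimes> w) = \<beta> v w"
  using tlift_eq[OF assms(1-3), of "[(v, w)]"] assms by simp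

lemma clinear_on_tlift:
  assumes V: "cvs.subspace V" and W: "cvs.subspace W" and b: "cbilinear_on V W \<beta>"
  shows "clinear_on (tensor_on V W) (tlift V W \<beta>)"
  unfolding clinear_on_def
proof (intro conjI ballI allI)
  fix s t assume "s \<in> tensor_on V W" "t \<in> tensor_on V W"
  then obtain ps qs where s: "s = (\<Sum>(v, w)\<leftarrow>ps. v \<otimes> w)" "set ps \<subseteq> V \<times> W"
    and t: "t = (\<Sum>(v, w)\<leftarrow>qs. v \<otimes> w)" "set qs \<subseteq> V \<times> W"
    unfolding tensor_on_eq[OF V W] by blast
  have "s + t = (\<Sum>(v, w)\<leftarrow>ps @ qs. v \<otimes> w)" by (simp add: s t)
  then show "tlift V W \<beta> (s + t) = tlift V W \<beta> s + tlift V W \<beta> t"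
    using s(2) t(2) by (simp only: tlift_eq[OF V W b] s(1) t(1) set_append Un_subset_iff) simp
next
  fix k s assume "s \<in> tensor_on V W"
  then obtain ps where s: "s = (\<Sum>(v, w)\<leftarrow>ps. v \<otimes> w)" "set ps \<subseteq> V \<times> W"
    unfolding tensor_on_eq[OF V W] by blast
  define qs where "qs = map (\<lambda>(v, w). (k *\<^sub>C v, w)) ps"
  have qs: "set qs \<subseteq> V \<times> W" using s(2) cvs.subspace_scale[OF V] by (auto simp: qs_def)
  have "k *\<^sub>C s = (\<Sum>(v, w)\<leftarrow>qs. v \<otimes> w)"
    unfolding s(1) qs_def by (induction ps) (auto simp: tens_bilinear scaleC_add_right)
  then have "tlift V W \<beta> (k *\<^sub>C s) = (\<Sum>(v, w)\<leftarrow>qs. \<beta> v w)"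
    by (simp only: tlift_eq[OF V W b qs])
  also have "\<dots> = k *\<^sub>C (\<Sum>(v, w)\<leftarrow>ps. \<beta> v w)"
    using s(2) b unfolding qs_def
    by (induction ps) (auto simp: scaleC_add_right cbilinear_on_def clinear_on_def)
  finally show "tlift V W \<beta> (k *\<^sub>C s) = k *\<^sub>C tlift V W \<beta> s"
    by (simp add: tlift_eq[OF V W b s(2)] s(1))
qed

lemma tensor_on_induct [consumes 1, case_names tens add scale]:
  assumes "t \<in> tensor_on V W"
    and "\<And>v w. v \<in> V \<Longrightarrow> w \<in> W \<Longrightarrow> P (v \<otimes> w)"
    and "\<And>s t. P s \<Longrightarrow> P t \<Longrightarrow> P (s + t)" and "\<And>k s. P s \<Longrightarrow> P (k *\<^sub>C s)"
    and "V \<noteq> {}" "W \<noteq> {}"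
  shows "P t"
  using assms(1) unfolding tensor_on_def
proof (induction rule: cvs.span_induct_alt)
  case base
  obtain v w where "v \<in> V" "w \<in> W" using assms(5,6) by blast
  then have "P (0 *\<^sub>C (v \<otimes> w))" by (intro assms)
  then show ?case by simp
qed (use assms in auto)

lemma tensor_induct [case_names tens add scale]:
  assumes "\<And>v w. P (v \<otimes> w)"
    and "\<And>s t. P s \<Longrightarrow> P t \<Longrightarrow> P (s + t)" and "\<And>k s. P s \<Longrightarrow> P (k *\<^sub>C s)"
  shows "P t"
  by (rule tensor_on_induct[of t UNIV UNIV]) (auto simp: tensor_on_UNIV assms)

lemma sweedler_tens: "bil F \<Longrightarrow> sweedler F (v \<otimes> w) = F v w"
  by (simp add: tlift_tens subspace_UNIV)

lemma lin_sweedler: "bil F \<Longrightarrow> lin (sweedler F)"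
  using clinear_on_tlift[OF subspace_UNIV subspace_UNIV] by (simp add: tensor_on_UNIV)

lemmas sweedler_add = lin_add[OF lin_sweedler] and sweedler_scale = lin_scale[OF lin_sweedler]

text \<open>On \<open>V \<otimes> W\<close> a globally bilinear map induces the same linear map as its restriction to
  \<open>V \<times> W\<close>, which allows the carriers to be forgotten.\<close>

lemma tlift_eq_sweedler:
  assumes V: "cvs.subspace V" and W: "cvs.subspace W" and F: "bil F"
    and eq: "\<And>v w. v \<in> V \<Longrightarrow> w \<in> W \<Longrightarrow> \<beta> v w = F v w" and t: "t \<in> tensor_on V W"
  shows "tlift V W \<beta> t = sweedler F t"
proof -
  have b: "cbilinear_on V W \<beta>"
    using cbilinear_on_subset[OF F, of V W] V W eq
    unfolding cbilinear_on_def clinear_on_def by (auto simp: cvs.subspace_add cvs.subspace_scale)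
  obtain ps where s: "t = (\<Sum>(v, w)\<leftarrow>ps. v \<otimes> w)" "set ps \<subseteq> V \<times> W"
    using t unfolding tensor_on_eq[OF V W] by blast
  have "tlift V W \<beta> t = (\<Sum>(v, w)\<leftarrow>ps. \<beta> v w)"
    using tlift_eq[OF V W b s(2)] s(1) by simp
  also have "\<dots> = (\<Sum>(v, w)\<leftarrow>ps. F v w)"
    using s(2) eq by (intro arg_cong[of _ _ sum_list] map_cong) auto
  also have "\<dots> = sweedler F t"
    using tlift_eq[OF subspace_UNIV subspace_UNIV F, of ps] s(1) by simp
  finally show ?thesis .
qed

lemma lin_comp_sweedler:
  assumes h: "lin h" and F: "bil F"
  shows "h (sweedler F t) = sweedler (\<lambda>v w. h (F v w)) t"
proof -
  have F': "bil (\<lambda>v w. h (F v w))"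
    using bilD1[OF F] bilD2[OF F] by (auto intro!: bilI intro: lin_comp[OF h])
  show ?thesis
  proof (induction t rule: tensor_induct)
    case tens then show ?case by (simp add: sweedler_tens F F')
  qed (simp_all add: sweedler_add sweedler_scale F F' lin_add[OF h] lin_scale[OF h])
qed

lemma bil_plus: "bil F \<Longrightarrow> bil H \<Longrightarrow> bil (\<lambda>v w. F v w + H v w)"
  by (auto intro!: bilI lin_plus dest: bilD1 bilD2)

lemma bil_scaleC: "bil F \<Longrightarrow> bil (\<lambda>v w. k *\<^sub>C F v w)"
  by (auto intro!: bilI lin_scaleC dest: bilD1 bilD2)

lemma sweedler_fun_plus:
  assumes F: "bil F" and H: "bil H"
  shows "sweedler (\<lambda>v w. F v w + H v w) t = sweedler F t + sweedler H t"
proof (induction t rule: tensor_induct)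
  case (tens v w)
  show ?case by (simp only: sweedler_tens[OF bil_plus[OF F H]] sweedler_tens[OF F] sweedler_tens[OF H])
next
  case (add s t)
  then show ?case
    by (simp only: sweedler_add[OF bil_plus[OF F H]] sweedler_add[OF F] sweedler_add[OF H] add_ac)
next
  case (scale k s)
  then show ?case
    by (simp only: sweedler_scale[OF bil_plus[OF F H]] sweedler_scale[OF F] sweedler_scale[OF H]
        scaleC_add_right)
qed

lemma sweedler_fun_scale:
  assumes F: "bil F"
  shows "sweedler (\<lambda>v w. k *\<^sub>C F v w) t = k *\<^sub>C sweedler F t"
  using lin_comp_sweedler[OF lin_scaleC[OF lin_id] F, of k t] by simp

lemma lin_sweedler_arg:
  assumes b: "\<And>x. bil (H x)" and l: "\<And>v w. lin (\<lambda>x. H x v w)"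
  shows "lin (\<lambda>x. sweedler (H x) t)"
proof (rule linI)
  show "sweedler (H (x + y)) t = sweedler (H x) t + sweedler (H y) t" for x y
    unfolding lin_add[OF l] by (rule sweedler_fun_plus[OF b b])
  show "sweedler (H (k *\<^sub>C x)) t = k *\<^sub>C sweedler (H x) t" for k x
    unfolding lin_scale[OF l] by (rule sweedler_fun_scale[OF b])
qed

lemma bil_sweedler_arg:
  assumes "\<And>x y. bil (H x y)" "\<And>x y v w. bil (\<lambda>x y. H x y v w)"
  shows "bil (\<lambda>x y. sweedler (H x y) t)"
proof (rule bilI)
  show "lin (\<lambda>x. sweedler (H x y) t)" for y
    by (rule lin_sweedler_arg) (rule assms(1), rule bilD1[OF assms(2)])
  show "lin (\<lambda>y. sweedler (H x y) t)" for x
    by (rule lin_sweedler_arg) (rule assms(1), rule bilD2[OF assms(2)])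
qed

lemma sweedler_in_subspace:
  assumes S: "cvs.subspace S" and V: "cvs.subspace V" and W: "cvs.subspace W" and F: "bil F"
    and "\<And>v w. v \<in> V \<Longrightarrow> w \<in> W \<Longrightarrow> F v w \<in> S" and t: "t \<in> tensor_on V W"
  shows "sweedler F t \<in> S"
  using t
proof (induction rule: tensor_on_induct)
  case (tens v w) then show ?case by (simp add: sweedler_tens F assms)
next
  case (add s t) then show ?case by (simp add: sweedler_add F cvs.subspace_add[OF S])
next
  case (scale k s) then show ?case by (simp add: sweedler_scale F cvs.subspace_scale[OF S])
qed (use cvs.subspace_0[OF V] cvs.subspace_0[OF W] in auto)

lemma sweedler_commute:
  assumes "\<And>x y. bil (\<lambda>v w. F v w x y)" "\<And>v w. bil (\<lambda>x y. F v w x y)"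
  shows "sweedler (\<lambda>v w. sweedler (\<lambda>x y. F v w x y) u) t = sweedler (\<lambda>x y. sweedler (\<lambda>v w. F v w x y) t) u"
proof -
  have a: "bil (\<lambda>v w. sweedler (\<lambda>x y. F v w x y) u)" 
    by (rule bil_sweedler_arg) (rule assms)+
  have b: "bil (\<lambda>x y. sweedler (\<lambda>v w. F v w x y) t)" for t
    by (rule bil_sweedler_arg) (rule assms)+
  show ?thesis
  proof (induction t rule: tensor_induct)
    case (tens v w)
    show ?case by (simp only: sweedler_tens[OF a] sweedler_tens[OF assms(1)])
  next
    case (add s t)
    then show ?case
      by (simp only: sweedler_add[OF a] sweedler_add[OF assms(1)] sweedler_fun_plus[OF b b])
  next
    case (scale k s)
    then show ?case
      by (simp only: sweedler_scale[OF a] sweedler_scale[OF assms(1)] sweedler_fun_scale[OF b])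
  qed
qed

section \<open>Algebras of endomorphisms\<close>

text \<open>An algebra that is only given on a carrier acts faithfully on its unitization.  Inside the type of
all endomorphisms of the latter it can be treated with the algebraic laws of the type class.\<close>
typedef (overloaded) 'v endo = "{f :: 'v::complex_vector \<Rightarrow> 'v. lin f}" morphisms app Endo
  using lin_id by blast

setup_lifting type_definition_endo

lemma lin_app: "lin (app f)"
  using app by blast

lemma app_Endo: "lin f \<Longrightarrow> app (Endo f) = f"
  by (simp add: Endo_inverse)

lemma endo_eqI: "(\<And>x. app f x = app g x) \<Longrightarrow> f = g"
  by (metis app_inject ext)

instantiation endo :: (complex_vector) complex_algebra_1
begin
lift_definition zero_endo :: "'a endo" is "\<lambda>x. 0" by (rule lin_const0)
lift_definition one_endo :: "'a endo" is "\<lambda>x. x" by (rule lin_id)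
lift_definition plus_endo :: "'a endo \<Rightarrow> 'a endo \<Rightarrow> 'a endo" is "\<lambda>f g x. f x + g x" by (rule lin_plus)
lift_definition minus_endo :: "'a endo \<Rightarrow> 'a endo \<Rightarrow> 'a endo" is "\<lambda>f g x. f x - g x" by (rule lin_minus2)
lift_definition uminus_endo :: "'a endo \<Rightarrow> 'a endo" is "\<lambda>f x. - f x" by (rule lin_uminus)
lift_definition times_endo :: "'a endo \<Rightarrow> 'a endo \<Rightarrow> 'a endo" is "\<lambda>f g x. f (g x)" by (rule lin_comp)
lift_definition scaleC_endo :: "complex \<Rightarrow> 'a endo \<Rightarrow> 'a endo" is "\<lambda>k f x. k *\<^sub>C f x" by (rule lin_scaleC)
instance
  by (standard; transfer)
    (auto simp: fun_eq_iff lin_add lin_scale scaleC_add_right scaleC_add_left scaleC_scaleC scaleC_one)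
end

lemmas app_simps = zero_endo.rep_eq one_endo.rep_eq plus_endo.rep_eq minus_endo.rep_eq
  uminus_endo.rep_eq times_endo.rep_eq scaleC_endo.rep_eq

lemma lin_app_left: "lin (\<lambda>f. app f x)"
  by (auto intro!: linI simp: app_simps)

section \<open>Extension of linear maps from subspaces\<close>

text \<open>Precomposed with such a projection, a map that is linear on a subspace becomes linear everywhere.\<close>
lemma exists_linear_projection:
  assumes S: "cvs.subspace S"
  obtains P :: "'x::complex_vector \<Rightarrow> 'x" where "lin P" "\<And>x. P x \<in> S" "\<And>x. x \<in> S \<Longrightarrow> P x = x"
proof -
  obtain g where "range g \<subseteq> S" "Vector_Spaces.linear scaleC scaleC g" "\<forall>x\<in>S. g (id x) = x"
    using cvs_pair.linear_exists_left_inverse_on[OF cvs.linear_id S] by auto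
  then show ?thesis by (intro that[of g]) (auto simp: lin_iff_linear)
qed

lemma lin_of_clinear_on:
  assumes "clinear_on S f" "lin P" "\<And>x. P x \<in> S"
  shows "lin (\<lambda>x. f (P x))"
  using assms by (auto intro!: linI simp: clinear_on_def)

lemma lin_eq_on_span:
  assumes "x \<in> cvs.span B" "lin f" "lin g" "\<And>b. b \<in> B \<Longrightarrow> f b = g b"
  shows "f x = g x"
  using assms(1)
  by (induction rule: cvs.span_induct_alt) (auto simp: assms lin_zero lin_add lin_scale)

lemma lin_in_subspace_on_span:
  assumes "x \<in> cvs.span B" "lin f" "cvs.subspace S" "\<And>b. b \<in> B \<Longrightarrow> f b \<in> S"
  shows "f x \<in> S"
  using assms(1)
  by (induction rule: cvs.span_induct_alt)
    (auto simp: assms lin_zero lin_add lin_scale cvs.subspace_0 cvs.subspace_add cvs.subspace_scale)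

section \<open>Alternating sums over the inner faces\<close>

text \<open>The part of the coboundary that multiplies neighbouring letters.  The recursion on the first letter
makes the alternating sum over positions accessible to induction.\<close>
fun alt_faces :: "('a::times list \<Rightarrow> 'u::ab_group_add) \<Rightarrow> 'a list \<Rightarrow> 'u" where
  "alt_faces F (a # b # as) = - F (a * b # as) - alt_faces (\<lambda>l. F (a # l)) (b # as)"
| "alt_faces F as = 0"

lemma alt_faces_lin: "lin h \<Longrightarrow> h (alt_faces F as) = alt_faces (\<lambda>l. h (F l)) as"
  by (induction F as rule: alt_faces.induct) (auto simp: lin_zero lin_minus lin_diff)

lemma alt_faces_add: "alt_faces (\<lambda>l. F l + G l) as = alt_faces F as + alt_faces G as"
proof (induction F as arbitrary: G rule: alt_faces.induct)
  case (1 F a b as)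
  show ?case by (simp add: 1[of "\<lambda>l. G (a # l)"])
qed auto

lemma alt_faces_cong:
  "(\<And>l. Suc (length l) = length as \<Longrightarrow> F l = G l) \<Longrightarrow> alt_faces F as = alt_faces G as"
proof (induction F as arbitrary: G rule: alt_faces.induct)
  case (1 F a b as)
  have "alt_faces (\<lambda>l. F (a # l)) (b # as) = alt_faces (\<lambda>l. G (a # l)) (b # as)"
    by (rule 1(1)) (use 1(2) in auto)
  then show ?case using 1(2)[of "a * b # as"] by simp
qed auto

lemma alt_faces_snoc:
  fixes F :: "'a::monoid_mult list \<Rightarrow> 'u::complex_vector"
  shows "alt_faces F (a # as @ [b]) = alt_faces (\<lambda>l. F (l @ [b])) (a # as)
     + (- 1) ^ Suc (length as) *\<^sub>C F (butlast (a # as) @ [last (a # as) * b])"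
proof (induction as arbitrary: F a)
  case Nil
  then show ?case by (simp add: cvs.scale_minus_left scaleC_one)
next
  case (Cons c as)
  show ?case using Cons[of "\<lambda>l. F (a # l)" c] by (simp add: cvs.scale_minus_left)
qed

lemma sum_from_1: "(\<Sum>i = 1..Suc m. f i) = f 1 + (\<Sum>i = 1..m. f (Suc i))"
  for f :: "nat \<Rightarrow> 'b::comm_monoid_add"
  by (subst sum.atLeast_Suc_atMost) (simp_all only: One_nat_def le_add1 plus_1_eq_Suc Suc_le_mono le0 sum.shift_bounds_cl_Suc_ivl)

lemma face_sum_eq_alt_faces:
  fixes F :: "'a::monoid_mult list \<Rightarrow> complex"
  shows "(\<Sum>i = 1..length as. (- 1) ^ i * F (take (i - 1) (a # as) @ [(a # as) ! (i - 1) * (a # as) ! i] @ drop (i + 1) (a # as)))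
     = alt_faces F (a # as)"
proof (induction as arbitrary: F a)
  case Nil
  then show ?case by simp
next
  case (Cons b as)
  let ?f = "\<lambda>i. (- 1) ^ i * F (take (i - 1) (a # b # as) @ [(a # b # as) ! (i - 1) * (a # b # as) ! i] @ drop (i + 1) (a # b # as))"
  have "(\<Sum>i = 1..length (b # as). ?f i) = ?f 1 + (\<Sum>i = 1..length as. ?f (Suc i))"
    using sum_from_1[of ?f "length as"] by simp
  also have "(\<Sum>i = 1..length as. ?f (Suc i)) = - alt_faces (\<lambda>l. F (a # l)) (b # as)"
    unfolding Cons[symmetric] sum_negf[symmetric]
  proof (rule sum.cong)
    fix i assume i: "i \<in> {1..length as}"
    then obtain j where "i = Suc j" by (cases i) auto
    then show "?f (Suc i) = - ((- 1) ^ i * F (a # take (i - 1) (b # as) @ [(b # as) ! (i - 1) * (b # as) ! i] @ drop (i + 1) (b # as)))"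
      by simp
  qed simp
  finally show ?case by simp
qed

lemma coboundary_map_eq:
  assumes "length as = Suc n"
  shows "coboundary_map \<psi> n g c (a # as) =
    sweedler (\<lambda>a' c'. g c' (butlast as @ [last as * a'])) (\<psi> (c \<otimes> a)) + alt_faces (g c) (a # as)"
proof -
  have "last (a # as) = last as" "as \<noteq> []" using assms by auto
  then show ?thesis
    using assms face_sum_eq_alt_faces[of "g c" a as] by (simp add: coboundary_map_def)
qed

section \<open>Characters along a path of conjugate homomorphisms\<close>

text \<open>In this section \<open>D a\<close> is the differential \<open>d (G a)\<close> of the image of \<open>a\<close> under a homomorphism \<open>G\<close>
into a differential graded algebra.\<close>
definition dform :: "('a \<Rightarrow> 'b::complex_algebra_1) \<Rightarrow> 'a list \<Rightarrow> 'b" where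
  "dform D as = prod_list (map D as)"

lemma dform_simps [simp]: "dform D [] = 1" "dform D (a # as) = D a * dform D as"
  by (auto simp: dform_def)

lemma dform_append: "dform D (as @ bs) = dform D as * dform D bs"
  by (simp add: dform_def)

text \<open>The sum over all ways to insert \<open>N\<close> into \<open>D a\<^sub>1 \<dots> D a\<^sub>m\<close>, at the two ends or between two factors.\<close>
fun insert_sum :: "'b::complex_algebra_1 \<Rightarrow> ('a \<Rightarrow> 'b) \<Rightarrow> 'a list \<Rightarrow> 'b" where
  "insert_sum N D [] = N"
| "insert_sum N D (a # as) = N * (D a * dform D as) + D a * insert_sum N D as"

text \<open>Here one factor \<open>D a\<^sub>i\<close> is replaced by \<open>b a\<^sub>i\<close>, with the sign \<open>(-1)\<^sup>i\<^sup>-\<^sup>1\<close> of moving a differential to that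
place.\<close>
fun bracket_sum :: "('a \<Rightarrow> 'b::complex_algebra_1) \<Rightarrow> ('a \<Rightarrow> 'b) \<Rightarrow> 'a list \<Rightarrow> 'b" where
  "bracket_sum b D [] = 0"
| "bracket_sum b D (a # as) = b a * dform D as - D a * bracket_sum b D as"

fun deriv_dform :: "('a \<Rightarrow> 'b::complex_algebra_1) \<Rightarrow> ('a \<Rightarrow> 'b) \<Rightarrow> 'a list \<Rightarrow> 'b" where
  "deriv_dform D' D [] = 0"
| "deriv_dform D' D (a # as) = D' a * dform D as + D a * deriv_dform D' D as"

lemma insert_sum_snoc:
  "insert_sum N D (as @ [b]) = insert_sum N D as * D b + dform D (as @ [b]) * N"
  by (induction as) (auto simp: dform_append algebra_simps)

lemma lin_dform: "lin D \<Longrightarrow> lin (\<lambda>a. dform D (us @ a # vs))"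
  by (simp add: dform_append lin_const_mult lin_mult_const)

lemma lin_insert_sum: "lin D \<Longrightarrow> lin (\<lambda>a. insert_sum N D (us @ a # vs))"
proof (induction us)
  case Nil
  then show ?case by (auto intro!: lin_plus lin_const_mult lin_mult_const)
next
  case (Cons u us)
  then show ?case
    using lin_dform[of D us vs] by (auto intro!: lin_plus lin_const_mult lin_mult_const)
qed

lemma scaleC_mult_simps:
  fixes x y :: "'b::complex_algebra_1"
  shows "(k *\<^sub>C x) * y = k *\<^sub>C (x * y)" "x * (k *\<^sub>C y) = k *\<^sub>C (x * y)"
  by (rule mult_scaleC_left, rule mult_scaleC_right)

text \<open>By the Leibniz rule each face is a sum of two products, and products of neighbouring faces cancel;
one product is left over at either end.\<close>
lemma alt_faces_dform:
  fixes G D :: "'a::complex_algebra_1 \<Rightarrow> 'b::complex_algebra_1"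
  assumes D: "\<And>a b. D (a * b) = D a * G b + G a * D b"
  shows "alt_faces (dform D) (a # as) =
    - (G a * dform D as) + (- 1) ^ length as *\<^sub>C (dform D (butlast (a # as)) * G (last (a # as)))"
proof (induction as arbitrary: a)
  case Nil
  then show ?case by (simp add: scaleC_one)
next
  case (Cons b bs)
  have "alt_faces (\<lambda>l. dform D (a # l)) (b # bs) = D a * alt_faces (dform D) (b # bs)"
    using alt_faces_lin[OF lin_const_mult[OF lin_id], of "D a" "dform D" "b # bs"] by simp
  then show ?case
    using Cons[of b]
    by (simp add: D algebra_simps scaleC_mult_simps cvs.scale_minus_left)
qed

text \<open>The cancellation is that of \<open>dform\<close> except where \<open>N\<close> separates the two products that would cancel:
there a commutator with \<open>N\<close> remains.\<close>
lemma alt_faces_insert_sum: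
  fixes G D :: "'a::complex_algebra_1 \<Rightarrow> 'b::complex_algebra_1"
  assumes D: "\<And>a b. D (a * b) = D a * G b + G a * D b"
  shows "alt_faces (insert_sum N D) (a # as) =
    - (G a * insert_sum N D as)
    + (- 1) ^ length as *\<^sub>C (insert_sum N D (butlast (a # as)) * G (last (a # as)))
    - bracket_sum (\<lambda>a. N * G a - G a * N) D (a # as)"
proof (induction as arbitrary: a)
  case Nil
  then show ?case by (simp add: scaleC_one)
next
  case (Cons b bs)
  have "alt_faces (\<lambda>l. insert_sum N D (a # l)) (b # bs)
      = N * (D a * alt_faces (dform D) (b # bs)) + D a * alt_faces (insert_sum N D) (b # bs)"
    using alt_faces_lin[OF lin_const_mult[OF lin_id], of "N * D a" "dform D" "b # bs"]
      alt_faces_lin[OF lin_const_mult[OF lin_id], of "D a" "insert_sum N D" "b # bs"]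
    by (simp add: alt_faces_add mult.assoc)
  then show ?case
    using Cons[of b] alt_faces_dform[where D = D and G = G, OF D, of b bs]
    by (simp add: D algebra_simps scaleC_mult_simps cvs.scale_minus_left scaleC_add_right)
qed

locale closed_trace =
  fixes M :: "nat \<Rightarrow> 'b::complex_algebra_1 set" and d :: "'b \<Rightarrow> 'b"
    and T :: "'c::complex_vector \<Rightarrow> 'b \<Rightarrow> complex" and n :: nat
  assumes M_sub: "cvs.subspace (M i)"
    and M_mult: "x \<in> M i \<Longrightarrow> y \<in> M j \<Longrightarrow> x * y \<in> M (i + j)"
    and d_lin: "lin d"
    and d_deg: "x \<in> M i \<Longrightarrow> d x \<in> M (Suc i)"
    and Leibniz: "x \<in> M i \<Longrightarrow> y \<in> M j \<Longrightarrow> d (x * y) = d x * y + (- 1) ^ i *\<^sub>C (x * d y)"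
    and d_d: "x \<in> M i \<Longrightarrow> d (d x) = 0"
    and T_bil: "bil T"
    and closed: "x \<in> M m \<Longrightarrow> n = Suc m \<Longrightarrow> T c (d x) = 0"

text \<open>The homomorphism \<open>G\<close> turns the entwining of the target into \<open>\<psi>\<close>, and \<open>N\<close> may be moved around the
trace without a twist.  Only these consequences of an entwining of the target matter for the
character of \<open>G\<close>.\<close>
locale trace_hom = closed_trace M d T n
  for M :: "nat \<Rightarrow> 'b::complex_algebra_1 set" and d :: "'b \<Rightarrow> 'b"
    and T :: "'c::complex_vector \<Rightarrow> 'b \<Rightarrow> complex" and n :: nat +
  fixes \<psi> :: "('c, 'a::complex_algebra_1) tensor \<Rightarrow> ('a, 'c) tensor" and G :: "'a \<Rightarrow> 'b" and N :: 'b
  assumes G_lin: "lin G" and G_mult: "G (a * b) = G a * G b" and G_M: "G a \<in> M 0" and N_M: "N \<in> M 0"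
    and trace_G: "\<omega> \<in> M n \<Longrightarrow> T c (G a * \<omega>) = sweedler (\<lambda>a' c'. T c' (\<omega> * G a')) (\<psi> (c \<otimes> a))"
    and trace_dG: "\<omega> \<in> M k \<Longrightarrow> n = Suc k \<Longrightarrow>
      T c (d (G a) * \<omega>) = (- 1) ^ k * sweedler (\<lambda>a' c'. T c' (\<omega> * d (G a'))) (\<psi> (c \<otimes> a))"
    and trace_N: "\<omega> \<in> M n \<Longrightarrow> T c (N * \<omega>) = T c (\<omega> * N)"
begin

abbreviation "dG \<equiv> \<lambda>a. d (G a)"

lemma dG_M: "dG a \<in> M (Suc 0)"
  by (rule d_deg[OF G_M])

lemma dG_lin: "lin dG"
  by (rule lin_comp[OF d_lin G_lin])

lemma dG_mult: "dG (a * b) = dG a * G b + G a * dG b"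
  by (simp add: G_mult Leibniz[OF G_M G_M] scaleC_one)

lemma mult_dform_M: "x \<in> M i \<Longrightarrow> x * dform dG as \<in> M (i + length as)"
proof (induction as arbitrary: x i)
  case (Cons a as)
  show ?case using Cons(1)[OF M_mult[OF Cons(2) dG_M]] by (simp add: mult.assoc)
qed simp

lemma d_mult_dform: "x \<in> M i \<Longrightarrow> d (x * dform dG as) = d x * dform dG as"
proof (induction as arbitrary: x i)
  case (Cons a as)
  have "d (x * dG a) = d x * dG a"
    by (simp add: Leibniz[OF Cons(2) dG_M] d_d[OF G_M])
  then show ?case using Cons(1)[OF M_mult[OF Cons(2) dG_M]] by (simp add: mult.assoc)
qed simp

lemma dform_M: "dform dG (a # as) \<in> M (length (a # as))"
  using mult_dform_M[OF dG_M, of a as] by simp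

lemma insert_sum_M: "insert_sum N dG as \<in> M (length as)"
proof (induction as)
  case (Cons a as)
  show ?case
    using mult_dform_M[OF N_M, of "a # as"] M_mult[OF dG_M Cons] by (auto intro!: cvs.subspace_add M_sub)
qed (simp add: N_M)

lemma bracket_M: "N * G a - G a * N \<in> M 0"
  using M_mult[OF N_M G_M] M_mult[OF G_M N_M] by (auto intro!: cvs.subspace_diff M_sub)

abbreviation "bracket \<equiv> \<lambda>a. N * G a - G a * N"

lemma bracket_sum_M: "bracket_sum bracket dG (a # as) \<in> M (length as)"
proof (induction as arbitrary: a)
  case Nil
  then show ?case using bracket_M by simp
next
  case (Cons b as)
  have "bracket a * dform dG (b # as) \<in> M (length (b # as))"
    using mult_dform_M[OF bracket_M, of a "b # as"] by simp
  moreover have "dG a * bracket_sum bracket dG (b # as) \<in> M (length (b # as))"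
    using M_mult[OF dG_M Cons[of b], of a] by (simp del: bracket_sum.simps)
  ultimately show ?case
    by (simp only: bracket_sum.simps(2)[of _ _ a] cvs.subspace_diff[OF M_sub])
qed

lemma d_bracket_sum: "d (bracket_sum bracket dG as) = deriv_dform (\<lambda>a. d (bracket a)) dG as"
proof (induction as)
  case (Cons a as)
  have "d (dG a * bracket_sum bracket dG as) = - (dG a * d (bracket_sum bracket dG as))"
  proof (cases as)
    case (Cons b bs)
    show ?thesis
      unfolding Cons using Leibniz[OF dG_M bracket_sum_M, of a b bs] d_d[OF G_M, of a]
      by (simp add: cvs.scale_minus_left scaleC_one del: bracket_sum.simps)
  qed (simp add: lin_zero[OF d_lin])
  then show ?case
    by (simp only: bracket_sum.simps deriv_dform.simps lin_diff[OF d_lin] d_mult_dform[OF bracket_M] Cons) simp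
qed (simp add: lin_zero[OF d_lin])

lemmas T_lin = bilD2[OF T_bil]

text \<open>The two arguments of \<open>T\<close> differ by the differential of \<open>G a * bracket_sum bracket dG as\<close>.  The right
hand side is the derivative of the character in the direction \<open>bracket\<close>.\<close>
lemma trace_bracket_sum:
  assumes n: "n = Suc k" and as: "length as = n"
  shows "T c (bracket_sum bracket dG (a # as)) =
    T c (bracket a * dform dG as + G a * deriv_dform (\<lambda>a. d (bracket a)) dG as)"
proof -
  have M: "bracket_sum bracket dG as \<in> M k"
    using n as bracket_sum_M by (cases as) (auto simp del: bracket_sum.simps)
  have "d (G a * bracket_sum bracket dG as)
      = dG a * bracket_sum bracket dG as + G a * deriv_dform (\<lambda>a. d (bracket a)) dG as"
    by (simp add: Leibniz[OF G_M M] d_bracket_sum scaleC_one)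
  moreover have "T c (d (G a * bracket_sum bracket dG as)) = 0"
    using closed[OF M_mult[OF G_M M]] n by simp
  ultimately show ?thesis
    by (simp add: lin_add[OF T_lin] lin_diff[OF T_lin] add_eq_0_iff)
qed

text \<open>The insertion of \<open>N\<close> in front is left out: its trace is that of the insertion at the end, and
cyclicity requires every gap of the cyclic word to be counted once.\<close>
definition primitive :: "'c \<Rightarrow> 'a list \<Rightarrow> complex" where
  "primitive c as = (if length as = n then - T c (insert_sum N dG as - N * dform dG as) else 0)"

lemma primitive_cochain:
  assumes n: "n = Suc k"
  shows "primitive \<in> cochains k"
  unfolding cochains_def mem_Collect_eq
proof (intro conjI allI impI)
  fix as :: "'a list" assume "length as = k + 1"
  then have "length as = n" using n by simp
  then show "lin (\<lambda>c. primitive c as)"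
    by (simp add: primitive_def lin_uminus bilD1[OF T_bil])
next
  fix c and as :: "'a list" and i assume as: "length as = k + 1" "i < k + 1"
  then have "as[i := a] = take i as @ a # drop (Suc i) as" for a
    by (simp add: upd_conv_take_nth_drop)
  then have eq: "primitive c (as[i := a]) = - T c (insert_sum N dG (take i as @ a # drop (Suc i) as)
      - N * dform dG (take i as @ a # drop (Suc i) as))" for a
    using as n by (metis primitive_def length_list_update Suc_eq_plus1)
  show "lin (\<lambda>a. primitive c (as[i := a]))"
    unfolding eq
    by (intro lin_uminus lin_comp[OF T_lin] lin_minus2 lin_const_mult lin_dform lin_insert_sum dG_lin)
next
  fix c and as :: "'a list" assume "length as \<noteq> k + 1"
  then have "length as \<noteq> n" using n by simp
  then show "primitive c as = 0" by (simp add: primitive_def)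
qed

lemma primitive_Cons:
  "length as = k \<Longrightarrow> n = Suc k \<Longrightarrow> primitive c (a # as) = - T c (dG a * insert_sum N dG as)"
  unfolding primitive_def by (simp add: mult.assoc)

lemma primitive_snoc:
  assumes "length as = k" "n = Suc k"
  shows "primitive c (as @ [b]) = - T c (insert_sum N dG as * dG b)"
proof -
  have len: "length (as @ [b]) = n" using assms by simp
  have "dform dG (as @ [b]) \<in> M n"
    using len dform_M[of "hd (as @ [b])" "tl (as @ [b])"] by simp
  then show ?thesis
    unfolding primitive_def using len
    by (simp add: insert_sum_snoc lin_diff[OF T_lin] lin_add[OF T_lin] trace_N[symmetric])
qed

lemma primitive_cyclic:
  assumes n: "n = Suc k"
  shows "primitive \<in> cyclic_cochains \<psi> k"
  unfolding cyclic_cochains_def mem_Collect_eq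
proof (intro conjI allI impI primitive_cochain[OF n])
  fix c and as :: "'a list" assume as: "length as = k + 1"
  then obtain a as' where a: "as = a # as'" "length as' = k" by (cases as) auto
  have b: "bil (\<lambda>a' c'. T c' (insert_sum N dG as' * d (G a')))"
    by (intro bilI bilD1[OF T_bil] lin_comp[OF T_lin] lin_const_mult dG_lin)
  have "primitive c as = - ((- 1) ^ k * sweedler (\<lambda>a' c'. T c' (insert_sum N dG as' * d (G a'))) (\<psi> (c \<otimes> a)))"
    using a primitive_Cons[OF a(2) n] trace_dG[OF insert_sum_M[of as'], of c a] n by simp
  also have "\<dots> = (- 1) ^ k * sweedler (\<lambda>a' c'. primitive c' (as' @ [a'])) (\<psi> (c \<otimes> a))"
    unfolding primitive_snoc[OF a(2) n]
    by (simp only: lin_comp_sweedler[OF lin_uminus[OF lin_id] b, symmetric]) simp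
  finally show "primitive c as = (- 1) ^ k * sweedler (\<lambda>a' c'. primitive c' (tl as @ [a'])) (\<psi> (c \<otimes> hd as))"
    by (simp add: a)
qed

text \<open>The inner faces telescope to the bracket sum and outer terms.  The trace identities turn the outer
terms into sums over \<open>\<psi> (c \<otimes> a)\<close>, where they cancel against the remaining cyclic face.\<close>
lemma coboundary_primitive:
  assumes n: "n = Suc k" and as: "length as = n"
  shows "coboundary_map \<psi> k primitive c (a # as) = T c (bracket_sum bracket dG (a # as))"
proof -
  obtain mid z where as_eq: "as = mid @ [z]" and mid: "length mid = k"
    using as n by (metis append_butlast_last_id length_butlast diff_Suc_1 list.size(3) nat.distinct(1))
  let ?K = "insert_sum N dG" and ?t = "\<psi> (c \<otimes> a)"
  have TK: "bil (\<lambda>a' c'. T c' (x * f a'))" if "lin f" for x and f :: "'a \<Rightarrow> 'b"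
    by (intro bilI bilD1[OF T_bil] lin_comp[OF T_lin] lin_const_mult that)
  have "alt_faces (primitive c) (a # as) = alt_faces (\<lambda>l. - T c (?K l - N * dform dG l)) (a # as)"
    by (rule alt_faces_cong) (simp add: primitive_def as)
  also have "\<dots> = - T c (alt_faces (\<lambda>l. ?K l - N * dform dG l) (a # as))"
    by (rule alt_faces_lin[symmetric]) (intro lin_uminus T_lin)
  also have "alt_faces (\<lambda>l. ?K l - N * dform dG l) (a # as)
     = alt_faces ?K (a # as) + (- N) * alt_faces (dform dG) (a # as)"
    using alt_faces_add[of ?K "\<lambda>l. (- N) * dform dG l" "a # as"]
      alt_faces_lin[OF lin_const_mult[OF lin_id], of "- N" "dform dG" "a # as"] by simp
  also have "\<dots> = - (G a * ?K as) + (- 1) ^ n *\<^sub>C (dG a * ?K mid * G z) + N * G a * dform dG as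
      - bracket_sum bracket dG (a # as)"
    unfolding alt_faces_insert_sum[where D = dG and G = G, OF dG_mult] alt_faces_dform[where D = dG and G = G, OF dG_mult]
    by (simp add: as_eq mid n algebra_simps scaleC_mult_simps scaleC_add_right
        cvs.scale_minus_left cvs.scale_minus_right)
  finally have faces: "alt_faces (primitive c) (a # as) = T c (G a * ?K as)
      - (- 1) ^ n * T c (dG a * (?K mid * G z)) - T c (N * (G a * dform dG as)) + T c (bracket_sum bracket dG (a # as))"
    by (simp add: lin_add[OF T_lin] lin_diff[OF T_lin] lin_minus[OF T_lin] lin_scale[OF T_lin]
        scaleC_complex_def mult.assoc)
  have df: "dform dG as \<in> M n"
    using as n dform_M by (cases as) (auto simp del: dform_simps)
  have 1: "T c (G a * ?K as) = sweedler (\<lambda>a' c'. T c' (?K as * G a')) ?t"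
    using trace_G[of "?K as"] insert_sum_M[of as] as by simp
  have 2: "T c (dG a * (?K mid * G z)) = (- 1) ^ k * sweedler (\<lambda>a' c'. T c' (?K mid * G z * dG a')) ?t"
    using trace_dG[of "?K mid * G z" k] M_mult[OF insert_sum_M[of mid] G_M] mid n by simp
  have 3: "T c (N * (G a * dform dG as)) = sweedler (\<lambda>a' c'. T c' (dform dG as * N * G a')) ?t"
  proof -
    have "G a * dform dG as \<in> M n" using mult_dform_M[OF G_M, of a as] as by simp
    then have "T c (N * (G a * dform dG as)) = T c (G a * (dform dG as * N))"
      by (simp add: trace_N mult.assoc)
    also have "\<dots> = sweedler (\<lambda>a' c'. T c' (dform dG as * N * G a')) ?t"
      using trace_G[of "dform dG as * N"] M_mult[OF df N_M] by simp
    finally show ?thesis .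
  qed
  have 4: "sweedler (\<lambda>a' c'. primitive c' (butlast as @ [last as * a'])) ?t =
    - sweedler (\<lambda>a' c'. T c' (?K mid * dG z * G a')) ?t - sweedler (\<lambda>a' c'. T c' (?K mid * G z * dG a')) ?t"
  proof -
    have eq: "primitive c' (mid @ [z * a']) = - (T c' (?K mid * dG z * G a') + T c' (?K mid * G z * dG a'))" for a' c'
      unfolding primitive_snoc[OF mid n] by (simp only: dG_mult) (simp add: algebra_simps lin_add[OF T_lin])
    show ?thesis
      unfolding as_eq butlast_snoc last_snoc eq
      using lin_comp_sweedler[OF lin_uminus[OF lin_id] bil_plus[OF TK[OF G_lin] TK[OF dG_lin]],
          of "?K mid * dG z" "?K mid * G z" ?t, symmetric]
        sweedler_fun_plus[OF TK[OF G_lin] TK[OF dG_lin], of "?K mid * dG z" "?K mid * G z" ?t] by simp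
  qed
  have 5: "sweedler (\<lambda>a' c'. T c' (?K as * G a')) ?t = sweedler (\<lambda>a' c'. T c' (?K mid * dG z * G a')) ?t
      + sweedler (\<lambda>a' c'. T c' (dform dG as * N * G a')) ?t"
  proof -
    have eq: "T c' (?K as * G a') = T c' (?K mid * dG z * G a') + T c' (dform dG as * N * G a')" for a' c'
      unfolding as_eq insert_sum_snoc distrib_right lin_add[OF T_lin] ..
    show ?thesis unfolding eq by (rule sweedler_fun_plus[OF TK[OF G_lin] TK[OF G_lin]])
  qed
  have sgn: "(- 1) ^ n * (- 1) ^ k = (- 1 :: complex)"
    by (simp add: n power_mult_distrib[symmetric])
  have len: "length as = Suc k" using as n by simp
  show ?thesis
    unfolding coboundary_map_eq[OF len] faces 1 2 3 4 5
    by (simp add: mult.assoc[symmetric] sgn)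
qed

end


text \<open>The algebra carries no topology, so a path in it is differentiated after applying linear
functionals.\<close>
definition weak_deriv :: "(real \<Rightarrow> 'b::complex_vector) \<Rightarrow> (real \<Rightarrow> 'b) \<Rightarrow> bool" where
  "weak_deriv f f' \<longleftrightarrow> (\<forall>\<Lambda> :: 'b \<Rightarrow> complex. lin \<Lambda> \<longrightarrow>
     (\<forall>t. ((\<lambda>t. \<Lambda> (f t)) has_vector_derivative \<Lambda> (f' t)) (at t)))"

lemma weak_derivD:
  fixes \<Lambda> :: "'b::complex_vector \<Rightarrow> complex"
  shows "weak_deriv f f' \<Longrightarrow> lin \<Lambda> \<Longrightarrow> ((\<lambda>t. \<Lambda> (f t)) has_vector_derivative \<Lambda> (f' t)) (at t)"
  by (auto simp: weak_deriv_def)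

lemma weak_derivI:
  assumes "\<And>(\<Lambda> :: 'b::complex_vector \<Rightarrow> complex) t. lin \<Lambda> \<Longrightarrow> ((\<lambda>t. \<Lambda> (f t)) has_vector_derivative \<Lambda> (f' t)) (at t)"
  shows "weak_deriv f f'"
  using assms by (auto simp: weak_deriv_def)

lemma weak_deriv_continuous:
  fixes \<Lambda> :: "'b::complex_vector \<Rightarrow> complex"
  assumes "weak_deriv f f'" "lin \<Lambda>"
  shows "continuous_on S (\<lambda>t. \<Lambda> (f t))"
  using has_vector_derivative_continuous[OF weak_derivD[OF assms]]
  by (intro continuous_at_imp_continuous_on) blast

lemma weak_deriv_const: "weak_deriv (\<lambda>t. x) (\<lambda>t. 0)"
  by (rule weak_derivI) (simp add: lin_zero)

lemma weak_deriv_add: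
  assumes "weak_deriv f f'" "weak_deriv g g'"
  shows "weak_deriv (\<lambda>t. f t + g t) (\<lambda>t. f' t + g' t)"
proof (rule weak_derivI)
  fix \<Lambda> :: "'a \<Rightarrow> complex" and t assume \<Lambda>: "lin \<Lambda>"
  show "((\<lambda>t. \<Lambda> (f t + g t)) has_vector_derivative \<Lambda> (f' t + g' t)) (at t)"
    unfolding lin_add[OF \<Lambda>]
    by (rule has_vector_derivative_add[OF weak_derivD[OF assms(1) \<Lambda>] weak_derivD[OF assms(2) \<Lambda>]])
qed

lemma weak_deriv_const_mult:
  fixes f :: "real \<Rightarrow> 'b::complex_algebra_1"
  assumes "weak_deriv f f'"
  shows "weak_deriv (\<lambda>t. x * f t) (\<lambda>t. x * f' t)"
proof (rule weak_derivI)
  fix \<Lambda> :: "'b \<Rightarrow> complex" and t assume "lin \<Lambda>"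
  from lin_comp[OF this lin_const_mult[OF lin_id]]
  show "((\<lambda>t. \<Lambda> (x * f t)) has_vector_derivative \<Lambda> (x * f' t)) (at t)"
    by (rule weak_derivD[OF assms])
qed

lemma weak_deriv_affine_mult:
  fixes f :: "real \<Rightarrow> 'b::complex_algebra_1"
  assumes f: "weak_deriv f f'"
  shows "weak_deriv (\<lambda>t. (x + of_real t *\<^sub>C y) * f t) (\<lambda>t. y * f t + (x + of_real t *\<^sub>C y) * f' t)"
proof (rule weak_derivI)
  fix \<Lambda> :: "'b \<Rightarrow> complex" and t assume \<Lambda>: "lin \<Lambda>"
  have x: "((\<lambda>t. \<Lambda> (z * f t)) has_vector_derivative \<Lambda> (z * f' t)) (at t)" for z
    by (rule weak_derivD[OF weak_deriv_const_mult[OF f] \<Lambda>])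
  have "((\<lambda>t. \<Lambda> (x * f t) + of_real t * \<Lambda> (y * f t)) has_vector_derivative
      \<Lambda> (x * f' t) + (of_real t * \<Lambda> (y * f' t) + 1 * \<Lambda> (y * f t))) (at t)"
    by (intro has_vector_derivative_add x has_vector_derivative_mult)
      (auto intro!: derivative_eq_intros simp: has_vector_derivative_def scaleR_conv_of_real)
  then show "((\<lambda>t. \<Lambda> ((x + of_real t *\<^sub>C y) * f t)) has_vector_derivative
      \<Lambda> (y * f t + (x + of_real t *\<^sub>C y) * f' t)) (at t)"
    by (simp add: distrib_right scaleC_mult_simps lin_add[OF \<Lambda>] lin_scale[OF \<Lambda>] scaleC_complex_def add_ac)
qed

lemma weak_deriv_dform:
  fixes D0 D1 :: "'a \<Rightarrow> 'b::complex_algebra_1"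
  defines "D \<equiv> \<lambda>t a. D0 a + of_real t *\<^sub>C D1 a"
  shows "weak_deriv (\<lambda>t. dform (D t) as) (\<lambda>t. deriv_dform D1 (D t) as)"
proof (induction as)
  case (Cons a as)
  show ?case
    using weak_deriv_affine_mult[OF Cons, of "D0 a" "D1 a"] by (simp add: D_def)
qed (simp add: weak_deriv_const)

lemma weak_deriv_insert_sum:
  fixes D0 D1 :: "'a \<Rightarrow> 'b::complex_algebra_1"
  defines "D \<equiv> \<lambda>t a. D0 a + of_real t *\<^sub>C D1 a"
  shows "\<exists>f'. weak_deriv (\<lambda>t. insert_sum N (D t) as) f'"
proof (induction as)
  case (Cons a as)
  then obtain f' where f': "weak_deriv (\<lambda>t. insert_sum N (D t) as) f'" by blast
  have "weak_deriv (\<lambda>t. D t a * dform (D t) as) (\<lambda>t. D1 a * dform (D t) as + D t a * deriv_dform D1 (D t) as)"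
    using weak_deriv_affine_mult[OF weak_deriv_dform, of "D0 a" "D1 a" D0 D1 as] by (simp add: D_def)
  from weak_deriv_add[OF weak_deriv_const_mult[OF this, of N] weak_deriv_affine_mult[OF f', of "D0 a" "D1 a"]]
  show ?case by (auto simp: D_def)
qed (auto intro: weak_deriv_const)

lemma bil_comp1:
  assumes "bil F" "lin f"
  shows "bil (\<lambda>x y. F (f x) y)"
proof (rule bilI)
  show "lin (\<lambda>x. F (f x) y)" for y by (rule lin_comp[OF bilD1[OF assms(1)] assms(2)])
  show "lin (\<lambda>y. F (f x) y)" for x by (rule bilD2[OF assms(1)])
qed

text \<open>A Sweedler sum is a finite sum, hence commutes with integration.\<close>
lemma sweedler_has_integral:
  fixes F :: "real \<Rightarrow> 'v::complex_vector \<Rightarrow> 'w::complex_vector \<Rightarrow> complex"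
  assumes F: "\<And>t. bil (F t)" and I: "\<And>v w. ((\<lambda>t. F t v w) has_integral I v w) S" and bI: "bil I"
  shows "((\<lambda>t. sweedler (F t) u) has_integral sweedler I u) S"
proof (induction u rule: tensor_induct)
  case (tens v w)
  then show ?case using I by (simp add: sweedler_tens F bI)
next
  case (add s t)
  then show ?case by (simp add: sweedler_add F bI has_integral_add)
next
  case (scale k s)
  then show ?case
    by (simp add: sweedler_scale F bI scaleC_complex_def has_integral_mult_right)
qed

lemma lin_integral:
  fixes f :: "real \<Rightarrow> 'v::complex_vector \<Rightarrow> complex"
  assumes f: "\<And>t. lin (f t)" and I: "\<And>v. ((\<lambda>t. f t v) has_integral I v) S"
  shows "lin I"
proof (rule linI)
  fix x y k
  have "((\<lambda>t. f t (x + y)) has_integral I x + I y) S"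
    using has_integral_add[OF I I, of x y] by (simp add: lin_add[OF f])
  then show "I (x + y) = I x + I y" using I has_integral_unique by blast
  have "((\<lambda>t. f t (k *\<^sub>C x)) has_integral k * I x) S"
    using has_integral_mult_right[OF I, of k x] by (simp add: lin_scale[OF f] scaleC_complex_def)
  then show "I (k *\<^sub>C x) = k *\<^sub>C I x" using I has_integral_unique unfolding scaleC_complex_def by blast
qed

lemma alt_faces_has_integral:
  fixes F :: "real \<Rightarrow> 'a::times list \<Rightarrow> complex"
  assumes "\<And>l. ((\<lambda>t. F t l) has_integral I l) S"
  shows "((\<lambda>t. alt_faces (F t) as) has_integral alt_faces I as) S"
  using assms
proof (induction "\<lambda>l :: 'a list. I l" as arbitrary: I F rule: alt_faces.induct)
  case (1 I a b as)
  have "((\<lambda>t. alt_faces (\<lambda>l. F t (a # l)) (b # as)) has_integral alt_faces (\<lambda>l. I (a # l)) (b # as)) S"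
    by (rule 1(1)) (rule 1(2))
  then show ?case
    using 1(2)[of "a * b # as"] by (auto intro!: has_integral_diff has_integral_neg)
qed simp_all

lemma cochain_bil:
  assumes g: "g \<in> cochains k"
  shows "bil (\<lambda>a c. g c (us @ a # vs))"
proof (cases "length us + length vs = k")
  case True
  show ?thesis
  proof (rule bilI)
    show "lin (\<lambda>c. g c (us @ a # vs))" for a
      using g True by (auto simp: cochains_def)
    have "lin (\<lambda>a. g c ((us @ 0 # vs)[length us := a]))" for c
      using g True unfolding cochains_def by (auto simp del: list_update_length)
    then show "lin (\<lambda>a. g c (us @ a # vs))" for c by simp
  qed
next
  case False
  then have "g c (us @ a # vs) = 0" for a c using g by (auto simp: cochains_def)
  then show ?thesis by (auto intro!: bilI lin_const0)
qed

text \<open>For every \<open>t\<close> the derivative of the character of \<open>G\<^sub>t\<close> is the coboundary of the cyclic cochain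
\<open>primitive\<close> for \<open>G\<^sub>t\<close>.  The integral of these cochains over \<open>[0, 1]\<close> is therefore a primitive of the
difference of the characters of the end points.\<close>
theorem path_characters_cohomologous:
  fixes G0 G1 :: "'a::complex_algebra_1 \<Rightarrow> 'b::complex_algebra_1"
  defines "G \<equiv> \<lambda>t a. G0 a + of_real t *\<^sub>C (G1 a - G0 a)"
  assumes hom: "\<And>t::real. trace_hom M d T (Suc k) \<psi> (G t) N"
    and path: "\<And>(t::real) a. G1 a - G0 a = N * G t a - G t a * N"
  obtains h where "h \<in> cyclic_cochains \<psi> k"
    and "\<And>c a as. length as = Suc k \<Longrightarrow> coboundary_map \<psi> k h c (a # as) =
       T c (G1 a * dform (\<lambda>a. d (G1 a)) as) - T c (G0 a * dform (\<lambda>a. d (G0 a)) as)"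
proof -
  interpret trace_hom M d T "Suc k" \<psi> "G t" N for t by (rule hom)
  define p where "p = (\<lambda>t::real. primitive t)"
  have dG: "d (G t a) = d (G0 a) + of_real t *\<^sub>C d (G1 a - G0 a)" for t a
    by (simp add: G_def lin_add[OF d_lin] lin_scale[OF d_lin])
  have p_cyc: "p t \<in> cyclic_cochains \<psi> k" for t
    unfolding p_def by (rule primitive_cyclic[OF refl])
  then have p_coch: "p t \<in> cochains k" for t by (auto simp: cyclic_cochains_def)
  define h where "h c as = integral {0..1} (\<lambda>t. p t c as)" for c as
  have int: "((\<lambda>t. p t c as) has_integral h c as) {0..1}" for c as
  proof (cases "length as = Suc k")
    case True
    obtain f' where f': "weak_deriv (\<lambda>t. insert_sum N (\<lambda>a. d (G0 a) + of_real t *\<^sub>C d (G1 a - G0 a)) as) f'"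
      using weak_deriv_insert_sum[of N "\<lambda>a. d (G0 a)" "\<lambda>a. d (G1 a - G0 a)" as] by blast
    note g' = weak_deriv_dform[of "\<lambda>a. d (G0 a)" "\<lambda>a. d (G1 a - G0 a)" as]
    have "continuous_on {0..1} (\<lambda>t. - T c (insert_sum N (\<lambda>a. d (G t a)) as - N * dform (\<lambda>a. d (G t a)) as))"
      unfolding dG lin_diff[OF T_lin]
      by (intro continuous_on_minus continuous_on_diff weak_deriv_continuous[OF f' T_lin]
          weak_deriv_continuous[OF weak_deriv_const_mult[OF g'] T_lin])
    then have int': "(\<lambda>t. - T c (insert_sum N (\<lambda>a. d (G t a)) as - N * dform (\<lambda>a. d (G t a)) as)) integrable_on {0..1}"
      by (rule integrable_continuous_interval)
    have "p t c as = - T c (insert_sum N (\<lambda>a. d (G t a)) as - N * dform (\<lambda>a. d (G t a)) as)" for t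
      using True by (simp add: p_def primitive_def)
    with int' have "(\<lambda>t. p t c as) integrable_on {0..1}" by presburger
    then show ?thesis unfolding h_def by (rule integrable_integral)
  next
    case False
    then have "p t c as = 0" for t by (simp add: p_def primitive_def)
    then show ?thesis by (simp add: h_def)
  qed
  have h_coch: "h \<in> cochains k"
    unfolding cochains_def mem_Collect_eq
  proof (intro conjI allI impI)
    show "lin (\<lambda>c. h c as)" if "length as = k + 1" for as
      by (rule lin_integral[OF _ int]) (use p_coch that in \<open>auto simp: cochains_def\<close>)
    show "lin (\<lambda>a. h c (as[i := a]))" if "length as = k + 1" "i < k + 1" for c as i
      by (rule lin_integral[OF _ int]) (use p_coch that in \<open>auto simp: cochains_def\<close>)
    show "h c as = 0" if "length as \<noteq> k + 1" for c as
      using that p_coch by (simp add: h_def cochains_def)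
  qed
  have int_sw: "((\<lambda>t. sweedler (\<lambda>a' c'. p t c' (us @ [f a'])) u) has_integral
      sweedler (\<lambda>a' c'. h c' (us @ [f a'])) u) {0..1}" if "lin f" for us u and f :: "'a \<Rightarrow> 'a"
  proof (rule sweedler_has_integral[OF _ int])
    have b: "bil (\<lambda>a' c'. g c' (us @ [f a']))" if "g \<in> cochains k" for g
      by (rule bil_comp1[OF cochain_bil[OF that] \<open>lin f\<close>])
    show "bil (\<lambda>a' c'. p t c' (us @ [f a']))" for t by (rule b[OF p_coch])
    show "bil (\<lambda>a' c'. h c' (us @ [f a']))" by (rule b[OF h_coch])
  qed
  have h_cyc: "h \<in> cyclic_cochains \<psi> k"
    unfolding cyclic_cochains_def mem_Collect_eq
  proof (intro conjI h_coch allI impI)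
    fix c and as :: "'a list" assume as: "length as = k + 1"
    have eq: "p t c as = (- 1) ^ k * sweedler (\<lambda>a' c'. p t c' (tl as @ [a'])) (\<psi> (c \<otimes> hd as))" for t
      using p_cyc[of t] as unfolding cyclic_cochains_def mem_Collect_eq by blast
    have "((\<lambda>t. p t c as) has_integral (- 1) ^ k * sweedler (\<lambda>a' c'. h c' (tl as @ [a'])) (\<psi> (c \<otimes> hd as))) {0..1}"
      unfolding eq by (rule has_integral_mult_right[OF int_sw[OF lin_id]])
    then show "h c as = (- 1) ^ k * sweedler (\<lambda>a' c'. h c' (tl as @ [a'])) (\<psi> (c \<otimes> hd as))"
      using int has_integral_unique by blast
  qed
  show ?thesis
  proof (rule that[OF h_cyc])
    fix c a and as :: "'a list" assume as: "length as = Suc k"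
    let ?D = "\<lambda>t a. d (G t a)"
    let ?\<phi> = "\<lambda>t. T c (G t a * dform (?D t) as)"
    have cob: "coboundary_map \<psi> k (p t) c (a # as)
       = T c ((G1 a - G0 a) * dform (?D t) as + G t a * deriv_dform (\<lambda>a. d (G1 a - G0 a)) (?D t) as)" for t
      unfolding p_def coboundary_primitive[OF refl as] trace_bracket_sum[OF refl as] path[of _ t] ..
    have "weak_deriv (\<lambda>t. dform (?D t) as) (\<lambda>t. deriv_dform (\<lambda>a. d (G1 a - G0 a)) (?D t) as)"
      unfolding dG by (rule weak_deriv_dform)
    from weak_derivD[OF weak_deriv_affine_mult[OF this, of "G0 a" "G1 a - G0 a"] T_lin, of c]
    have "(?\<phi> has_vector_derivative coboundary_map \<psi> k (p t) c (a # as)) (at t)" for t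
      unfolding cob by (simp add: G_def)
    then have "((\<lambda>t. coboundary_map \<psi> k (p t) c (a # as)) has_integral (?\<phi> 1 - ?\<phi> 0)) {0..1}"
      by (intro fundamental_theorem_of_calculus) (auto intro: has_vector_derivative_at_within)
    moreover have "((\<lambda>t. coboundary_map \<psi> k (p t) c (a # as)) has_integral coboundary_map \<psi> k h c (a # as)) {0..1}"
      unfolding coboundary_map_eq[OF as]
      by (intro has_integral_add alt_faces_has_integral int int_sw lin_const_mult lin_id)
    ultimately have "coboundary_map \<psi> k h c (a # as) = ?\<phi> 1 - ?\<phi> 0"
      using has_integral_unique by blast
    then show "coboundary_map \<psi> k h c (a # as) =
       T c (G1 a * dform (\<lambda>a. d (G1 a)) as) - T c (G0 a * dform (\<lambda>a. d (G0 a)) as)"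
      by (simp add: G_def scaleC_one)
  qed
qed

section \<open>Matrices over a possibly non-unital algebra\<close>

instantiation prod :: (complex_vector, complex_vector) complex_vector
begin
definition scaleC_prod :: "complex \<Rightarrow> 'a \<times> 'b \<Rightarrow> 'a \<times> 'b" where
  "scaleC_prod k x = (k *\<^sub>C fst x, k *\<^sub>C snd x)"
instance
  by standard (auto simp: scaleC_prod_def scaleC_add_right scaleC_add_left scaleC_scaleC scaleC_one prod_eq_iff)
end

lemma lin_single: "lin (Poly_Mapping.single i)"
  by (auto intro!: linI poly_mapping_eqI simp: single_add lookup_single lookup_scaleC when_def)

lemma lin_lookup: "lin (\<lambda>p. Poly_Mapping.lookup p i)"
  by (auto intro!: linI simp: lookup_add lookup_scaleC)

lemma lin_fst: "lin fst"
  by (auto intro!: linI simp: scaleC_prod_def)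

locale assoc_alg =
  fixes m :: "'r::complex_vector \<Rightarrow> 'r \<Rightarrow> 'r"
  assumes m_bil: "bil m" and m_assoc: "m (m x y) z = m x (m y z)"
begin

lemmas m_lin1 = bilD1[OF m_bil] and m_lin2 = bilD2[OF m_bil]

lemma m_zero [simp]: "m 0 x = 0" "m x 0 = 0"
  using lin_zero[OF m_lin1] lin_zero[OF m_lin2] by auto

text \<open>The left action of the algebra on its unitization, whose elements are pairs of an element and a
scalar.  It is faithful because \<open>r\<close> sends the unit \<open>(0, 1)\<close> to \<open>(r, 0)\<close>.\<close>
definition act :: "'r \<Rightarrow> 'r \<times> complex \<Rightarrow> 'r \<times> complex" where
  "act r v = (m r (fst v) + snd v *\<^sub>C r, 0)"

lemma act_bil: "bil act"
  by (intro bilI linI)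
    (auto simp: act_def lin_add[OF m_lin1] lin_add[OF m_lin2] lin_scale[OF m_lin1] lin_scale[OF m_lin2]
      scaleC_add_right scaleC_add_left scaleC_scaleC scaleC_prod_def scaleC_complex_def algebra_simps)

lemma act_act: "act r (act s v) = act (m r s) v"
  by (simp add: act_def m_assoc lin_add[OF m_lin2] lin_scale[OF m_lin2])

text \<open>The matrix with the single entry \<open>r\<close>, acting on column vectors over the unitization.\<close>
definition E :: "nat \<Rightarrow> nat \<Rightarrow> 'r \<Rightarrow> (nat \<Rightarrow>\<^sub>0 'r \<times> complex) endo" where
  "E i j r = Endo (\<lambda>v. Poly_Mapping.single i (act r (Poly_Mapping.lookup v j)))"

lemma app_E: "app (E i j r) v = Poly_Mapping.single i (act r (Poly_Mapping.lookup v j))"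
  unfolding E_def
  by (subst app_Endo) (rule lin_comp[OF lin_single lin_comp[OF bilD2[OF act_bil] lin_lookup]], rule refl)

lemma E_lin: "lin (E i j)"
  by (intro linI endo_eqI)
    (auto simp: app_E app_simps lin_add[OF bilD1[OF act_bil]] lin_scale[OF bilD1[OF act_bil]]
      lin_add[OF lin_single] lin_scale[OF lin_single])

lemma E_zero [simp]: "E i j 0 = 0"
  by (rule lin_zero[OF E_lin])

lemma E_mult: "E i j r * E k l s = (if j = k then E i l (m r s) else 0)"
  by (rule endo_eqI)
    (auto simp: app_E app_simps act_act lookup_single when_def lin_zero[OF bilD2[OF act_bil]])

definition entry :: "nat \<Rightarrow> nat \<Rightarrow> (nat \<Rightarrow>\<^sub>0 'r \<times> complex) endo \<Rightarrow> 'r" where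
  "entry i j f = fst (Poly_Mapping.lookup (app f (Poly_Mapping.single j (0, 1))) i)"

lemma entry_lin: "lin (entry i j)"
  unfolding entry_def by (intro lin_comp[OF lin_fst] lin_comp[OF lin_lookup] lin_app_left)

lemma entry_E: "entry i j (E k l r) = (if i = k \<and> j = l then r else 0)"
  by (auto simp: entry_def app_E lookup_single when_def act_def scaleC_one)

text \<open>Two indices are needed for \<open>diag(\<rho>, \<nu> \<circ> \<rho>)\<close>, and a third one for the homomorphism to which it is
connected by a path.\<close>
definition Mat :: "(nat \<Rightarrow> nat \<Rightarrow> 'r) \<Rightarrow> (nat \<Rightarrow>\<^sub>0 'r \<times> complex) endo" where
  "Mat x = (\<Sum>i<3. \<Sum>j<3. E i j (x i j))"

definition mm :: "(nat \<Rightarrow> nat \<Rightarrow> 'r) \<Rightarrow> (nat \<Rightarrow> nat \<Rightarrow> 'r) \<Rightarrow> nat \<Rightarrow> nat \<Rightarrow> 'r" where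
  "mm x y i j = (\<Sum>k<3. m (x i k) (y k j))"

lemma entry_Mat: "i < 3 \<Longrightarrow> j < 3 \<Longrightarrow> entry i j (Mat x) = x i j"
proof -
  assume ij: "i < 3" "j < 3"
  have "entry i j (Mat x) = (\<Sum>k<3. \<Sum>l<3. if i = k \<and> j = l then x k l else 0)"
    by (simp add: Mat_def lin_sum[OF entry_lin] entry_E)
  also have "\<dots> = (\<Sum>k<3. if k = i then x i j else 0)"
    using ij by (intro sum.cong refl) (auto simp: if_distrib sum.delta)
  finally show ?thesis using ij by (simp add: sum.delta)
qed

lemma Mat_mult: "Mat x * Mat y = Mat (mm x y)"
proof -
  have "Mat x * Mat y = (\<Sum>i<3. \<Sum>j<3. \<Sum>k<3. \<Sum>l<3. E i j (x i j) * E k l (y k l))"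
    by (simp only: Mat_def sum_distrib_right) (simp only: sum_distrib_left)
  also have "\<dots> = (\<Sum>i<3. \<Sum>j<3. \<Sum>k<3. if k = j then (\<Sum>l<3. E i l (m (x i j) (y j l))) else 0)"
  proof (intro sum.cong refl)
    fix i j k :: nat
    show "(\<Sum>l<3. E i j (x i j) * E k l (y k l)) = (if k = j then (\<Sum>l<3. E i l (m (x i j) (y j l))) else 0)"
      by (cases "k = j") (simp_all add: E_mult)
  qed
  also have "\<dots> = (\<Sum>i<3. \<Sum>j<3. \<Sum>l<3. E i l (m (x i j) (y j l)))"
  proof (rule sum.cong[OF refl], rule sum.cong[OF refl])
    fix i j :: nat assume "j \<in> {..<3}"
    then show "(\<Sum>k<3. if k = j then (\<Sum>l<3. E i l (m (x i j) (y j l))) else 0) = (\<Sum>l<3. E i l (m (x i j) (y j l)))"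
      by (simp add: sum.delta)
  qed
  also have "\<dots> = (\<Sum>i<3. \<Sum>l<3. \<Sum>j<3. E i l (m (x i j) (y j l)))"
    by (rule sum.cong[OF refl]) (rule sum.swap)
  finally show ?thesis by (simp add: Mat_def mm_def lin_sum[OF E_lin])
qed

lemma Mat_add: "Mat (\<lambda>i j. x i j + y i j) = Mat x + Mat y"
  by (simp add: Mat_def lin_add[OF E_lin] sum.distrib)

lemma Mat_scale: "Mat (\<lambda>i j. k *\<^sub>C x i j) = k *\<^sub>C Mat x"
  by (simp add: Mat_def lin_scale[OF E_lin] cvs.scale_sum_right)

lemma Mat_expand: "Mat x = E 0 0 (x 0 0) + E 0 1 (x 0 1) + E 0 2 (x 0 2)
   + E 1 0 (x 1 0) + E 1 1 (x 1 1) + E 1 2 (x 1 2) + E 2 0 (x 2 0) + E 2 1 (x 2 1) + E 2 2 (x 2 2)"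
  by (simp add: Mat_def eval_nat_numeral add.assoc)

end

section \<open>Cycles with globally defined operations\<close>

lemma sweedler_id: "sweedler (\<otimes>) t = t"
proof (induction t rule: tensor_induct)
  case (tens v w)
  show ?case by (rule sweedler_tens) (auto intro!: bilI lin_tens1 lin_tens2 lin_id)
next
  have b: "bil ((\<otimes>) :: 'a \<Rightarrow> 'b \<Rightarrow> _)"
    by (auto intro!: bilI linI simp: tens_bilinear)
  {
    case (add s t)
    then show ?case by (simp add: sweedler_add[OF b])
  next
    case (scale k s)
    then show ?case by (simp add: sweedler_scale[OF b])
  }
qed

lemma bil_tens: "bil (\<otimes>)"
  by (auto intro!: bilI linI simp: tens_bilinear)

lemma bil_tens_comp: "lin f \<Longrightarrow> bil (\<lambda>x y. f x \<otimes> y)"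
  by (rule bil_comp1[OF bil_tens])

lemma sweedler_fun_sum:
  assumes "\<And>i. i \<in> S \<Longrightarrow> bil (F i)"
  shows "sweedler (\<lambda>v w. \<Sum>i\<in>S. F i v w) t = (\<Sum>i\<in>S. sweedler (F i) t)"
proof -
  have "bil (\<lambda>v w. \<Sum>i\<in>S. F i v w)"
    using assms by (intro bilI lin_sum') (auto dest: bilD1 bilD2)
  then show ?thesis
    by (induction t rule: tensor_induct)
      (simp_all add: sweedler_tens sweedler_add sweedler_scale assms sum.distrib cvs.scale_sum_right)
qed

text \<open>Projections onto the carriers make all operations of the cycle total and multilinear.\<close>

locale globalized_cycle =
  fixes R :: "('r::complex_vector, 'z) dga_scheme"
    and \<Delta> :: "'c::complex_vector \<Rightarrow> ('c, 'c) tensor" and \<epsilon> :: "'c \<Rightarrow> complex"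
    and \<Psi> :: "('c, 'r) tensor \<Rightarrow> ('r, 'c) tensor" and T0 :: "('c, 'r) tensor \<Rightarrow> complex"
    and n :: nat and pr prn pr0 :: "'r \<Rightarrow> 'r"
    and \<psi> :: "('c, 'a::complex_algebra_1) tensor \<Rightarrow> ('a, 'c) tensor"
  assumes dg: "dg_entwining R \<Delta> \<epsilon> \<Psi>"
    and tr: "closed_graded_entwined_trace n R \<Psi> T0"
    and pr: "lin pr" "\<And>x. pr x \<in> total R" "\<And>x. x \<in> total R \<Longrightarrow> pr x = x"
    and prn: "lin prn" "\<And>x. prn x \<in> piece R n" "\<And>x. x \<in> piece R n \<Longrightarrow> prn x = x"
    and pr0: "lin pr0" "\<And>x. pr0 x \<in> piece R 0" "\<And>x. x \<in> piece R 0 \<Longrightarrow> pr0 x = x"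
begin

definition m :: "'r \<Rightarrow> 'r \<Rightarrow> 'r" where "m x y = mul R (pr x) (pr y)"
definition D :: "'r \<Rightarrow> 'r" where "D x = diff R (pr x)"
definition T :: "'c \<Rightarrow> 'r \<Rightarrow> complex" where "T c x = T0 (c \<otimes> prn x)"

lemma piece_sub: "cvs.subspace (piece R i)"
  using dg by (auto simp: dg_entwining_def dg_algebra_def)

lemma piece_total: "x \<in> piece R i \<Longrightarrow> x \<in> total R"
  unfolding total_def by (rule cvs.span_base) blast

lemma total_sub: "cvs.subspace (total R)"
  by (simp add: total_def)

lemma pr_piece: "x \<in> piece R i \<Longrightarrow> pr x = x"
  by (simp add: pr piece_total)

lemma alg: "algebra_on (total R) (mul R)"
  using dg by (auto simp: dg_entwining_def dg_algebra_def)

lemma m_bil': "bil m"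
  using alg unfolding m_def algebra_on_def cbilinear_on_def
  by (auto intro!: lin_of_clinear_on[OF _ pr(1,2)] simp: pr(2))

lemma m_assoc': "m (m x y) z = m x (m y z)"
  using alg unfolding m_def algebra_on_def by (simp add: pr)

sublocale assoc_alg m
  by unfold_locales (rule m_bil', rule m_assoc')

lemma m_eq: "x \<in> piece R i \<Longrightarrow> y \<in> piece R j \<Longrightarrow> mul R x y = m x y"
  by (simp add: m_def pr_piece)

lemma m_piece: "x \<in> piece R i \<Longrightarrow> y \<in> piece R j \<Longrightarrow> m x y \<in> piece R (i + j)"
  using dg by (auto simp: m_def pr_piece dg_entwining_def dg_algebra_def)

lemma D_lin: "lin D"
  unfolding D_def using dg
  by (intro lin_of_clinear_on[OF _ pr(1,2)]) (auto simp: dg_entwining_def dg_algebra_def)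

lemma D_eq: "x \<in> piece R i \<Longrightarrow> diff R x = D x"
  by (simp add: D_def pr_piece)

lemma D_piece: "x \<in> piece R i \<Longrightarrow> D x \<in> piece R (Suc i)"
  using dg by (auto simp: D_def pr_piece dg_entwining_def dg_algebra_def)

lemma D_D: "x \<in> piece R i \<Longrightarrow> D (D x) = 0"
  using dg D_piece[of x i] D_eq[of "D x" "Suc i"] D_eq[of x i] piece_total[of x i]
  by (auto simp: dg_entwining_def dg_algebra_def)

lemma D_m: "x \<in> piece R i \<Longrightarrow> y \<in> piece R j \<Longrightarrow> D (m x y) = m (D x) y + (- 1) ^ i *\<^sub>C m x (D y)"
proof -
  assume x: "x \<in> piece R i" and y: "y \<in> piece R j"
  have "diff R (mul R x y) = mul R (diff R x) y + (- 1) ^ i *\<^sub>C mul R x (diff R y)"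
    using dg x y unfolding dg_entwining_def dg_algebra_def by blast
  then show ?thesis
    by (simp only: m_eq[OF x y] D_eq[OF x] D_eq[OF y] m_eq[OF D_piece[OF x] y] m_eq[OF x D_piece[OF y]]
        D_eq[OF m_piece[OF x y]])
qed

lemma T_eq: "x \<in> piece R n \<Longrightarrow> T0 (c \<otimes> x) = T c x"
  by (simp add: T_def prn)

lemma T_bil': "bil T"
proof -
  have T0: "clinear_on (tensor_on UNIV (piece R n)) T0"
    using tr by (auto simp: closed_graded_entwined_trace_def)
  show ?thesis
    by (intro bilI linI)
      (use T0 prn in \<open>auto simp: T_def clinear_on_def tens_bilinear tens_in lin_add[OF prn(1)] lin_scale[OF prn(1)]\<close>)
qed

lemma T_closed: "x \<in> piece R i \<Longrightarrow> n = Suc i \<Longrightarrow> T c (D x) = 0"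
proof -
  assume x: "x \<in> piece R i" and n: "n = Suc i"
  have "T0 (c \<otimes> diff R x) = 0"
    using tr x n unfolding closed_graded_entwined_trace_def by auto
  then show ?thesis using D_piece[OF x] by (simp only: D_eq[OF x] T_eq n[symmetric])
qed

lemma \<Psi>_lin: "clinear_on (tensor_on UNIV (total R)) \<Psi>"
  using dg by (auto simp: dg_entwining_def entwining_def)

lemma \<Psi>_piece: "x \<in> piece R i \<Longrightarrow> \<Psi> (c \<otimes> x) \<in> tensor_on (piece R i) UNIV"
  using dg tens_in[of c UNIV x "piece R i"] by (auto simp: dg_entwining_def)

lemma \<Psi>_total: "x \<in> total R \<Longrightarrow> \<Psi> (c \<otimes> x) \<in> tensor_on (total R) UNIV"
  using dg tens_in[of c UNIV x "total R"] by (auto simp: dg_entwining_def entwining_def)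

lemma \<Psi>_lin1: "x \<in> total R \<Longrightarrow> lin (\<lambda>c. \<Psi> (c \<otimes> x))"
  using \<Psi>_lin by (auto intro!: linI simp: tens_bilinear clinear_on_def tens_in)

lemma \<Psi>_add: "x \<in> total R \<Longrightarrow> y \<in> total R \<Longrightarrow> \<Psi> (c \<otimes> (x + y)) = \<Psi> (c \<otimes> x) + \<Psi> (c \<otimes> y)"
  using \<Psi>_lin by (auto simp: tens_bilinear clinear_on_def tens_in)

lemma \<Psi>_scale: "x \<in> total R \<Longrightarrow> \<Psi> (c \<otimes> (k *\<^sub>C x)) = k *\<^sub>C \<Psi> (c \<otimes> x)"
  using \<Psi>_lin by (auto simp: tens_bilinear clinear_on_def tens_in)

lemma \<Psi>_m:
  assumes x: "x \<in> total R" and y: "y \<in> total R"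
  shows "\<Psi> (c \<otimes> m x y) =
    sweedler (\<lambda>x' c'. sweedler (\<lambda>y' c''. m x' y' \<otimes> c'') (\<Psi> (c' \<otimes> y))) (\<Psi> (c \<otimes> x))"
proof -
  have b: "bil (\<lambda>y' c''. m x' y' \<otimes> c'')" for x'
    by (rule bil_tens_comp[OF m_lin2])
  have in1: "tlift (total R) UNIV (\<lambda>b' c''. mul R x' b' \<otimes> c'') (\<Psi> (c' \<otimes> y))
     = sweedler (\<lambda>y' c''. m x' y' \<otimes> c'') (\<Psi> (c' \<otimes> y))" if "x' \<in> total R" for x' c'
    using that by (intro tlift_eq_sweedler[OF total_sub subspace_UNIV b _ \<Psi>_total[OF y]]) (simp add: m_def pr)
  have b2: "bil (\<lambda>x' c'. sweedler (\<lambda>y' c''. m x' y' \<otimes> c'') (\<Psi> (c' \<otimes> y)))"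
    by (intro bilI lin_sweedler_arg b lin_tens1 m_lin1 lin_comp[OF lin_sweedler[OF b] \<Psi>_lin1[OF y]])
  have ent: "\<forall>c. \<forall>a\<in>total R. \<forall>b\<in>total R. \<Psi> (c \<otimes> mul R a b) = tlift (total R) UNIV (\<lambda>a' c'.
      tlift (total R) UNIV (\<lambda>b' c''. mul R a' b' \<otimes> c'') (\<Psi> (c' \<otimes> b))) (\<Psi> (c \<otimes> a))"
    using dg unfolding dg_entwining_def entwining_def by (elim conjE) assumption
  have "\<Psi> (c \<otimes> mul R x y) = tlift (total R) UNIV (\<lambda>a' c'. tlift (total R) UNIV
      (\<lambda>b' c''. mul R a' b' \<otimes> c'') (\<Psi> (c' \<otimes> y))) (\<Psi> (c \<otimes> x))"
    using ent x y by simp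
  also have "\<dots> = sweedler (\<lambda>x' c'. sweedler (\<lambda>y' c''. m x' y' \<otimes> c'') (\<Psi> (c' \<otimes> y))) (\<Psi> (c \<otimes> x))"
    by (rule tlift_eq_sweedler[OF total_sub subspace_UNIV b2 in1 \<Psi>_total[OF x]])
  finally show ?thesis using x y by (simp add: m_def pr)
qed

lemma \<Psi>_D: "x \<in> piece R i \<Longrightarrow> \<Psi> (c \<otimes> D x) = sweedler (\<lambda>x' c'. D x' \<otimes> c') (\<Psi> (c \<otimes> x))"
proof -
  assume x: "x \<in> piece R i"
  have tm: "tensor_map UNIV (total R) id (diff R) (c \<otimes> x) = c \<otimes> D x"
  proof -
    have b: "bil (\<lambda>c x. c \<otimes> D x)" by (intro bilI lin_tens1 lin_tens2 lin_id D_lin)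
    have "tensor_map UNIV (total R) id (diff R) (c \<otimes> x) = sweedler (\<lambda>c x. c \<otimes> D x) (c \<otimes> x)"
      unfolding tensor_map_def
      by (rule tlift_eq_sweedler[OF subspace_UNIV total_sub b]) (auto simp: D_def pr tens_in piece_total[OF x])
    then show ?thesis by (simp add: sweedler_tens b)
  qed
  have "tensor_map (total R) UNIV (diff R) id (\<Psi> (c \<otimes> x)) = sweedler (\<lambda>x' c'. D x' \<otimes> c') (\<Psi> (c \<otimes> x))"
    unfolding tensor_map_def
    by (rule tlift_eq_sweedler[OF total_sub subspace_UNIV bil_tens_comp[OF D_lin]])
      (auto simp: D_def pr \<Psi>_total piece_total[OF x])
  moreover have "tensor_map (total R) UNIV (diff R) id (\<Psi> (c \<otimes> x)) = \<Psi> (tensor_map UNIV (total R) id (diff R) (c \<otimes> x))"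
    using dg tens_in[of c UNIV x "total R"] piece_total[OF x] unfolding dg_entwining_def by blast
  ultimately show ?thesis by (simp add: tm)
qed

lemma T_trace:
  assumes x: "x \<in> piece R i" and y: "y \<in> piece R j" and n: "i + j = n"
  shows "T c (m x y) = (- 1) ^ (i * j) * sweedler (\<lambda>x' c'. T c' (m y x')) (\<Psi> (c \<otimes> x))"
proof -
  have b: "bil (\<lambda>x' c'. T c' (m y x'))"
    by (intro bilI lin_comp[OF bilD2[OF T_bil'] m_lin2] bilD1[OF T_bil'])
  have "T0 (c \<otimes> mul R x y) = (- 1) ^ (i * j) * tlift (piece R i) UNIV (\<lambda>s c'. T0 (c' \<otimes> mul R y s)) (\<Psi> (c \<otimes> x))"
    using tr x y n unfolding closed_graded_entwined_trace_def by blast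
  also have "tlift (piece R i) UNIV (\<lambda>s c'. T0 (c' \<otimes> mul R y s)) (\<Psi> (c \<otimes> x))
      = sweedler (\<lambda>x' c'. T c' (m y x')) (\<Psi> (c \<otimes> x))"
  proof (rule tlift_eq_sweedler[OF piece_sub subspace_UNIV b _ \<Psi>_piece[OF x]])
    fix v c' assume v: "v \<in> piece R i"
    have "m y v \<in> piece R n" using m_piece[OF y v] n by (simp add: add.commute)
    then show "T0 (c' \<otimes> mul R y v) = T c' (m y v)"
      using v y by (simp add: m_eq T_eq)
  qed
  also have "T0 (c \<otimes> mul R x y) = T c (m x y)"
    using m_piece[OF x y] n x y by (simp add: m_eq T_eq)
  finally show ?thesis .
qed

definition invariant :: "'r \<Rightarrow> bool" where
  "invariant r \<longleftrightarrow> r \<in> piece R 0 \<and> (\<forall>c. \<Psi> (c \<otimes> r) = r \<otimes> c)"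

text \<open>For such a family the trace identity of the cycle can be stated with \<open>\<psi>\<close> instead of \<open>\<Psi>\<close>
(\<open>T_entwined\<close>); this is how the entwining of the cycle is eliminated.\<close>
definition entwined :: "nat \<Rightarrow> ('a \<Rightarrow> 'r) \<Rightarrow> bool" where
  "entwined p u \<longleftrightarrow> lin u \<and> (\<forall>a. u a \<in> piece R p) \<and>
     (\<forall>c a. \<Psi> (c \<otimes> u a) = sweedler (\<lambda>a' c'. u a' \<otimes> c') (\<psi> (c \<otimes> a)))"

lemma invariant_0: "invariant 0"
  using lin_zero[OF \<Psi>_lin1] \<Psi>_scale[of 0 _ 0] cvs.subspace_0[OF total_sub] cvs.subspace_0[OF piece_sub]
  by (simp add: invariant_def)

lemma invariant_add: "invariant r \<Longrightarrow> invariant s \<Longrightarrow> invariant (r + s)"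
  by (auto simp: invariant_def \<Psi>_add piece_total tens_bilinear(1) cvs.subspace_add[OF piece_sub])

lemma invariant_scale: "invariant r \<Longrightarrow> invariant (k *\<^sub>C r)"
  by (auto simp: invariant_def \<Psi>_scale piece_total tens_bilinear(3) cvs.subspace_scale[OF piece_sub])

lemma \<Psi>_m_invariant_left:
  assumes r: "invariant r" and y: "y \<in> piece R p"
  shows "\<Psi> (c \<otimes> m r y) = sweedler (\<lambda>y' c'. m r y' \<otimes> c') (\<Psi> (c \<otimes> y))"
proof -
  have b: "bil (\<lambda>y' c''. m x' y' \<otimes> c'')" for x'
    by (rule bil_tens_comp[OF m_lin2])
  have b2: "bil (\<lambda>x' c'. sweedler (\<lambda>y' c''. m x' y' \<otimes> c'') (\<Psi> (c' \<otimes> y)))"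
    by (intro bilI lin_sweedler_arg b lin_tens1 m_lin1 lin_comp[OF lin_sweedler[OF b] \<Psi>_lin1] piece_total[OF y])
  show ?thesis
    using r piece_total[OF y] piece_total[of r 0] by (simp add: invariant_def \<Psi>_m sweedler_tens[OF b2])
qed

lemma \<Psi>_m_invariant_right:
  assumes r: "invariant r" and x: "x \<in> piece R p"
  shows "\<Psi> (c \<otimes> m x r) = sweedler (\<lambda>x' c'. m x' r \<otimes> c') (\<Psi> (c \<otimes> x))"
proof -
  have b: "bil (\<lambda>y' c''. m x' y' \<otimes> c'')" for x'
    by (rule bil_tens_comp[OF m_lin2])
  show ?thesis
    using r piece_total[OF x] piece_total[of r 0] by (simp add: invariant_def \<Psi>_m sweedler_tens[OF b])
qed

lemma invariant_m: "invariant r \<Longrightarrow> invariant s \<Longrightarrow> invariant (m r s)"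
  using \<Psi>_m_invariant_left[of r s 0] m_piece[of r 0 s 0]
  by (auto simp: invariant_def sweedler_tens[OF bil_tens_comp[OF m_lin2]])

lemma entwinedD:
  assumes "entwined p u"
  shows "lin u" "u a \<in> piece R p" "\<Psi> (c \<otimes> u a) = sweedler (\<lambda>a' c'. u a' \<otimes> c') (\<psi> (c \<otimes> a))"
  using assms by (auto simp: entwined_def)

lemma entwinedI:
  assumes "lin u" "\<And>a. u a \<in> piece R p" "\<And>c a. \<Psi> (c \<otimes> u a) = sweedler (\<lambda>a' c'. u a' \<otimes> c') (\<psi> (c \<otimes> a))"
  shows "entwined p u"
  using assms unfolding entwined_def by blast

lemma invariantD: "invariant r \<Longrightarrow> r \<in> piece R 0" "invariant r \<Longrightarrow> \<Psi> (c \<otimes> r) = r \<otimes> c"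
  unfolding invariant_def by blast+

lemma sweedler_entwined:
  assumes u: "entwined p u" and F: "bil F"
  shows "sweedler F (\<Psi> (c \<otimes> u a)) = sweedler (\<lambda>a' c'. F (u a') c') (\<psi> (c \<otimes> a))"
  unfolding entwinedD(3)[OF u]
  using lin_comp_sweedler[OF lin_sweedler[OF F] bil_tens_comp[OF entwinedD(1)[OF u]]]
  by (simp add: sweedler_tens[OF F])

lemma entwined_0: "entwined p (\<lambda>a. 0)"
proof (rule entwinedI)
  show "\<Psi> (c \<otimes> 0) = sweedler (\<lambda>a' c'. 0 \<otimes> c') (\<psi> (c \<otimes> a))" for c a
  proof -
    have "\<Psi> (c \<otimes> (0 *\<^sub>C 0)) = 0 *\<^sub>C \<Psi> (c \<otimes> 0)"
      by (rule \<Psi>_scale[OF cvs.subspace_0[OF total_sub]])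
    moreover have "sweedler (\<lambda>a' c'. 0 *\<^sub>C (0 \<otimes> c') :: ('r, 'c) tensor) t
        = 0 *\<^sub>C sweedler (\<lambda>a' c'. 0 \<otimes> c') t" for t :: "('a, 'c) tensor"
      by (rule sweedler_fun_scale[OF bil_tens_comp[OF lin_const0]])
    ultimately show ?thesis by (simp only: scaleC_zero_left tens_zero)
  qed
qed (rule lin_const0, rule cvs.subspace_0[OF piece_sub])


lemma entwined_add:
  assumes u: "entwined p u" and v: "entwined p v"
  shows "entwined p (\<lambda>a. u a + v a)"
proof (rule entwinedI)
  show "lin (\<lambda>a. u a + v a)" by (rule lin_plus[OF entwinedD(1)[OF u] entwinedD(1)[OF v]])
  show "u a + v a \<in> piece R p" for a
    by (rule cvs.subspace_add[OF piece_sub entwinedD(2)[OF u] entwinedD(2)[OF v]])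
  show "\<Psi> (c \<otimes> (u a + v a)) = sweedler (\<lambda>a' c'. (u a' + v a') \<otimes> c') (\<psi> (c \<otimes> a))" for c a
    unfolding tens_bilinear(1) \<Psi>_add[OF piece_total[OF entwinedD(2)[OF u]] piece_total[OF entwinedD(2)[OF v]]]
      entwinedD(3)[OF u] entwinedD(3)[OF v]
    by (rule sweedler_fun_plus[OF bil_tens_comp[OF entwinedD(1)[OF u]] bil_tens_comp[OF entwinedD(1)[OF v]], symmetric])
qed


lemma entwined_sum: "(\<And>i. i \<in> S \<Longrightarrow> entwined p (u i)) \<Longrightarrow> entwined p (\<lambda>a. \<Sum>i\<in>S. u i a)"
proof (induction S rule: infinite_finite_induct)
  case (insert x F)
  then show ?case using entwined_add[of p "u x" "\<lambda>a. \<Sum>i\<in>F. u i a"] by simp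
qed (simp_all add: entwined_0)

lemma entwined_m_left:
  assumes r: "invariant r" and u: "entwined p u"
  shows "entwined p (\<lambda>a. m r (u a))"
proof (rule entwinedI)
  show "lin (\<lambda>a. m r (u a))" by (rule lin_comp[OF m_lin2 entwinedD(1)[OF u]])
  show "m r (u a) \<in> piece R p" for a using m_piece[OF invariantD(1)[OF r] entwinedD(2)[OF u]] by simp
  show "\<Psi> (c \<otimes> m r (u a)) = sweedler (\<lambda>a' c'. m r (u a') \<otimes> c') (\<psi> (c \<otimes> a))" for c a
    unfolding \<Psi>_m_invariant_left[OF r entwinedD(2)[OF u]] by (rule sweedler_entwined[OF u bil_tens_comp[OF m_lin2]])
qed

lemma entwined_m_right:
  assumes r: "invariant r" and u: "entwined p u"
  shows "entwined p (\<lambda>a. m (u a) r)"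
proof (rule entwinedI)
  show "lin (\<lambda>a. m (u a) r)" by (rule lin_comp[OF m_lin1 entwinedD(1)[OF u]])
  show "m (u a) r \<in> piece R p" for a using m_piece[OF entwinedD(2)[OF u] invariantD(1)[OF r], of a] by simp
  show "\<Psi> (c \<otimes> m (u a) r) = sweedler (\<lambda>a' c'. m (u a') r \<otimes> c') (\<psi> (c \<otimes> a))" for c a
    unfolding \<Psi>_m_invariant_right[OF r entwinedD(2)[OF u]] by (rule sweedler_entwined[OF u bil_tens_comp[OF m_lin1]])
qed

lemma entwined_D:
  assumes u: "entwined p u"
  shows "entwined (Suc p) (\<lambda>a. D (u a))"
proof (rule entwinedI)
  show "lin (\<lambda>a. D (u a))" by (rule lin_comp[OF D_lin entwinedD(1)[OF u]])
  show "D (u a) \<in> piece R (Suc p)" for a by (rule D_piece[OF entwinedD(2)[OF u]])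
  show "\<Psi> (c \<otimes> D (u a)) = sweedler (\<lambda>a' c'. D (u a') \<otimes> c') (\<psi> (c \<otimes> a))" for c a
    unfolding \<Psi>_D[OF entwinedD(2)[OF u]] by (rule sweedler_entwined[OF u bil_tens_comp[OF D_lin]])
qed

lemma T_entwined:
  assumes u: "entwined p u" and y: "y \<in> piece R q" and n: "p + q = n"
  shows "T c (m (u a) y) = (- 1) ^ (p * q) * sweedler (\<lambda>a' c'. T c' (m y (u a'))) (\<psi> (c \<otimes> a))"
proof -
  have "bil (\<lambda>x' c'. T c' (m y x'))"
    by (intro bilI lin_comp[OF bilD2[OF T_bil'] m_lin2] bilD1[OF T_bil'])
  then show ?thesis
    using T_trace[OF entwinedD(2)[OF u] y n] sweedler_entwined[OF u] by simp
qed

lemma T_invariant: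
  assumes r: "invariant r" and y: "y \<in> piece R n"
  shows "T c (m r y) = T c (m y r)"
proof -
  have "bil (\<lambda>x' c'. T c' (m y x'))"
    by (intro bilI lin_comp[OF bilD2[OF T_bil'] m_lin2] bilD1[OF T_bil'])
  then show ?thesis
    using T_trace[of r 0 y n] r y by (simp add: invariant_def sweedler_tens)
qed

end

section \<open>The trace on matrices over a cycle\<close>

context globalized_cycle
begin

definition M :: "nat \<Rightarrow> (nat \<Rightarrow>\<^sub>0 'r \<times> complex) endo set" where
  "M p = {Mat x | x. \<forall>i j. x i j \<in> piece R p}"

definition d :: "(nat \<Rightarrow>\<^sub>0 'r \<times> complex) endo \<Rightarrow> (nat \<Rightarrow>\<^sub>0 'r \<times> complex) endo" where
  "d f = (\<Sum>i<3. \<Sum>j<3. E i j (D (entry i j f)))"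

definition mtrace :: "'c \<Rightarrow> (nat \<Rightarrow>\<^sub>0 'r \<times> complex) endo \<Rightarrow> complex" where
  "mtrace c f = (\<Sum>i<3. T c (entry i i f))"

lemma M_iff: "f \<in> M p \<longleftrightarrow> (\<exists>x. f = Mat x \<and> (\<forall>i j. x i j \<in> piece R p))"
  by (auto simp: M_def)

lemma Mat_in_M: "(\<And>i j. x i j \<in> piece R p) \<Longrightarrow> Mat x \<in> M p"
  by (auto simp: M_def)

lemma in_M_E:
  assumes "f \<in> M p"
  obtains x where "f = Mat x" "\<And>i j. x i j \<in> piece R p"
  using assms by (auto simp: M_def)

lemma d_Mat: "d (Mat x) = Mat (\<lambda>i j. D (x i j))"
proof -
  have "d (Mat x) = (\<Sum>i<3. \<Sum>j<3. E i j (D (x i j)))"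
    unfolding d_def by (intro sum.cong refl) (simp add: entry_Mat)
  then show ?thesis by (simp only: Mat_def)
qed

lemma mtrace_Mat: "mtrace c (Mat x) = (\<Sum>i<3. T c (x i i))"
  unfolding mtrace_def by (intro sum.cong refl) (simp add: entry_Mat)

lemmas T_lin' = bilD2[OF T_bil']

lemma mtrace_E: "mtrace c (E i j r) = (if i = j \<and> i < 3 then T c r else 0)"
proof -
  have "mtrace c (E i j r) = (\<Sum>k<3. if k = i then (if i = j then T c r else 0) else 0)"
    unfolding mtrace_def by (intro sum.cong refl) (auto simp: entry_E lin_zero[OF T_lin'])
  then show ?thesis by (simp add: sum.delta)
qed

lemma mtrace_bil: "bil mtrace"
  unfolding mtrace_def
  by (intro bilI lin_sum' lin_comp[OF T_lin' entry_lin] bilD1[OF T_bil'])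

lemma d_lin': "lin d"
  unfolding d_def by (intro lin_sum' lin_comp[OF E_lin] lin_comp[OF D_lin] entry_lin)

lemma mm_piece: "(\<And>i j. x i j \<in> piece R p) \<Longrightarrow> (\<And>i j. y i j \<in> piece R q) \<Longrightarrow> mm x y i j \<in> piece R (p + q)"
  unfolding mm_def by (intro cvs.subspace_sum piece_sub m_piece)

lemma D_mm:
  assumes "\<And>i j. x i j \<in> piece R p" "\<And>i j. y i j \<in> piece R q"
  shows "D (mm x y i j) = mm (\<lambda>i j. D (x i j)) y i j + (- 1) ^ p *\<^sub>C mm x (\<lambda>i j. D (y i j)) i j"
  unfolding mm_def lin_sum[OF D_lin] D_m[OF assms] by (simp add: sum.distrib cvs.scale_sum_right)

sublocale mats: closed_trace M d mtrace n
proof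
  show "cvs.subspace (M i)" for i
  proof (rule cvs.subspaceI)
    show "0 \<in> M i"
      unfolding M_iff by (rule exI[of _ "\<lambda>_ _. 0"]) (simp add: Mat_def cvs.subspace_0[OF piece_sub])
    show "x + y \<in> M i" if "x \<in> M i" "y \<in> M i" for x y
      using that by (elim in_M_E) (simp only: Mat_add[symmetric], intro Mat_in_M cvs.subspace_add[OF piece_sub])
    show "k *\<^sub>C x \<in> M i" if "x \<in> M i" for k x
      using that by (elim in_M_E) (simp only: Mat_scale[symmetric], intro Mat_in_M cvs.subspace_scale[OF piece_sub])
  qed
  show "x * y \<in> M (i + j)" if "x \<in> M i" "y \<in> M j" for x y i j
    using that by (elim in_M_E) (simp only: Mat_mult, intro Mat_in_M mm_piece)
  show "d x \<in> M (Suc i)" if "x \<in> M i" for x i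
    using that by (elim in_M_E) (simp only: d_Mat, intro Mat_in_M D_piece)
  show "d (x * y) = d x * y + (- 1) ^ i *\<^sub>C (x * d y)" if xy: "x \<in> M i" "y \<in> M j" for x y i j
  proof -
    obtain u v where u: "x = Mat u" "\<And>i' j'. u i' j' \<in> piece R i" and v: "y = Mat v" "\<And>i' j'. v i' j' \<in> piece R j"
      using xy unfolding M_iff by blast
    show ?thesis
      unfolding u(1) v(1) Mat_mult d_Mat D_mm[OF u(2) v(2)] Mat_add Mat_scale ..
  qed
  show "d (d x) = 0" if "x \<in> M i" for x i
  proof -
    obtain u where u: "x = Mat u" "\<And>i' j'. u i' j' \<in> piece R i" using \<open>x \<in> M i\<close> unfolding M_iff by blast
    show ?thesis unfolding u(1) d_Mat D_D[OF u(2)] by (simp add: Mat_def)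
  qed
  show "mtrace c (d x) = 0" if x: "x \<in> M i" and n: "n = Suc i" for x i c
  proof -
    obtain u where u: "x = Mat u" "\<And>i' j'. u i' j' \<in> piece R i" using x unfolding M_iff by blast
    show ?thesis unfolding u(1) d_Mat mtrace_Mat T_closed[OF u(2) n] by simp
  qed
qed (rule d_lin', rule mtrace_bil)

definition entwined_mat :: "nat \<Rightarrow> ('a \<Rightarrow> nat \<Rightarrow> nat \<Rightarrow> 'r) \<Rightarrow> bool" where
  "entwined_mat p X \<longleftrightarrow> (\<forall>i j. entwined p (\<lambda>a. X a i j))"

definition invariant_mat :: "(nat \<Rightarrow> nat \<Rightarrow> 'r) \<Rightarrow> bool" where
  "invariant_mat x \<longleftrightarrow> (\<forall>i j. invariant (x i j))"

lemma invariant_mat_mm: "invariant_mat x \<Longrightarrow> invariant_mat y \<Longrightarrow> invariant_mat (mm x y)"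
  by (simp add: invariant_mat_def mm_def eval_nat_numeral invariant_add invariant_m)

lemma entwined_mat_mm1: "invariant_mat x \<Longrightarrow> entwined_mat p X \<Longrightarrow> entwined_mat p (\<lambda>a. mm x (X a))"
  unfolding invariant_mat_def entwined_mat_def mm_def
  by (intro allI entwined_sum entwined_m_left) blast+

lemma entwined_mat_mm2: "invariant_mat x \<Longrightarrow> entwined_mat p X \<Longrightarrow> entwined_mat p (\<lambda>a. mm (X a) x)"
  unfolding invariant_mat_def entwined_mat_def mm_def
  by (intro allI entwined_sum entwined_m_right) blast+

text \<open>Exchanging two matrices under the matrix trace exchanges the order of a finite double sum, so the
identity is inherited from the entries.\<close>
lemma mtrace_entwined:
  assumes X: "entwined_mat p X" and w: "\<omega> \<in> M q" and n: "p + q = n"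
  shows "mtrace c (Mat (X a) * \<omega>) = (- 1) ^ (p * q) * sweedler (\<lambda>a' c'. mtrace c' (\<omega> * Mat (X a'))) (\<psi> (c \<otimes> a))"
proof -
  obtain w where w: "\<omega> = Mat w" "\<And>i j. w i j \<in> piece R q" using w unfolding M_iff by blast
  have X': "entwined p (\<lambda>a. X a i j)" for i j using X by (simp add: entwined_mat_def)
  have b: "bil (\<lambda>a' c'. T c' (m y (X a' i j)))" for y i j
    by (intro bilI lin_comp[OF T_lin'] lin_comp[OF m_lin2] entwinedD(1)[OF X'] bilD1[OF T_bil'])
  have b2: "bil (\<lambda>a' c'. \<Sum>i\<in>S. T c' (m (w k i) (X a' i k)))" for S k
    by (intro bilI lin_sum' bilD1[OF b] bilD2[OF b])
  have "mtrace c (Mat (X a) * \<omega>) = (\<Sum>i<3. \<Sum>k<3. (- 1) ^ (p * q) *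
      sweedler (\<lambda>a' c'. T c' (m (w k i) (X a' i k))) (\<psi> (c \<otimes> a)))"
    unfolding w(1) Mat_mult mtrace_Mat mm_def lin_sum[OF T_lin'] T_entwined[OF X' w(2) n] ..
  also have "\<dots> = (\<Sum>k<3. \<Sum>i<3. (- 1) ^ (p * q) *
      sweedler (\<lambda>a' c'. T c' (m (w k i) (X a' i k))) (\<psi> (c \<otimes> a)))"
    by (rule sum.swap)
  also have "\<dots> = (- 1) ^ (p * q) * sweedler (\<lambda>a' c'. \<Sum>k<3. \<Sum>i<3. T c' (m (w k i) (X a' i k))) (\<psi> (c \<otimes> a))"
    by (simp only: sum_distrib_left sweedler_fun_sum[OF b2] sweedler_fun_sum[OF b])
  finally show ?thesis
    unfolding w(1) Mat_mult mtrace_Mat mm_def lin_sum[OF T_lin'] .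
qed

lemma mtrace_invariant:
  assumes x: "invariant_mat x" and w: "\<omega> \<in> M n"
  shows "mtrace c (Mat x * \<omega>) = mtrace c (\<omega> * Mat x)"
proof -
  obtain w where w: "\<omega> = Mat w" "\<And>i j. w i j \<in> piece R n" using w unfolding M_iff by blast
  have x': "invariant (x i j)" for i j using x by (simp add: invariant_mat_def)
  show ?thesis
    unfolding w(1) Mat_mult mtrace_Mat mm_def lin_sum[OF T_lin'] T_invariant[OF x' w(2)] by (rule sum.swap)
qed

lemma trace_hom_matrices:
  assumes X: "entwined_mat 0 X" and x: "invariant_mat x"
    and mult: "\<And>a b. Mat (X (a * b)) = Mat (X a) * Mat (X b)"
  shows "trace_hom M d mtrace n \<psi> (\<lambda>a. Mat (X a)) (Mat x)"
proof
  have X': "entwined 0 (\<lambda>a. X a i j)" for i j using X by (simp add: entwined_mat_def)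
  have dX: "entwined_mat 1 (\<lambda>a i j. D (X a i j))"
    using entwined_D[OF X'] by (simp add: entwined_mat_def)
  show "lin (\<lambda>a. Mat (X a))"
    unfolding Mat_def by (intro lin_sum' lin_comp[OF E_lin] entwinedD(1)[OF X'])
  show "Mat (X (a * b)) = Mat (X a) * Mat (X b)" for a b by (rule mult)
  show "Mat (X a) \<in> M 0" for a unfolding M_iff using entwinedD(2)[OF X'] by blast
  show "Mat x \<in> M 0" unfolding M_iff using x by (auto simp: invariant_mat_def invariant_def)
  show "mtrace c (Mat (X a) * \<omega>) = sweedler (\<lambda>a' c'. mtrace c' (\<omega> * Mat (X a'))) (\<psi> (c \<otimes> a))"
    if "\<omega> \<in> M n" for \<omega> c a
    using mtrace_entwined[OF X that, of c a] by simp
  show "mtrace c (d (Mat (X a)) * \<omega>) = (- 1) ^ k * sweedler (\<lambda>a' c'. mtrace c' (\<omega> * d (Mat (X a')))) (\<psi> (c \<otimes> a))"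
    if "\<omega> \<in> M k" "n = Suc k" for \<omega> c a k
    unfolding d_Mat using mtrace_entwined[OF dX that(1), of c a] that(2) by simp
  show "mtrace c (Mat x * \<omega>) = mtrace c (\<omega> * Mat x)" if "\<omega> \<in> M n" for \<omega> c
    by (rule mtrace_invariant[OF x that])
qed

definition form :: "('a \<Rightarrow> 'r) \<Rightarrow> 'a \<Rightarrow> 'a list \<Rightarrow> 'r" where
  "form u a as = foldl m (u a) (map (\<lambda>a. D (u a)) as)"

lemma d_E: "i < 3 \<Longrightarrow> j < 3 \<Longrightarrow> d (E i j r) = E i j (D r)"
proof -
  assume ij: "i < 3" "j < 3"
  have "E i j r = Mat (\<lambda>k l. if k = i \<and> l = j then r else 0)"
    using ij unfolding Mat_expand by (auto simp: less_Suc_eq numeral_3_eq_3)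
  moreover have "E i j (D r) = Mat (\<lambda>k l. D (if k = i \<and> l = j then r else 0))"
    using ij unfolding Mat_expand by (auto simp: less_Suc_eq numeral_3_eq_3 lin_zero[OF D_lin])
  ultimately show ?thesis by (simp add: d_Mat)
qed

text \<open>The row \<open>(P, Z)\<close> and the column \<open>(Q, Z')\<close> identify the homomorphism \<open>diag(u, v)\<close> with \<open>v\<close>.  With
\<open>V\<^sub>0\<close>, \<open>V\<^sub>1\<close> of shape \<open>3 \<times> 2\<close> given by the identity block and by the row \<open>(P, Z)\<close>, with \<open>W\<close> of shape
\<open>2 \<times> 3\<close> consisting of the identity block and the column \<open>(Q, Z')\<close>, and with \<open>V\<^sub>t\<close> the affine path from \<open>V\<^sub>0\<close>
to \<open>V\<^sub>1\<close>, the product \<open>W V\<^sub>t\<close> acts as the identity on \<open>diag(u, v)\<close>.  Hence \<open>V\<^sub>t diag(u, v) W\<close> is a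
homomorphism for every \<open>t\<close>.  Its character is that of \<open>u\<close> plus that of \<open>v\<close> at \<open>t = 0\<close>, and that of
\<open>v\<close> at \<open>t = 1\<close>, because at both ends the matrices are triangular.\<close>
lemma flabby_character_cobounds:
  assumes inv: "invariant e" "invariant P" "invariant Q" "invariant Z" "invariant Z'"
    and u: "entwined 0 u" and v: "entwined 0 v"
    and u_mult: "\<And>a b. u (a * b) = m (u a) (u b)" and v_mult: "\<And>a b. v (a * b) = m (v a) (v b)"
    and e: "\<And>x. x \<in> piece R 0 \<Longrightarrow> m e x = x \<and> m x e = x"
    and left: "\<And>a. m Q (m P (u a)) = u a" "\<And>a. m Q (m Z (v a)) = 0" "\<And>a. m Z' (m P (u a)) = 0"
       "\<And>a. m Z' (m Z (v a)) = v a"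
    and right: "\<And>a. m (u a) (m Q P) = u a" "\<And>a. m (u a) (m Q Z) = 0" "\<And>a. m (v a) (m Z' P) = 0"
       "\<And>a. m (v a) (m Z' Z) = v a"
    and total: "\<And>a. m P (m (u a) Q) + m Z (m (v a) Z') = v a"
  shows "n = 0 \<Longrightarrow> T c (u a) = 0"
    and "n = Suc k \<Longrightarrow> \<exists>h\<in>cyclic_cochains \<psi> k. \<forall>c a as. length as = n \<longrightarrow>
      coboundary_map \<psi> k h c (a # as) = - T c (form u a as)"
proof -
  assume n: "n = 0"
  have u0: "u a \<in> piece R n" and v0: "v a \<in> piece R n" using entwinedD(2)[OF u] entwinedD(2)[OF v] n by auto
  have mp: "m x y \<in> piece R n" if "invariant x" "y \<in> piece R n" for x y
    using m_piece[OF invariantD(1)[OF that(1)] that(2)] by simp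
  have mp': "m y x \<in> piece R n" if "invariant x" "y \<in> piece R n" for x y
    using m_piece[OF that(2) invariantD(1)[OF that(1)]] by simp
  have "T c (v a) = T c (m P (m (u a) Q)) + T c (m Z (m (v a) Z'))"
    using total[of a] by (metis lin_add[OF T_lin'])
  also have "T c (m P (m (u a) Q)) = T c (u a)"
    using T_invariant[OF inv(2) mp'[OF inv(3) u0]] right(1) by (simp add: m_assoc)
  also have "T c (m Z (m (v a) Z')) = T c (v a)"
    using T_invariant[OF inv(4) mp'[OF inv(5) v0]] right(4) by (simp add: m_assoc)
  finally show "T c (u a) = 0" by simp
next
  assume n: "n = Suc k"
  define V0 where "V0 = (\<lambda>i j. if i = j \<and> i < (2::nat) then e else 0)"
  define V1 where "V1 = (\<lambda>i j. if i = (2::nat) \<and> j = (0::nat) then P else if i = 2 \<and> j = 1 then Z else 0)"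
  define W where "W = (\<lambda>i j. if i = j \<and> i < (2::nat) then e else if i = 0 \<and> j = 2 then Q
      else if i = 1 \<and> j = 2 then Z' else 0)"
  define F where "F = (\<lambda>a i j. if i = (0::nat) \<and> j = (0::nat) then u a else if i = 1 \<and> j = 1 then v a else 0)"
  have V0: "Mat V0 = E 0 0 e + E 1 1 e" by (simp add: Mat_expand V0_def)
  have V1: "Mat V1 = E 2 0 P + E 2 1 Z" by (simp add: Mat_expand V1_def)
  have W: "Mat W = E 0 0 e + E 0 2 Q + E 1 1 e + E 1 2 Z'" by (simp add: Mat_expand W_def)
  have F: "Mat (F a) = E 0 0 (u a) + E 1 1 (v a)" for a by (simp add: Mat_expand F_def)
  note [simp] = e[OF entwinedD(2)[OF u], THEN conjunct1] e[OF entwinedD(2)[OF u], THEN conjunct2]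
    e[OF entwinedD(2)[OF v], THEN conjunct1] e[OF entwinedD(2)[OF v], THEN conjunct2]
    e[OF invariantD(1)[OF inv(2)], THEN conjunct1] e[OF invariantD(1)[OF inv(3)], THEN conjunct1]
    e[OF invariantD(1)[OF inv(4)], THEN conjunct1] e[OF invariantD(1)[OF inv(5)], THEN conjunct1]
    e[OF invariantD(1)[OF inv(2)], THEN conjunct2] e[OF invariantD(1)[OF inv(3)], THEN conjunct2]
    e[OF invariantD(1)[OF inv(4)], THEN conjunct2] e[OF invariantD(1)[OF inv(5)], THEN conjunct2]
    e[OF invariantD(1)[OF inv(1)], THEN conjunct1]
  let ?v0 = "Mat V0" and ?v1 = "Mat V1" and ?w = "Mat W" and ?f = "\<lambda>a. Mat (F a)"
  have rel: "?w * ?v0 * ?f a = ?f a" "?w * ?v1 * ?f a = ?f a" "?f a * ?w * ?v0 = ?f a" "?f a * ?w * ?v1 = ?f a" for a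
    unfolding V0 V1 W F
    by (simp_all add: distrib_left distrib_right E_mult m_assoc left right lin_add[OF E_lin, symmetric])
  have F_mult: "?f (a * b) = ?f a * ?f b" for a b
    unfolding F by (simp add: distrib_left distrib_right E_mult u_mult v_mult)
  define G0 where "G0 a = ?v0 * ?f a * ?w" for a
  define G1 where "G1 a = ?v1 * ?f a * ?w" for a
  define Vt where "Vt t i j = V0 i j + of_real t *\<^sub>C (V1 i j + (- 1) *\<^sub>C V0 i j)" for t :: real and i j
  let ?vt = "\<lambda>t. Mat (Vt t)"
  have vt: "?vt t = ?v0 + of_real t *\<^sub>C (?v1 - ?v0)" for t
    unfolding Vt_def Mat_add Mat_scale by (simp add: cvs.scale_minus_left scaleC_one)
  \<comment> \<open>The derivative of \<open>V\<^sub>t\<close> is constant and \<open>W V\<^sub>t\<close> acts as the identity, so \<open>(V\<^sub>1 - V\<^sub>0) W\<close> generates the path.\<close>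
  define N where "N = mm (\<lambda>i j. V1 i j + (- 1) *\<^sub>C V0 i j) W"
  have N: "Mat N = (?v1 - ?v0) * ?w"
    unfolding N_def Mat_mult[symmetric] Mat_add Mat_scale by (simp add: cvs.scale_minus_left scaleC_one)
  have Gt: "G0 a + of_real t *\<^sub>C (G1 a - G0 a) = Mat (mm (mm (Vt t) (F a)) W)" for t a
    unfolding Mat_mult[symmetric] vt G0_def G1_def by (simp add: algebra_simps scaleC_mult_simps scaleC_add_right)
  have inv_V: "invariant_mat V0" "invariant_mat V1" "invariant_mat W"
    using inv by (auto simp: invariant_mat_def V0_def V1_def W_def invariant_0)
  have inv_Vt: "invariant_mat (Vt t)" for t
    using inv_V unfolding invariant_mat_def Vt_def
    by (intro allI invariant_add invariant_scale) blast+
  have inv_N: "invariant_mat N"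
    unfolding N_def
  proof (rule invariant_mat_mm[OF _ inv_V(3)])
    show "invariant_mat (\<lambda>i j. V1 i j + (- 1) *\<^sub>C V0 i j)"
      using inv_V unfolding invariant_mat_def by (intro allI invariant_add invariant_scale) blast+
  qed
  have ent_F: "entwined_mat 0 F"
    unfolding entwined_mat_def
  proof (intro allI)
    fix i j :: nat
    consider "i = 0 \<and> j = 0" | "i = 1 \<and> j = 1" | "\<not> (i = 0 \<and> j = 0)" "\<not> (i = 1 \<and> j = 1)" by blast
    then show "entwined 0 (\<lambda>a. F a i j)"
    proof cases
      case 1
      then have "(\<lambda>a. F a i j) = u" by (simp add: F_def)
      then show ?thesis using u by simp
    next
      case 2
      then have "(\<lambda>a. F a i j) = v" by (simp add: F_def)
      then show ?thesis using v by simp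
    next
      case 3
      then have "(\<lambda>a. F a i j) = (\<lambda>a. 0)" unfolding F_def by (simp only: if_False)
      then show ?thesis using entwined_0 by simp
    qed
  qed
  have wvf: "?w * ?vt t * ?f a = ?f a" for t a
    using rel(1,2)[of a] unfolding vt by (simp add: algebra_simps scaleC_mult_simps)
  have fwv: "?f a * ?w * (?v1 - ?v0) = 0" for a
    using rel(3,4)[of a] by (simp add: algebra_simps)
  have hom: "trace_hom M d mtrace (Suc k) \<psi> (\<lambda>a. G0 a + of_real t *\<^sub>C (G1 a - G0 a)) (Mat N)" for t
    unfolding Gt n[symmetric]
  proof (rule trace_hom_matrices[OF _ inv_N])
    show "entwined_mat 0 (\<lambda>a. mm (mm (Vt t) (F a)) W)"
      by (intro entwined_mat_mm2 entwined_mat_mm1 inv_V inv_Vt ent_F)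
    fix a b
    have "Mat (mm (mm (Vt t) (F a)) W) * Mat (mm (mm (Vt t) (F b)) W) = ?vt t * ?f a * (?w * ?vt t * ?f b) * ?w"
      by (simp add: Mat_mult[symmetric] mult.assoc)
    then show "Mat (mm (mm (Vt t) (F (a * b))) W) = Mat (mm (mm (Vt t) (F a)) W) * Mat (mm (mm (Vt t) (F b)) W)"
      unfolding wvf by (simp add: Mat_mult[symmetric] F_mult mult.assoc)
  qed
  have path: "G1 a - G0 a = Mat N * (G0 a + of_real t *\<^sub>C (G1 a - G0 a))
      - (G0 a + of_real t *\<^sub>C (G1 a - G0 a)) * Mat N" for t a
  proof -
    have "Mat N * Mat (mm (mm (Vt t) (F a)) W) = (?v1 - ?v0) * (?w * ?vt t * ?f a) * ?w"
      unfolding N Mat_mult[symmetric] by (simp add: mult.assoc)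
    moreover have "Mat (mm (mm (Vt t) (F a)) W) * Mat N = ?vt t * (?f a * ?w * (?v1 - ?v0)) * ?w"
      unfolding N Mat_mult[symmetric] by (simp add: mult.assoc)
    ultimately show ?thesis
      unfolding Gt wvf fwv by (simp add: G0_def G1_def algebra_simps)
  qed
  obtain h where h: "h \<in> cyclic_cochains \<psi> k"
    and cob: "\<And>c a as. length as = Suc k \<Longrightarrow> coboundary_map \<psi> k h c (a # as) =
       mtrace c (G1 a * dform (\<lambda>a. d (G1 a)) as) - mtrace c (G0 a * dform (\<lambda>a. d (G0 a)) as)"
    using path_characters_cohomologous[OF hom path] by blast
  have G0': "G0 a = E 0 0 (u a) + E 0 2 (m (u a) Q) + E 1 1 (v a) + E 1 2 (m (v a) Z')" for a
    unfolding G0_def V0 W F by (simp add: distrib_left distrib_right E_mult add_ac)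
  have G1': "G1 a = E 2 0 (m P (u a)) + E 2 1 (m Z (v a)) + E 2 2 (v a)" for a
  proof -
    have "G1 a = E 2 0 (m P (u a)) + E 2 1 (m Z (v a)) + E 2 2 (m P (m (u a) Q) + m Z (m (v a) Z'))"
      unfolding G1_def V1 W F
      by (simp add: distrib_left distrib_right E_mult m_assoc lin_add[OF E_lin] add_ac)
    then show ?thesis by (simp only: total)
  qed
  have dG0: "d (G0 a) = E 0 0 (D (u a)) + E 0 2 (D (m (u a) Q)) + E 1 1 (D (v a)) + E 1 2 (D (m (v a) Z'))" for a
    unfolding G0' by (simp add: lin_add[OF d_lin'] d_E)
  have dG1: "d (G1 a) = E 2 0 (D (m P (u a))) + E 2 1 (D (m Z (v a))) + E 2 2 (D (v a))" for a
    unfolding G1' by (simp add: lin_add[OF d_lin'] d_E)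
  \<comment> \<open>The third row of these matrices vanishes, so their third column does not contribute to the first
    two diagonal entries of a product.\<close>
  have prod0: "\<exists>y z. (E 0 0 x + E 0 2 r + E 1 1 x' + E 1 2 r') * dform (\<lambda>a. d (G0 a)) as
      = E 0 0 (foldl m x (map (\<lambda>a. D (u a)) as)) + E 0 2 y + E 1 1 (foldl m x' (map (\<lambda>a. D (v a)) as)) + E 1 2 z"
    for as x x' r r'
  proof (induction as arbitrary: x x' r r')
    case (Cons a as)
    have "(E 0 0 x + E 0 2 r + E 1 1 x' + E 1 2 r') * d (G0 a)
      = E 0 0 (m x (D (u a))) + E 0 2 (m x (D (m (u a) Q))) + E 1 1 (m x' (D (v a))) + E 1 2 (m x' (D (m (v a) Z')))"
      unfolding dG0 by (simp add: distrib_left distrib_right E_mult add_ac)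
    then show ?case
      using Cons[of "m x (D (u a))" "m x (D (m (u a) Q))" "m x' (D (v a))" "m x' (D (m (v a) Z'))"]
      by (simp add: mult.assoc[symmetric])
  qed auto
  \<comment> \<open>Only the third row is nonzero, so the last entry is multiplicative.\<close>
  have prod1: "\<exists>y z. (E 2 0 r + E 2 1 r' + E 2 2 x) * dform (\<lambda>a. d (G1 a)) as
      = E 2 0 y + E 2 1 z + E 2 2 (foldl m x (map (\<lambda>a. D (v a)) as))"
    for as x r r'
  proof (induction as arbitrary: x r r')
    case (Cons a as)
    have "(E 2 0 r + E 2 1 r' + E 2 2 x) * d (G1 a)
      = E 2 0 (m x (D (m P (u a)))) + E 2 1 (m x (D (m Z (v a)))) + E 2 2 (m x (D (v a)))"
      unfolding dG1 by (simp add: distrib_left distrib_right E_mult add_ac)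
    then show ?case
      using Cons[of "m x (D (m P (u a)))" "m x (D (m Z (v a)))" "m x (D (v a))"]
      by (simp add: mult.assoc[symmetric])
  qed auto
  note mtrace_lin = bilD2[OF mtrace_bil]
  have T0: "mtrace c (G0 a * dform (\<lambda>a. d (G0 a)) as) = T c (form u a as) + T c (form v a as)" for c a as
    using prod0[of "u a" "m (u a) Q" "v a" "m (v a) Z'" as]
    unfolding G0'[of a, symmetric] by (auto simp: lin_add[OF mtrace_lin] mtrace_E form_def)
  have T1: "mtrace c (G1 a * dform (\<lambda>a. d (G1 a)) as) = T c (form v a as)" for c a as
    using prod1[of "m P (u a)" "m Z (v a)" "v a" as]
    unfolding G1'[of a, symmetric] by (auto simp: lin_add[OF mtrace_lin] mtrace_E form_def)
  show "\<exists>h\<in>cyclic_cochains \<psi> k. \<forall>c a as. length as = n \<longrightarrow>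
      coboundary_map \<psi> k h c (a # as) = - T c (form u a as)"
    using h cob n by (intro bexI[of _ h]) (auto simp: T0 T1)
qed

end

section \<open>Vanishing cycles\<close>

lemma mat2_mult_nth: "mat2_mult f x y $ i $ j = f (x $ i $ 1) (y $ 1 $ j) + f (x $ i $ 2) (y $ 2 $ j)"
  by (simp add: mat2_mult_def sum_2)

lemma mat2_diag_nth: "mat2_diag a b $ 1 $ 1 = a" "mat2_diag a b $ 1 $ 2 = 0"
   "mat2_diag a b $ 2 $ 1 = 0" "mat2_diag a b $ 2 $ 2 = b"
  by (simp_all add: mat2_diag_def)

context assoc_alg
begin

lemmas m_distrib = lin_add[OF m_lin1] lin_add[OF m_lin2]

text \<open>One row of \<open>X diag(a, b) Y = r\<close>, multiplied by \<open>X = Y\<^sup>-\<^sup>1\<close> on the right.\<close>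
lemma conjugation_rows:
  assumes YX: "m y11 x11 + m y12 x21 = e" "m y11 x12 + m y12 x22 = 0"
      "m y21 x11 + m y22 x21 = 0" "m y21 x12 + m y22 x22 = e"
    and unit: "m a e = a" "m b e = b"
    and r: "m (m p a) y11 + m (m q b) y21 = r1" "m (m p a) y12 + m (m q b) y22 = r2"
  shows "m p a = m r1 x11 + m r2 x21" "m q b = m r1 x12 + m r2 x22"
proof -
  have "m r1 x11 + m r2 x21
      = m (m p a) (m y11 x11 + m y12 x21) + m (m q b) (m y21 x11 + m y22 x21)"
    unfolding r[symmetric] m_distrib by (simp add: m_assoc add_ac)
  then show "m p a = m r1 x11 + m r2 x21" unfolding YX by (simp add: m_assoc unit)
  have "m r1 x12 + m r2 x22
      = m (m p a) (m y11 x12 + m y12 x22) + m (m q b) (m y21 x12 + m y22 x22)"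
    unfolding r[symmetric] m_distrib by (simp add: m_assoc add_ac)
  then show "m q b = m r1 x12 + m r2 x22" unfolding YX by (simp add: m_assoc unit)
qed

text \<open>One column of \<open>X diag(a, b) Y = c\<close>, multiplied by \<open>Y = X\<^sup>-\<^sup>1\<close> on the left.\<close>
lemma conjugation_columns:
  assumes YX: "m y11 x11 + m y12 x21 = e" "m y11 x12 + m y12 x22 = 0"
      "m y21 x11 + m y22 x21 = 0" "m y21 x12 + m y22 x22 = e"
    and unit: "m e a = a" "m e b = b"
    and c: "m (m x11 a) s + m (m x12 b) t = c1" "m (m x21 a) s + m (m x22 b) t = c2"
  shows "m a s = m y11 c1 + m y12 c2" "m b t = m y21 c1 + m y22 c2"
proof -
  have "m y11 c1 + m y12 c2
      = m (m y11 x11 + m y12 x21) (m a s) + m (m y11 x12 + m y12 x22) (m b t)"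
    unfolding c[symmetric] m_distrib by (simp add: m_assoc add_ac)
  then show "m a s = m y11 c1 + m y12 c2" unfolding YX by (simp add: m_assoc[symmetric] unit)
  have "m y21 c1 + m y22 c2
      = m (m y21 x11 + m y22 x21) (m a s) + m (m y21 x12 + m y22 x22) (m b t)"
    unfolding c[symmetric] m_distrib by (simp add: m_assoc add_ac)
  then show "m b t = m y21 c1 + m y22 c2" unfolding YX by (simp add: m_assoc[symmetric] unit)
qed

text \<open>Here \<open>X diag(a, b) Y = diag(0, b)\<close> with \<open>Y = X\<^sup>-\<^sup>1\<close>.  The first row of \<open>X\<close> annihilates \<open>diag(a, b)\<close> and
the first column of \<open>Y\<close> is annihilated by it; what remains of \<open>X\<close> and \<open>Y\<close> is a row and a column that
identify \<open>diag(a, b)\<close> with \<open>b\<close>.\<close>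
lemma corner_relations:
  assumes YX: "m y11 x11 + m y12 x21 = e" "m y11 x12 + m y12 x22 = 0"
      "m y21 x11 + m y22 x21 = 0" "m y21 x12 + m y22 x22 = e"
    and XY: "m x21 y12 + m x22 y22 = e"
    and unit: "m e a = a" "m e b = b" "m a e = a" "m b e = b"
    and conj: "m (m x11 a) y11 + m (m x12 b) y21 = 0" "m (m x11 a) y12 + m (m x12 b) y22 = 0"
      "m (m x21 a) y11 + m (m x22 b) y21 = 0" "m (m x21 a) y12 + m (m x22 b) y22 = b"
  shows "m y12 (m x21 a) = a" "m y12 (m x22 b) = 0" "m y22 (m x21 a) = 0" "m y22 (m x22 b) = b"
    "m a (m y12 x21) = a" "m a (m y12 x22) = 0" "m b (m y22 x21) = 0" "m b (m y22 x22) = b"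
    "m x21 (m a y12) + m x22 (m b y22) = b"
proof -
  note rows = conjugation_rows[OF YX unit(3,4)] and cols = conjugation_columns[OF YX unit(1,2)]
  have 1: "m x11 a = 0" "m x12 b = 0" using rows[OF conj(1,2)] by simp_all
  have 3: "m a y11 = 0" "m b y21 = 0" using cols[OF conj(1,3)] by simp_all
  have "m y12 (m x21 a) = m (m y11 x11 + m y12 x21) a" by (simp add: m_distrib m_assoc 1)
  then show "m y12 (m x21 a) = a" unfolding YX unit .
  have "m y12 (m x22 b) = m (m y11 x12 + m y12 x22) b" by (simp add: m_distrib m_assoc 1)
  then show "m y12 (m x22 b) = 0" unfolding YX by simp
  have "m y22 (m x21 a) = m (m y21 x11 + m y22 x21) a" by (simp add: m_distrib m_assoc 1)
  then show "m y22 (m x21 a) = 0" unfolding YX by simp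
  have "m y22 (m x22 b) = m (m y21 x12 + m y22 x22) b" by (simp add: m_distrib m_assoc 1)
  then show "m y22 (m x22 b) = b" unfolding YX unit .
  have "m a (m y12 x21) = m a (m y11 x11 + m y12 x21)" by (simp add: m_distrib m_assoc[symmetric] 3)
  then show "m a (m y12 x21) = a" unfolding YX unit .
  have "m a (m y12 x22) = m a (m y11 x12 + m y12 x22)" by (simp add: m_distrib m_assoc[symmetric] 3)
  then show "m a (m y12 x22) = 0" unfolding YX by simp
  have "m b (m y22 x21) = m b (m y21 x11 + m y22 x21)" by (simp add: m_distrib m_assoc[symmetric] 3)
  then show "m b (m y22 x21) = 0" unfolding YX by simp
  have "m b (m y22 x22) = m b (m y21 x12 + m y22 x22)" by (simp add: m_distrib m_assoc[symmetric] 3)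
  then show "m b (m y22 x22) = b" unfolding YX unit .
  show "m x21 (m a y12) + m x22 (m b y22) = b" using conj(4) by (simp add: m_assoc)
qed

end

context globalized_cycle
begin

definition lmul :: "'r \<Rightarrow> ('r, 'c) tensor \<Rightarrow> ('r, 'c) tensor" where
  "lmul x = sweedler (\<lambda>v w. m x v \<otimes> w)"

lemma lmul_bil: "bil (\<lambda>v w. m x v \<otimes> w)"
  by (rule bil_tens_comp[OF m_lin2])

lemma lmul_lin: "lin (lmul x)"
  unfolding lmul_def by (rule lin_sweedler[OF lmul_bil])

lemma lmul_lin1: "lin (\<lambda>x. lmul x t)"
  unfolding lmul_def by (intro lin_sweedler_arg lmul_bil lin_tens1 m_lin1)

lemma lmul_tens: "lmul x (v \<otimes> w) = m x v \<otimes> w"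
  unfolding lmul_def by (rule sweedler_tens[OF lmul_bil])

lemma lmul_lmul: "lmul x (lmul y t) = lmul (m x y) t"
  unfolding lmul_def[of y] lin_comp_sweedler[OF lmul_lin lmul_bil] lmul_tens m_assoc[symmetric]
  by (simp add: lmul_def)

lemma lmul_unit:
  assumes "t \<in> tensor_on (piece R 0) UNIV" "\<And>x. x \<in> piece R 0 \<Longrightarrow> m e x = x"
  shows "lmul e t = t"
  using assms(1)
proof (induction rule: tensor_on_induct)
  case (tens v w)
  then show ?case by (simp add: lmul_tens assms(2))
next
  case (add s t)
  then show ?case by (simp add: lin_add[OF lmul_lin])
next
  case (scale k s)
  then show ?case by (simp add: lin_scale[OF lmul_lin])
qed (use cvs.subspace_0[OF piece_sub] in auto)

text \<open>The inverse of an invariant matrix is invariant: both columns below solve the same invertible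
  linear system.\<close>

lemma invariant_column:
  assumes x: "invariant x11" "invariant x12" "invariant x21" "invariant x22"
    and y: "y11 \<in> piece R 0" "y12 \<in> piece R 0" "y21 \<in> piece R 0" "y22 \<in> piece R 0"
    and s: "s \<in> piece R 0" "t \<in> piece R 0"
    and YX: "m y11 x11 + m y12 x21 = e" "m y11 x12 + m y12 x22 = 0"
      "m y21 x11 + m y22 x21 = 0" "m y21 x12 + m y22 x22 = e"
    and e: "\<And>x. x \<in> piece R 0 \<Longrightarrow> m e x = x"
    and inv: "invariant (m x11 s + m x12 t)" "invariant (m x21 s + m x22 t)"
  shows "invariant s" "invariant t"
proof -
  have eq: "\<Psi> (c \<otimes> s) - s \<otimes> c = 0" "\<Psi> (c \<otimes> t) - t \<otimes> c = 0" for c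
  proof -
    define B1 where "B1 = \<Psi> (c \<otimes> s) - s \<otimes> c"
    define B2 where "B2 = \<Psi> (c \<otimes> t) - t \<otimes> c"
    have row: "lmul p B1 + lmul q B2 = 0"
      if p: "invariant p" and q: "invariant q" and pq: "invariant (m p s + m q t)" for p q
    proof -
      have ps: "m p s \<in> total R" and qt: "m q t \<in> total R"
        using m_piece[OF invariantD(1)[OF p] s(1)] m_piece[OF invariantD(1)[OF q] s(2)] piece_total by auto
      have "\<Psi> (c \<otimes> (m p s + m q t)) = lmul p (\<Psi> (c \<otimes> s)) + lmul q (\<Psi> (c \<otimes> t))"
        unfolding \<Psi>_add[OF ps qt] \<Psi>_m_invariant_left[OF p s(1)] \<Psi>_m_invariant_left[OF q s(2)] lmul_def ..
      moreover have "(m p s + m q t) \<otimes> c = lmul p (s \<otimes> c) + lmul q (t \<otimes> c)"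
        by (simp add: lmul_tens tens_bilinear)
      ultimately show ?thesis
        using invariantD(2)[OF pq, of c] by (simp add: B1_def B2_def lin_diff[OF lmul_lin] algebra_simps)
    qed
    note r = row[OF x(1,2) inv(1)] row[OF x(3,4) inv(2)]
    have B: "B1 \<in> tensor_on (piece R 0) UNIV" "B2 \<in> tensor_on (piece R 0) UNIV"
      unfolding B1_def B2_def using s
      by (auto intro!: cvs.subspace_diff subspace_tensor_on \<Psi>_piece tens_in)
    have "lmul y11 (lmul x11 B1 + lmul x12 B2) + lmul y12 (lmul x21 B1 + lmul x22 B2)
       = lmul (m y11 x11 + m y12 x21) B1 + lmul (m y11 x12 + m y12 x22) B2"
      by (simp add: lin_add[OF lmul_lin] lin_add[OF lmul_lin1] lmul_lmul add_ac)
    then have "B1 = 0"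
      unfolding r YX by (simp add: lin_zero[OF lmul_lin] lin_zero[OF lmul_lin1] lmul_unit[OF B(1) e])
    have "lmul y21 (lmul x11 B1 + lmul x12 B2) + lmul y22 (lmul x21 B1 + lmul x22 B2)
       = lmul (m y21 x11 + m y22 x21) B1 + lmul (m y21 x12 + m y22 x22) B2"
      by (simp add: lin_add[OF lmul_lin] lin_add[OF lmul_lin1] lmul_lmul add_ac)
    then have "B2 = 0"
      unfolding r YX by (simp add: lin_zero[OF lmul_lin] lin_zero[OF lmul_lin1] lmul_unit[OF B(2) e])
    from \<open>B1 = 0\<close> \<open>B2 = 0\<close> show "\<Psi> (c \<otimes> s) - s \<otimes> c = 0" "\<Psi> (c \<otimes> t) - t \<otimes> c = 0"
      by (simp_all add: B1_def B2_def)
  qed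
  then show "invariant s" "invariant t" using s by (simp_all add: invariant_def)
qed

text \<open>The matrix units are independent, so the equation \<open>\<psi>(c \<otimes> X) = X \<otimes> c\<close> can be read off entry by
entry.\<close>
lemma invariant_entries:
  assumes X: "X \<in> mat2 (piece R 0)" and inv: "\<And>c. mat2_entwining (piece R 0) \<Psi> (c \<otimes> X) = X \<otimes> c"
  shows "invariant (X $ k $ l)"
proof -
  let ?V = "piece R 0"
  let ?\<beta> = "\<lambda>c x. \<Sum>i\<in>UNIV. \<Sum>j\<in>UNIV. tensor_map ?V UNIV (mat2_unit i j) id (\<Psi> (c \<otimes> x $ i $ j))"
  have unit_lin: "lin (mat2_unit i j :: 'r \<Rightarrow> 'r^2^2)" for i j
    by (auto intro!: linI simp: mat2_unit_def vec_eq_iff scaleC_vec_def)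
  have unit_bil: "bil (\<lambda>v w. (mat2_unit i j v :: 'r^2^2) \<otimes> (w :: 'c))" for i j
    by (rule bil_tens_comp[OF unit_lin])
  have tm: "tensor_map ?V UNIV (mat2_unit i j) id t = sweedler (\<lambda>v w. mat2_unit i j v \<otimes> w) t"
    if "t \<in> tensor_on ?V UNIV" for t :: "('r, 'c) tensor" and i j
    unfolding tensor_map_def
    by (rule tlift_eq_sweedler[OF piece_sub subspace_UNIV unit_bil _ that]) simp
  have Vx: "x $ i $ j \<in> ?V" if "x \<in> mat2 ?V" for x i j using that by (simp add: mat2_def)
  have eq: "?\<beta> c x = (\<Sum>i\<in>UNIV. \<Sum>j\<in>UNIV. sweedler (\<lambda>v w. mat2_unit i j v \<otimes> w) (\<Psi> (c \<otimes> x $ i $ j)))"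
    if "x \<in> mat2 ?V" for c x
    by (intro sum.cong refl tm \<Psi>_piece Vx that)
  have sub: "cvs.subspace (mat2 ?V)"
    by (rule cvs.subspaceI)
      (auto simp: mat2_def scaleC_vec_def cvs.subspace_0[OF piece_sub] cvs.subspace_add[OF piece_sub]
        cvs.subspace_scale[OF piece_sub])
  define sw where "sw i j = sweedler (\<lambda>v w. (mat2_unit i j v :: 'r^2^2) \<otimes> (w :: 'c))" for i j
  have sw_lin: "lin (sw i j)" for i j unfolding sw_def by (rule lin_sweedler[OF unit_bil])
  have eq': "?\<beta> c x = (\<Sum>i\<in>UNIV. \<Sum>j\<in>UNIV. sw i j (\<Psi> (c \<otimes> x $ i $ j)))" if "x \<in> mat2 ?V" for c x
    unfolding sw_def by (rule eq[OF that])
  have b1: "clinear_on UNIV (\<lambda>c. ?\<beta> c w)" if w: "w \<in> mat2 ?V" for w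
    unfolding eq'[OF w] by (intro lin_sum' lin_comp[OF sw_lin] \<Psi>_lin1 piece_total[OF Vx[OF w]])
  have b2: "clinear_on (mat2 ?V) (?\<beta> c)" for c
    unfolding clinear_on_def
  proof (intro conjI ballI allI)
    fix w w' assume w: "w \<in> mat2 ?V" and w': "w' \<in> mat2 ?V"
    have "sw i j (\<Psi> (c \<otimes> (w + w') $ i $ j)) = sw i j (\<Psi> (c \<otimes> w $ i $ j)) + sw i j (\<Psi> (c \<otimes> w' $ i $ j))" for i j
      using \<Psi>_add[OF piece_total[OF Vx[OF w]] piece_total[OF Vx[OF w']], of c i j i j]
      by (simp add: lin_add[OF sw_lin])
    then show "?\<beta> c (w + w') = ?\<beta> c w + ?\<beta> c w'"
      by (simp only: eq'[OF w] eq'[OF w'] eq'[OF cvs.subspace_add[OF sub w w']] sum.distrib)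
  next
    fix k w assume w: "w \<in> mat2 ?V"
    have "(k *\<^sub>C w) $ i $ j = k *\<^sub>C w $ i $ j" for i j by (simp add: scaleC_vec_def)
    then have "sw i j (\<Psi> (c \<otimes> (k *\<^sub>C w) $ i $ j)) = k *\<^sub>C sw i j (\<Psi> (c \<otimes> w $ i $ j))" for i j
      using \<Psi>_scale[OF piece_total[OF Vx[OF w]], of c k i j] by (simp add: lin_scale[OF sw_lin])
    then show "?\<beta> c (k *\<^sub>C w) = k *\<^sub>C ?\<beta> c w"
      by (simp only: eq'[OF w] eq'[OF cvs.subspace_scale[OF sub w]] cvs.scale_sum_right)
  qed
  have b: "cbilinear_on UNIV (mat2 ?V) ?\<beta>"
    unfolding cbilinear_on_def using b1 b2 by blast
  have XcE: "X \<otimes> c = (\<Sum>i\<in>UNIV. \<Sum>j\<in>UNIV. sweedler (\<lambda>v w. mat2_unit i j v \<otimes> w) (\<Psi> (c \<otimes> X $ i $ j)))" for c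
    using inv[of c] unfolding mat2_entwining_def tlift_tens[OF subspace_UNIV sub b UNIV_I X] eq[OF X] by simp
  have nth_lin: "lin (\<lambda>x :: 'r^2^2. x $ k $ l)"
    by (auto intro!: linI simp: scaleC_vec_def)
  define pk where "pk = sweedler (\<lambda>(x :: 'r^2^2) (c :: 'c). x $ k $ l \<otimes> c)"
  have pk_bil: "bil (\<lambda>(x :: 'r^2^2) (c :: 'c). x $ k $ l \<otimes> c)"
    by (rule bil_tens_comp[OF nth_lin])
  have pk_lin: "lin pk" unfolding pk_def by (rule lin_sweedler[OF pk_bil])
  have pk_unit: "pk (sweedler (\<lambda>v w. mat2_unit i j v \<otimes> w) t) = (if i = k \<and> j = l then t else 0)" for i j t
  proof -
    have "pk (sweedler (\<lambda>v w. mat2_unit i j v \<otimes> w) t) = sweedler (\<lambda>v w. pk (mat2_unit i j v \<otimes> w)) t"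
      by (rule lin_comp_sweedler[OF pk_lin unit_bil])
    also have "(\<lambda>v w. pk (mat2_unit i j v \<otimes> w)) = (\<lambda>v w. (if i = k \<and> j = l then 1 else 0) *\<^sub>C (v \<otimes> w))"
      unfolding pk_def sweedler_tens[OF pk_bil] by (auto simp: fun_eq_iff mat2_unit_def scaleC_one)
    also have "sweedler \<dots> t = (if i = k \<and> j = l then 1 else 0) *\<^sub>C t"
      unfolding sweedler_fun_scale[OF bil_tens] sweedler_id ..
    finally show ?thesis by (simp add: scaleC_one)
  qed
  have "X $ k $ l \<otimes> c = pk (X \<otimes> c)" for c
    unfolding pk_def sweedler_tens[OF pk_bil] ..
  also have "pk (X \<otimes> c) = \<Psi> (c \<otimes> X $ k $ l)" for c
    unfolding XcE lin_sum[OF pk_lin] pk_unit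
    by (cases "k = 1"; cases "l = 1") (use exhaust_2 in \<open>auto simp: sum_2\<close>)
  finally show ?thesis using Vx[OF X] by (simp add: invariant_def)
qed

end


lemma cyclic_cochains_uminus:
  assumes h: "h \<in> cyclic_cochains \<psi> k"
  shows "(\<lambda>c as. - h c as) \<in> cyclic_cochains \<psi> k"
proof -
  have hc: "h \<in> cochains k" using h unfolding cyclic_cochains_def by blast
  have "(\<lambda>c as. - h c as) \<in> cochains k"
    using hc unfolding cochains_def mem_Collect_eq by (auto intro: lin_uminus)
  moreover have "- h c as = (- 1) ^ k * sweedler (\<lambda>a' c'. - h c' (tl as @ [a'])) (\<psi> (c \<otimes> hd as))"
    if as: "length as = k + 1" for c as
  proof -
    have "bil (\<lambda>a' c'. h c' (tl as @ [a']))" using cochain_bil[OF hc, of "tl as" "[]"] by simp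
    then have "sweedler (\<lambda>a' c'. - h c' (tl as @ [a'])) (\<psi> (c \<otimes> hd as))
        = - sweedler (\<lambda>a' c'. h c' (tl as @ [a'])) (\<psi> (c \<otimes> hd as))"
      using lin_comp_sweedler[OF lin_uminus[OF lin_id], symmetric] by metis
    moreover have "h c as = (- 1) ^ k * sweedler (\<lambda>a' c'. h c' (tl as @ [a'])) (\<psi> (c \<otimes> hd as))"
      using h as unfolding cyclic_cochains_def by blast
    ultimately show ?thesis by simp
  qed
  ultimately show ?thesis unfolding cyclic_cochains_def by blast
qed

lemma coboundary_map_uminus:
  assumes h: "h \<in> cochains k"
  shows "coboundary_map \<psi> k (\<lambda>c as. - h c as) c as = - coboundary_map \<psi> k h c as"
proof (cases "length as = k + 2")
  case True
  then obtain a as' where as: "as = a # as'" "length as' = Suc k" by (cases as) auto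
  have "bil (\<lambda>a' c'. h c' (butlast as' @ [last as' * a']))"
    by (rule bil_comp1[OF cochain_bil[OF h] lin_const_mult[OF lin_id]])
  note 1 = lin_comp_sweedler[OF lin_uminus[OF lin_id] this, symmetric]
  have 2: "alt_faces (\<lambda>l. - h c l) as = - alt_faces (h c) as"
    by (rule alt_faces_lin[OF lin_uminus[OF lin_id], symmetric])
  show ?thesis using 1 2 unfolding as(1) coboundary_map_eq[OF as(2)] by simp
qed (simp add: coboundary_map_def)

context globalized_cycle
begin

lemma form_eq:
  assumes u: "entwined 0 u"
  shows "foldl (mul R) (u a) (map (\<lambda>a. diff R (u a)) as) = form u a as \<and> form u a as \<in> piece R (length as)"
proof (induction as rule: rev_induct)
  case Nil
  show ?case using entwinedD(2)[OF u] by (simp add: form_def)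
next
  case (snoc b as)
  have Du: "diff R (u b) = D (u b)" "D (u b) \<in> piece R 1"
    using D_eq[OF entwinedD(2)[OF u]] D_piece[OF entwinedD(2)[OF u]] by auto
  have "form u a (as @ [b]) = m (form u a as) (D (u b))" by (simp add: form_def)
  moreover have "foldl (mul R) (u a) (map (\<lambda>a. diff R (u a)) (as @ [b])) = mul R (form u a as) (D (u b))"
    using snoc Du by simp
  moreover have "mul R (form u a as) (D (u b)) = m (form u a as) (D (u b))"
    using snoc Du(2) by (intro m_eq) auto
  ultimately show ?case using m_piece[OF conjunct2[OF snoc] Du(2)] by simp
qed

lemma vanishing_cycle_character:
  assumes \<rho>: "algebra_hom_on UNIV (*) (piece R 0) (mul R) \<rho>"
    and \<rho>\<Psi>: "\<And>t. tensor_map UNIV UNIV \<rho> id (\<psi> t) = \<Psi> (tensor_map UNIV UNIV id \<rho> t)"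
    and van: "vanishing R \<Psi>"
  shows "cycle_character n R T0 \<rho> \<in> cyclic_coboundaries \<psi> n"
proof -
  let ?V = "piece R 0"
  obtain e \<nu> X Y where e: "unit_on ?V (mul R) e" and e_inv: "\<And>c. \<Psi> (c \<otimes> e) = e \<otimes> c"
    and \<nu>: "algebra_hom_on ?V (mul R) ?V (mul R) \<nu>"
    and \<nu>\<Psi>: "\<And>t. t \<in> tensor_on UNIV ?V \<Longrightarrow> tensor_map ?V UNIV \<nu> id (\<Psi> t) = \<Psi> (tensor_map UNIV ?V id \<nu> t)"
    and X: "X \<in> mat2_entwined_units ?V (mul R) e \<Psi>"
    and XY: "mat2_inverse_pair ?V (mul R) e X Y"
    and conj: "\<And>a. a \<in> ?V \<Longrightarrow> mat2_mult (mul R) (mat2_mult (mul R) X (mat2_diag a (\<nu> a))) Y = mat2_diag 0 (\<nu> a)"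
    using van unfolding vanishing_def by blast
  have mV: "mul R x y = m x y" if "x \<in> ?V" "y \<in> ?V" for x y using m_eq[OF that] .
  have mV_in: "m x y \<in> ?V" if "x \<in> ?V" "y \<in> ?V" for x y using m_piece[OF that] by simp
  have eV: "e \<in> ?V" and e_unit: "\<And>x. x \<in> ?V \<Longrightarrow> m e x = x \<and> m x e = x"
    using e mV by (auto simp: unit_on_def)
  have inv_e: "invariant e" using eV e_inv by (simp add: invariant_def)
  have XV: "X $ i $ j \<in> ?V" and YV: "Y $ i $ j \<in> ?V" for i j
    using XY by (auto simp: mat2_inverse_pair_def mat2_def)
  have invX: "invariant (X $ i $ j)" for i j
  proof (rule invariant_entries)
    show "X \<in> mat2 ?V" using XY by (simp add: mat2_inverse_pair_def)
    show "mat2_entwining ?V \<Psi> (c \<otimes> X) = X \<otimes> c" for c using X by (simp add: mat2_entwined_units_def)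
  qed
  have XY_eq: "mat2_mult (mul R) X Y = mat2_diag e e" and YX_eq: "mat2_mult (mul R) Y X = mat2_diag e e"
    using XY by (simp_all add: mat2_inverse_pair_def)
  have XY': "m (X $ i $ 1) (Y $ 1 $ j) + m (X $ i $ 2) (Y $ 2 $ j) = mat2_diag e e $ i $ j" for i j
    unfolding XY_eq[symmetric] mat2_mult_nth by (simp add: mV XV YV)
  have YX': "m (Y $ i $ 1) (X $ 1 $ j) + m (Y $ i $ 2) (X $ 2 $ j) = mat2_diag e e $ i $ j" for i j
    unfolding YX_eq[symmetric] mat2_mult_nth by (simp add: mV XV YV)
  have YX: "m (Y$1$1) (X$1$1) + m (Y$1$2) (X$2$1) = e" "m (Y$1$1) (X$1$2) + m (Y$1$2) (X$2$2) = 0"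
      "m (Y$2$1) (X$1$1) + m (Y$2$2) (X$2$1) = 0" "m (Y$2$1) (X$1$2) + m (Y$2$2) (X$2$2) = e"
    unfolding YX' by (simp_all add: mat2_diag_nth)
  have XY2: "m (X$2$1) (Y$1$2) + m (X$2$2) (Y$2$2) = e"
    unfolding XY' by (simp add: mat2_diag_nth)
  have inv0: "invariant (mat2_diag e e $ i $ j)" for i j
    by (simp add: mat2_diag_def inv_e invariant_0)
  have invY: "invariant (Y $ 1 $ j)" "invariant (Y $ 2 $ j)" for j
    using invariant_column[OF invX[of 1 1] invX[of 1 2] invX[of 2 1] invX[of 2 2]
        YV[of 1 1] YV[of 1 2] YV[of 2 1] YV[of 2 2] YV[of 1 j] YV[of 2 j] YX] e_unit
    by (simp_all only: XY' inv0)
  define v0 where "v0 r = \<nu> (pr0 r)" for r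
  have \<nu>_lin: "clinear_on ?V \<nu>" and \<nu>_in: "\<And>x. x \<in> ?V \<Longrightarrow> \<nu> x \<in> ?V"
    and \<nu>_mul: "\<And>x y. x \<in> ?V \<Longrightarrow> y \<in> ?V \<Longrightarrow> \<nu> (mul R x y) = mul R (\<nu> x) (\<nu> y)"
    using \<nu> by (auto simp: algebra_hom_on_def)
  have v0_lin: "lin v0" unfolding v0_def by (rule lin_of_clinear_on[OF \<nu>_lin pr0(1,2)])
  have v0_eq: "v0 x = \<nu> x" if "x \<in> ?V" for x by (simp add: v0_def pr0(3)[OF that])
  have \<rho>_in: "\<rho> a \<in> ?V" and \<rho>_lin: "lin \<rho>" and \<rho>_mul: "\<rho> (a * b) = mul R (\<rho> a) (\<rho> b)" for a b
    using \<rho> by (auto simp: algebra_hom_on_def)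
  have u: "entwined 0 \<rho>"
  proof (rule entwinedI[OF \<rho>_lin \<rho>_in])
    fix c a
    have "tensor_map UNIV UNIV \<rho> id (\<psi> (c \<otimes> a)) = sweedler (\<lambda>a' c'. \<rho> a' \<otimes> c') (\<psi> (c \<otimes> a))"
      by (simp add: tensor_map_def)
    moreover have "tensor_map UNIV UNIV id \<rho> (c \<otimes> a) = c \<otimes> \<rho> a"
      unfolding tensor_map_def
      by (subst sweedler_tens) (auto intro!: bilI lin_tens1 lin_tens2 lin_id \<rho>_lin)
    ultimately show "\<Psi> (c \<otimes> \<rho> a) = sweedler (\<lambda>a' c'. \<rho> a' \<otimes> c') (\<psi> (c \<otimes> a))"
      using \<rho>\<Psi>[of "c \<otimes> a"] by simp
  qed
  define v where "v a = v0 (\<rho> a)" for a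
  have v_eq: "v a = \<nu> (\<rho> a)" for a by (simp add: v_def v0_eq \<rho>_in)
  have v: "entwined 0 v"
  proof (rule entwinedI)
    show "lin v" unfolding v_def by (rule lin_comp[OF v0_lin \<rho>_lin])
    show "v a \<in> ?V" for a by (simp add: v_eq \<nu>_in \<rho>_in)
    fix c :: 'c and a :: 'a
    have b: "bil (\<lambda>c x. c \<otimes> v0 x :: ('c, 'r) tensor)" by (intro bilI lin_tens1 lin_tens2 lin_id v0_lin)
    have "tensor_map UNIV ?V id \<nu> (c \<otimes> \<rho> a) = sweedler (\<lambda>c x. c \<otimes> v0 x) (c \<otimes> \<rho> a)"
      unfolding tensor_map_def
      by (rule tlift_eq_sweedler[OF subspace_UNIV piece_sub b]) (auto simp: v0_eq tens_in \<rho>_in)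
    also have "\<dots> = c \<otimes> v a" by (simp add: sweedler_tens[OF b] v_def)
    finally have 1: "tensor_map UNIV ?V id \<nu> (c \<otimes> \<rho> a) = c \<otimes> v a" .
    have "tensor_map ?V UNIV \<nu> id (\<Psi> (c \<otimes> \<rho> a)) = sweedler (\<lambda>x c'. v0 x \<otimes> c') (\<Psi> (c \<otimes> \<rho> a))"
      unfolding tensor_map_def
      by (rule tlift_eq_sweedler[OF piece_sub subspace_UNIV bil_tens_comp[OF v0_lin]])
        (auto simp: v0_eq \<Psi>_piece \<rho>_in)
    also have "\<dots> = sweedler (\<lambda>a' c'. v a' \<otimes> c') (\<psi> (c \<otimes> a))"
      unfolding v_def by (rule sweedler_entwined[OF u bil_tens_comp[OF v0_lin]])
    finally show "\<Psi> (c \<otimes> v a) = sweedler (\<lambda>a' c'. v a' \<otimes> c') (\<psi> (c \<otimes> a))"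
      using \<nu>\<Psi>[of "c \<otimes> \<rho> a"] tens_in[of c UNIV "\<rho> a" ?V] \<rho>_in 1 by simp
  qed
  have vV: "v a \<in> ?V" for a by (rule entwinedD(2)[OF v])
  have conj': "m (m (X $ i $ 1) (\<rho> a)) (Y $ 1 $ j) + m (m (X $ i $ 2) (v a)) (Y $ 2 $ j) = mat2_diag 0 (v a) $ i $ j" for i j a
  proof -
    have 0: "0 \<in> ?V" by (rule cvs.subspace_0[OF piece_sub])
    have "mat2_mult (mul R) X (mat2_diag (\<rho> a) (v a)) $ i $ 1 = m (X $ i $ 1) (\<rho> a)"
      "mat2_mult (mul R) X (mat2_diag (\<rho> a) (v a)) $ i $ 2 = m (X $ i $ 2) (v a)"
      unfolding mat2_mult_nth mat2_diag_nth by (simp_all add: mV XV \<rho>_in vV 0)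
    then have "m (m (X $ i $ 1) (\<rho> a)) (Y $ 1 $ j) + m (m (X $ i $ 2) (v a)) (Y $ 2 $ j)
       = mat2_mult (mul R) (mat2_mult (mul R) X (mat2_diag (\<rho> a) (v a))) Y $ i $ j"
      unfolding mat2_mult_nth[of _ "mat2_mult (mul R) X (mat2_diag (\<rho> a) (v a))"]
      by (simp add: mV mV_in XV YV \<rho>_in vV)
    then show ?thesis using conj[OF \<rho>_in[of a]] by (simp add: v_eq)
  qed
  have c: "m (m (X$1$1) (\<rho> a)) (Y$1$1) + m (m (X$1$2) (v a)) (Y$2$1) = 0"
      "m (m (X$1$1) (\<rho> a)) (Y$1$2) + m (m (X$1$2) (v a)) (Y$2$2) = 0"
      "m (m (X$2$1) (\<rho> a)) (Y$1$1) + m (m (X$2$2) (v a)) (Y$2$1) = 0"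
      "m (m (X$2$1) (\<rho> a)) (Y$1$2) + m (m (X$2$2) (v a)) (Y$2$2) = v a" for a
    unfolding conj' by (simp_all add: mat2_diag_nth)
  have units: "m e (\<rho> a) = \<rho> a" "m e (v a) = v a" "m (\<rho> a) e = \<rho> a" "m (v a) e = v a" for a
    using e_unit \<rho>_in vV by auto
  note rel = corner_relations[OF YX XY2 units c]
  have u_mult: "\<rho> (a * b) = m (\<rho> a) (\<rho> b)" and v_mult: "v (a * b) = m (v a) (v b)" for a b
  proof -
    show "\<rho> (a * b) = m (\<rho> a) (\<rho> b)" by (simp add: \<rho>_mul mV \<rho>_in)
    show "v (a * b) = m (v a) (v b)" 
      using \<nu>_mul[OF \<rho>_in[of a] \<rho>_in[of b]] mV[OF \<nu>_in[OF \<rho>_in[of a]] \<nu>_in[OF \<rho>_in[of b]]]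
      by (simp add: v_eq \<rho>_mul)
  qed
  note main = flabby_character_cobounds[OF inv_e invX[of 2 1] invY(1)[of 2] invX[of 2 2] invY(2)[of 2] u v
      u_mult v_mult e_unit rel]
  have char: "cycle_character n R T0 \<rho> c (a # as) = T c (form \<rho> a as)" if "length as = n" for c a as
    using that form_eq[OF u, of a as] T_eq[of "form \<rho> a as" c] by (simp add: cycle_character_def)
  have char0: "cycle_character n R T0 \<rho> c as = 0" if "length as \<noteq> Suc n" for c as
    using that by (simp add: cycle_character_def)
  show ?thesis
  proof (cases n)
    case 0
    have "cycle_character n R T0 \<rho> c as = 0" for c as
    proof (cases as)
      case (Cons a as')
      show ?thesis
      proof (cases as')
        case Nil
        have "T c (\<rho> a) = 0" by (rule main(1)[OF _ 0])
        then show ?thesis using char[of "[]" c a] 0 Cons Nil by (simp add: form_def)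
      next
        case (Cons b bs)
        then show ?thesis using char0[of as c] \<open>as = a # as'\<close> 0 by simp
      qed
    qed (use char0[of as c] in simp)
    then have "cycle_character n R T0 \<rho> = (\<lambda>c as. 0)" by blast
    then show ?thesis by (simp add: 0)
  next
    case (Suc k)
    obtain h where h: "h \<in> cyclic_cochains \<psi> k"
      and cob: "\<And>c a as. length as = n \<Longrightarrow> coboundary_map \<psi> k h c (a # as) = - T c (form \<rho> a as)"
      using main(2)[OF _ Suc] by blast
    have hc: "h \<in> cochains k" using h unfolding cyclic_cochains_def by blast
    have "cycle_character n R T0 \<rho> c as = coboundary_map \<psi> k (\<lambda>c as. - h c as) c as" for c as
    proof (cases "length as = Suc n")
      case True
      then obtain a as' where as: "as = a # as'" "length as' = n" by (cases as) auto
      then show ?thesis using cob[of as' c a] char[of as' c a] by (simp add: coboundary_map_uminus[OF hc])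
    next
      case False
      then show ?thesis using char0[OF False] Suc by (simp add: coboundary_map_def)
    qed
    then have "cycle_character n R T0 \<rho> = coboundary_map \<psi> k (\<lambda>c as. - h c as)" by blast
    then show ?thesis using cyclic_cochains_uminus[OF h] by (simp add: Suc)
  qed
qed

end

theorem vanishing_character_is_coboundary:
  fixes \<psi> :: "('c::complex_vector, 'a::complex_algebra_1) tensor \<Rightarrow> ('a, 'c) tensor"
  assumes "is_vanishing_character TYPE('r::complex_vector) n \<Delta> \<epsilon> \<psi> g"
  shows "g \<in> cyclic_coboundaries \<psi> n"
proof -
  obtain R :: "'r dga" and \<Psi> T0 \<rho> where cyc: "entwined_cycle n \<psi> R \<Delta> \<epsilon> \<Psi> T0 \<rho>"
    and van: "vanishing R \<Psi>" and g: "g = cycle_character n R T0 \<rho>"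
    using assms unfolding is_vanishing_character_def by blast
  have over: "dg_entwining_over \<psi> R \<Delta> \<epsilon> \<Psi> \<rho>" and tr: "closed_graded_entwined_trace n R \<Psi> T0"
    using cyc by (simp_all add: entwined_cycle_def)
  have dg: "dg_entwining R \<Delta> \<epsilon> \<Psi>" and \<rho>: "algebra_hom_on UNIV (*) (piece R 0) (mul R) \<rho>"
    and \<rho>\<Psi>: "\<And>t. tensor_map UNIV UNIV \<rho> id (\<psi> t) = \<Psi> (tensor_map UNIV UNIV id \<rho> t)"
    using over by (simp_all add: dg_entwining_over_def)
  have sub: "cvs.subspace (piece R i)" for i
    using dg by (simp add: dg_entwining_def dg_algebra_def)
  obtain pr where pr: "lin pr" "\<And>x. pr x \<in> total R" "\<And>x. x \<in> total R \<Longrightarrow> pr x = x"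
    using exists_linear_projection[of "total R"] by (auto simp: total_def)
  obtain prn where prn: "lin prn" "\<And>x. prn x \<in> piece R n" "\<And>x. x \<in> piece R n \<Longrightarrow> prn x = x"
    using exists_linear_projection[OF sub] by blast
  obtain pr0 where pr0: "lin pr0" "\<And>x. pr0 x \<in> piece R 0" "\<And>x. x \<in> piece R 0 \<Longrightarrow> pr0 x = x"
    using exists_linear_projection[OF sub] by blast
  interpret globalized_cycle R \<Delta> \<epsilon> \<Psi> T0 n pr prn pr0 \<psi>
    by unfold_locales (fact dg tr pr prn pr0)+
  show ?thesis unfolding g by (rule vanishing_cycle_character[OF \<rho> \<rho>\<Psi> van])
qed

section \<open>Linear extension from a basis\<close>

definition lext :: "('k \<Rightarrow> 'u::complex_vector) \<Rightarrow> ('k \<Rightarrow>\<^sub>0 complex) \<Rightarrow> 'u" where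
  "lext b p = (\<Sum>k\<in>Poly_Mapping.keys p. Poly_Mapping.lookup p k *\<^sub>C b k)"

lemma lext_superset:
  assumes "finite K" "Poly_Mapping.keys p \<subseteq> K"
  shows "lext b p = (\<Sum>k\<in>K. Poly_Mapping.lookup p k *\<^sub>C b k)"
  unfolding lext_def using assms by (intro sum.mono_neutral_left) (auto simp: in_keys_iff)

lemma lin_lext: "lin (lext b)"
proof (rule linI)
  fix p q :: "'a \<Rightarrow>\<^sub>0 complex" and c
  let ?K = "Poly_Mapping.keys p \<union> Poly_Mapping.keys q"
  have "Poly_Mapping.keys (p + q) \<subseteq> ?K" by (rule Poly_Mapping.keys_add)
  then show "lext b (p + q) = lext b p + lext b q"
    by (simp add: lext_superset[of ?K] lookup_add scaleC_add_left sum.distrib)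
  have "Poly_Mapping.keys (c *\<^sub>C p) \<subseteq> Poly_Mapping.keys p"
    by (auto simp: in_keys_iff lookup_scaleC)
  then show "lext b (c *\<^sub>C p) = c *\<^sub>C lext b p"
    by (simp add: lext_superset[of "Poly_Mapping.keys p"] lookup_scaleC scaleC_complex_def
        cvs.scale_sum_right scaleC_scaleC)
qed

abbreviation bv :: "'k \<Rightarrow> 'k \<Rightarrow>\<^sub>0 complex" where "bv k \<equiv> Poly_Mapping.single k 1"

lemma lext_bv [simp]: "lext b (bv k) = b k"
  by (simp add: lext_def scaleC_one)

lemma lin_lext_arg: "(\<And>k. lin (\<lambda>z. b z k)) \<Longrightarrow> lin (\<lambda>z. lext (b z) p)"
  unfolding lext_def by (intro lin_sum' lin_scaleC)

lemma lext_comp: "lin h \<Longrightarrow> h (lext b p) = lext (\<lambda>k. h (b k)) p"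
  by (simp add: lext_def lin_sum lin_scale)

lemma lext_bv_id: "lext bv p = p"
proof -
  have "Poly_Mapping.lookup p k *\<^sub>C bv k = Poly_Mapping.single k (Poly_Mapping.lookup p k)" for k
    by (rule poly_mapping_eqI) (simp add: lookup_scaleC lookup_single scaleC_complex_def when_def)
  then show ?thesis unfolding lext_def by (simp only: poly_mapping_eq_sum_single[symmetric])
qed

lemma lin_eq_on_bv:
  assumes "lin f" "lin g" "\<And>k. f (bv k) = g (bv k)"
  shows "f p = g p"
proof -
  have "f p = lext (\<lambda>k. f (bv k)) p" using lext_comp[OF assms(1), of bv p] by (simp add: lext_bv_id)
  also have "\<dots> = lext (\<lambda>k. g (bv k)) p" by (simp add: assms(3))
  also have "\<dots> = g p" using lext_comp[OF assms(2), of bv p] by (simp add: lext_bv_id)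
  finally show ?thesis .
qed

lemma endo_eq_on_bv: "(\<And>k. app f (bv k) = app g (bv k)) \<Longrightarrow> f = g"
  by (rule endo_eqI, rule lin_eq_on_bv) (auto intro: lin_app)

definition of_basis :: "('k \<Rightarrow> ('k \<Rightarrow>\<^sub>0 complex)) \<Rightarrow> ('k \<Rightarrow>\<^sub>0 complex) endo" where
  "of_basis b = Endo (lext b)"

lemma app_of_basis [simp]: "app (of_basis b) p = lext b p"
  by (simp add: of_basis_def app_Endo lin_lext)

section \<open>Finite rank endomorphisms and the trace\<close>

text \<open>A finite set of rows contains all nonzero ones, so diagonal sums are finite; these operators are
the ones of finite rank.\<close>
definition finite_rank :: "('k \<Rightarrow>\<^sub>0 complex) endo set" where
  "finite_rank = {x. \<exists>K. finite K \<and> (\<forall>v. Poly_Mapping.keys (app x v) \<subseteq> K)}"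

lemma subspace_finite_rank: "cvs.subspace finite_rank"
proof (rule cvs.subspaceI)
  show "0 \<in> (finite_rank :: ('k \<Rightarrow>\<^sub>0 complex) endo set)"
    by (auto simp: finite_rank_def app_simps)
next
  fix x y :: "('k \<Rightarrow>\<^sub>0 complex) endo" assume "x \<in> finite_rank" "y \<in> finite_rank"
  then obtain K L where K: "finite K" "\<And>v. Poly_Mapping.keys (app x v) \<subseteq> K"
    and L: "finite L" "\<And>v. Poly_Mapping.keys (app y v) \<subseteq> L"
    unfolding finite_rank_def by blast
  have "Poly_Mapping.keys (app (x + y) v) \<subseteq> K \<union> L" for v
    using K(2)[of v] L(2)[of v] Poly_Mapping.keys_add[of "app x v" "app y v"] by (auto simp: app_simps)
  then show "x + y \<in> finite_rank" using K(1) L(1) unfolding finite_rank_def by blast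
next
  fix c and x :: "('k \<Rightarrow>\<^sub>0 complex) endo" assume "x \<in> finite_rank"
  then obtain K where K: "finite K" "\<And>v. Poly_Mapping.keys (app x v) \<subseteq> K" unfolding finite_rank_def by blast
  have "Poly_Mapping.keys (app (c *\<^sub>C x) v) \<subseteq> K" for v
    using K(2)[of v] by (auto simp: app_simps in_keys_iff lookup_scaleC)
  then show "c *\<^sub>C x \<in> finite_rank" using K(1) unfolding finite_rank_def by blast
qed

lemma finite_rank_mult_right: "x \<in> finite_rank \<Longrightarrow> x * y \<in> finite_rank"
  unfolding finite_rank_def by (auto simp: app_simps)

lemma finite_rank_mult_left:
  assumes "x \<in> finite_rank"
  shows "y * x \<in> finite_rank"
proof -
  obtain K where K: "finite K" "\<And>v. Poly_Mapping.keys (app x v) \<subseteq> K"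
    using assms unfolding finite_rank_def by blast
  let ?L = "\<Union>k\<in>K. Poly_Mapping.keys (app y (bv k))"
  have "Poly_Mapping.keys (app (y * x) v) \<subseteq> ?L" for v
  proof
    fix i assume i: "i \<in> Poly_Mapping.keys (app (y * x) v)"
    have "app (y * x) v = lext (\<lambda>k. app y (bv k)) (app x v)"
      using lext_comp[OF lin_app[of y], of bv "app x v"] by (simp add: app_simps lext_bv_id)
    also have "\<dots> = (\<Sum>k\<in>K. Poly_Mapping.lookup (app x v) k *\<^sub>C app y (bv k))"
      by (rule lext_superset[OF K])
    finally have "(\<Sum>k\<in>K. Poly_Mapping.lookup (app x v) k * Poly_Mapping.lookup (app y (bv k)) i) \<noteq> 0"
      using i by (simp add: in_keys_iff lookup_sum lookup_scaleC scaleC_complex_def)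
    then obtain k where "k \<in> K" "Poly_Mapping.lookup (app y (bv k)) i \<noteq> 0"
      by (metis (no_types, lifting) mult_zero_right sum.neutral)
    then show "i \<in> ?L" by (auto simp: in_keys_iff)
  qed
  moreover have "finite ?L" using K(1) by simp
  ultimately show ?thesis unfolding finite_rank_def by blast
qed

definition diag_sum :: "'k set \<Rightarrow> ('k \<Rightarrow>\<^sub>0 complex) endo \<Rightarrow> complex" where
  "diag_sum K x = (\<Sum>k\<in>K. Poly_Mapping.lookup (app x (bv k)) k)"

definition trace :: "('k \<Rightarrow>\<^sub>0 complex) endo \<Rightarrow> complex" where
  "trace x = diag_sum {k. Poly_Mapping.lookup (app x (bv k)) k \<noteq> 0} x"

lemma trace_eq_diag_sum:
  assumes "finite K" "\<And>v. Poly_Mapping.keys (app x v) \<subseteq> K"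
  shows "trace x = diag_sum K x"
  unfolding trace_def diag_sum_def
  using assms by (intro sum.mono_neutral_left) (force simp: in_keys_iff)+

lemma clinear_on_trace: "clinear_on finite_rank trace"
  unfolding clinear_on_def
proof (intro conjI ballI allI)
  fix x y :: "('k \<Rightarrow>\<^sub>0 complex) endo" assume "x \<in> finite_rank" "y \<in> finite_rank"
  then obtain K L where K: "finite K" "\<And>v. Poly_Mapping.keys (app x v) \<subseteq> K"
    and L: "finite L" "\<And>v. Poly_Mapping.keys (app y v) \<subseteq> L"
    unfolding finite_rank_def by blast
  have KL: "finite (K \<union> L)" using K L by simp
  have "Poly_Mapping.keys (app (x + y) v) \<subseteq> K \<union> L" for v
    using K(2)[of v] L(2)[of v] Poly_Mapping.keys_add[of "app x v" "app y v"] by (auto simp: app_simps)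
  note 1 = trace_eq_diag_sum[OF KL this]
  have "trace x = diag_sum (K \<union> L) x" "trace y = diag_sum (K \<union> L) y"
    by (rule trace_eq_diag_sum[OF KL]; use K L in blast)+
  then show "trace (x + y) = trace x + trace y"
    unfolding 1 by (simp add: diag_sum_def app_simps lookup_add sum.distrib)
next
  fix c and x :: "('k \<Rightarrow>\<^sub>0 complex) endo" assume "x \<in> finite_rank"
  then obtain K where K: "finite K" "\<And>v. Poly_Mapping.keys (app x v) \<subseteq> K" unfolding finite_rank_def by blast
  have "Poly_Mapping.keys (app (c *\<^sub>C x) v) \<subseteq> K" for v
    using K(2)[of v] by (auto simp: app_simps in_keys_iff lookup_scaleC)
  note 1 = trace_eq_diag_sum[OF K(1) this]
  show "trace (c *\<^sub>C x) = c *\<^sub>C trace x"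
    unfolding 1 trace_eq_diag_sum[OF K]
    by (simp add: diag_sum_def app_simps lookup_scaleC cvs.scale_sum_right)
qed

lemma lookup_app_mult:
  assumes "finite K" "Poly_Mapping.keys (app y v) \<subseteq> K"
  shows "Poly_Mapping.lookup (app (x * y) v) i =
    (\<Sum>k\<in>K. Poly_Mapping.lookup (app x (bv k)) i * Poly_Mapping.lookup (app y v) k)"
proof -
  have "app (x * y) v = lext (\<lambda>k. app x (bv k)) (app y v)"
    using lext_comp[OF lin_app[of x], of bv "app y v"] by (simp add: app_simps lext_bv_id)
  also have "\<dots> = (\<Sum>k\<in>K. Poly_Mapping.lookup (app y v) k *\<^sub>C app x (bv k))"
    by (rule lext_superset[OF assms])
  finally show ?thesis
    by (simp add: lookup_sum lookup_scaleC scaleC_complex_def mult.commute)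
qed

lemma trace_commute:
  assumes "x \<in> finite_rank"
  shows "trace (x * y) = trace (y * x)"
proof -
  obtain K where K: "finite K" "\<And>v. Poly_Mapping.keys (app x v) \<subseteq> K"
    using assms unfolding finite_rank_def by blast
  obtain K' where K': "finite K'" "\<And>v. Poly_Mapping.keys (app (y * x) v) \<subseteq> K'"
    using finite_rank_mult_left[OF assms, of y] unfolding finite_rank_def by blast
  define L where "L = K' \<union> (\<Union>k\<in>K. Poly_Mapping.keys (app y (bv k)))"
  have L: "finite L" using K K' by (simp add: L_def)
  have "trace (x * y) = diag_sum K (x * y)"
    by (rule trace_eq_diag_sum) (use K in \<open>auto simp: app_simps\<close>)
  also have "\<dots> = (\<Sum>i\<in>K. \<Sum>k\<in>L. Poly_Mapping.lookup (app x (bv k)) i * Poly_Mapping.lookup (app y (bv i)) k)"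
    unfolding diag_sum_def by (intro sum.cong refl lookup_app_mult L) (auto simp: L_def)
  also have "\<dots> = (\<Sum>k\<in>L. \<Sum>i\<in>K. Poly_Mapping.lookup (app y (bv i)) k * Poly_Mapping.lookup (app x (bv k)) i)"
    by (subst sum.swap) (simp add: mult.commute)
  also have "\<dots> = diag_sum L (y * x)"
    unfolding diag_sum_def by (intro sum.cong refl lookup_app_mult[symmetric] K)
  also have "\<dots> = trace (y * x)"
    by (rule trace_eq_diag_sum[symmetric, OF L]) (use K' in \<open>auto simp: L_def\<close>)
  finally show ?thesis .
qed

section \<open>A flabby algebra of endomorphisms\<close>

type_synonym cone = "(int list \<Rightarrow>\<^sub>0 complex) endo"

text \<open>The basis vectors with first entry \<open>i\<close> span a copy of the whole space.  The operator \<open>shift i\<close> maps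
onto that copy, \<open>bump\<close> translates the copies, and \<open>ampliation x\<close> acts as \<open>x\<close> on each copy with
\<open>i \<ge> 0\<close>.  Translation by one removes the copy at \<open>0\<close> from the ampliation; this is the last of the
\<open>cone_relations\<close>.\<close>
definition shift :: "int \<Rightarrow> cone" where
  "shift i = of_basis (\<lambda>l. bv (i # l))"

definition unshift :: cone where
  "unshift = of_basis (\<lambda>l. case l of [] \<Rightarrow> 0 | i # l' \<Rightarrow> if i = 0 then bv l' else 0)"

definition bump :: "int \<Rightarrow> cone" where
  "bump d = of_basis (\<lambda>l. case l of [] \<Rightarrow> bv [] | i # l' \<Rightarrow> bv ((i + d) # l'))"

definition ampliation :: "cone \<Rightarrow> cone" where
  "ampliation x = of_basis (\<lambda>l. case l of [] \<Rightarrow> 0 | i # l' \<Rightarrow> if 0 \<le> i then app (shift i) (app x (bv l')) else 0)"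

lemma app_shift_bv [simp]: "app (shift i) (bv l) = bv (i # l)"
  by (simp add: shift_def)

lemma ampliation_shift: "0 \<le> i \<Longrightarrow> app (ampliation x) (app (shift i) v) = app (shift i) (app x v)"
  by (rule lin_eq_on_bv[OF lin_comp[OF lin_app lin_app] lin_comp[OF lin_app lin_app]])
    (simp add: ampliation_def)

lemma unshift_shift: "app unshift (app (shift i) v) = (if i = 0 then v else 0)"
proof (rule lin_eq_on_bv[of _ _ v])
  show "lin (\<lambda>v. app unshift (app (shift i) v))" by (rule lin_comp[OF lin_app lin_app])
  show "lin (\<lambda>v. if i = 0 then v else 0)" by (cases "i = 0") (auto intro: lin_id lin_const0)
qed (simp add: unshift_def)

lemma bump_shift: "app (bump d) (app (shift i) v) = app (shift (i + d)) v"
  by (rule lin_eq_on_bv[OF lin_comp[OF lin_app lin_app] lin_app]) (simp add: bump_def)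

lemma ampliation_lin: "lin ampliation"
proof (intro linI endo_eq_on_bv)
  fix x y :: cone and c l
  show "app (ampliation (x + y)) (bv l) = app (ampliation x + ampliation y) (bv l)"
    by (cases l) (simp_all add: ampliation_def app_simps lin_add[OF lin_app])
  show "app (ampliation (c *\<^sub>C x)) (bv l) = app (c *\<^sub>C ampliation x) (bv l)"
    by (cases l) (simp_all add: ampliation_def app_simps lin_scale[OF lin_app])
qed

lemma ampliation_mult: "ampliation (x * y) = ampliation x * ampliation y"
proof (rule endo_eq_on_bv)
  fix l :: "int list"
  show "app (ampliation (x * y)) (bv l) = app (ampliation x * ampliation y) (bv l)"
  proof (cases l)
    case (Cons i l')
    have y: "app (ampliation y) (bv l) = (if 0 \<le> i then app (shift i) (app y (bv l')) else 0)"
      by (simp add: ampliation_def Cons)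
    show ?thesis
      by (simp add: app_simps y ampliation_shift lin_zero[OF lin_app]) (simp add: ampliation_def Cons app_simps)
  qed (simp add: ampliation_def app_simps lin_zero[OF lin_lext])
qed

lemma cone_relations:
  shows "unshift * shift 0 = 1" "bump 1 * bump (- 1) = 1" "bump (- 1) * bump 1 = 1"
    "shift 0 * x = ampliation x * shift 0" "unshift * ampliation x = x * unshift"
    "bump 1 * ampliation x = (ampliation x - shift 0 * x * unshift) * bump 1"
proof -
  show "unshift * shift 0 = 1" by (rule endo_eqI) (simp add: app_simps unshift_shift)
  show b: "bump 1 * bump (- 1) = 1" "bump (- 1) * bump 1 = 1"
    by (rule endo_eq_on_bv, rename_tac l, case_tac l; simp add: app_simps bump_def)+
  show "shift 0 * x = ampliation x * shift 0" by (rule endo_eqI) (simp add: app_simps ampliation_shift)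
  show "unshift * ampliation x = x * unshift"
  proof (rule endo_eq_on_bv)
    fix l show "app (unshift * ampliation x) (bv l) = app (x * unshift) (bv l)"
    proof (cases l)
      case (Cons i l')
      have "app (ampliation x) (bv l) = (if 0 \<le> i then app (shift i) (app x (bv l')) else 0)"
        by (simp add: ampliation_def Cons)
      moreover have "app unshift (bv l) = (if i = 0 then bv l' else 0)" by (simp add: unshift_def Cons)
      ultimately show ?thesis by (simp add: app_simps unshift_shift lin_zero[OF lin_app])
    qed (simp add: app_simps ampliation_def unshift_def lin_zero[OF lin_app] lin_zero[OF lin_lext])
  qed
  have "bump 1 * ampliation x * bump (- 1) = ampliation x - shift 0 * x * unshift"
  proof (rule endo_eq_on_bv)
    fix l show "app (bump 1 * ampliation x * bump (- 1)) (bv l) = app (ampliation x - shift 0 * x * unshift) (bv l)"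
    proof (cases l)
      case (Cons i l')
      have a: "app (ampliation x) (bv (j # l')) = (if 0 \<le> j then app (shift j) (app x (bv l')) else 0)" for j
        by (simp add: ampliation_def)
      have b: "app (bump (- 1)) (bv (i # l')) = bv ((i - 1) # l')" by (simp add: bump_def)
      have u: "app unshift (bv (i # l')) = (if i = 0 then bv l' else 0)" by (simp add: unshift_def)
      show ?thesis
        unfolding Cons app_simps b a u by (simp add: bump_shift lin_zero[OF lin_app])
    qed (simp add: app_simps ampliation_def unshift_def bump_def lin_zero[OF lin_app] lin_zero[OF lin_lext])
  qed
  then have "bump 1 * ampliation x * (bump (- 1) * bump 1) = (ampliation x - shift 0 * x * unshift) * bump 1"
    by (simp add: mult.assoc[symmetric])
  then show "bump 1 * ampliation x = (ampliation x - shift 0 * x * unshift) * bump 1"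
    by (simp add: b)
qed

text \<open>In terms of matrix units for the basis vectors \<open>[]\<close> and \<open>[0]\<close>, numbered \<open>0\<close> and \<open>1\<close>, these are
\<open>E\<^sub>0\<^sub>0 + E\<^sub>0\<^sub>1\<close> and \<open>E\<^sub>1\<^sub>0\<close>.\<close>
definition idem :: cone where
  "idem = of_basis (\<lambda>l. if l = [] \<or> l = [0] then bv [] else 0)"

definition nilp :: cone where
  "nilp = of_basis (\<lambda>l. if l = [] then bv [0] else 0)"

lemma idem_nilp:
  "idem * idem = idem" "idem * nilp * idem = idem" "nilp * idem * nilp = nilp" "nilp * nilp = 0"
  by (rule endo_eq_on_bv; simp add: app_simps idem_def nilp_def lin_zero[OF lin_lext])+

lemma of_basis_finite_rank:
  fixes b :: "'k \<Rightarrow> 'l \<Rightarrow>\<^sub>0 complex"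
  assumes "finite K" "\<And>k. Poly_Mapping.keys (b k) \<subseteq> K"
  shows "Poly_Mapping.keys (lext b v) \<subseteq> K"
proof
  fix i assume "i \<in> Poly_Mapping.keys (lext b v)"
  then have "(\<Sum>k\<in>Poly_Mapping.keys v. Poly_Mapping.lookup v k * Poly_Mapping.lookup (b k) i) \<noteq> 0"
    by (simp add: in_keys_iff lext_def lookup_sum lookup_scaleC scaleC_complex_def)
  then obtain k where "Poly_Mapping.lookup (b k) i \<noteq> 0"
    by (metis (no_types, lifting) mult_zero_right sum.neutral)
  then show "i \<in> K" using assms(2)[of k] by (auto simp: in_keys_iff)
qed

lemma idem_bounded: "Poly_Mapping.keys (app idem v) \<subseteq> {[]}"
  unfolding idem_def app_of_basis by (rule of_basis_finite_rank) auto

lemma nilp_bounded: "Poly_Mapping.keys (app nilp v) \<subseteq> {[0]}"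
  unfolding nilp_def app_of_basis by (rule of_basis_finite_rank) auto

lemma idem_finite_rank: "idem \<in> finite_rank" and nilp_finite_rank: "nilp \<in> finite_rank"
  unfolding finite_rank_def using idem_bounded nilp_bounded by blast+

lemma trace_idem: "trace idem = 1" "trace (idem * nilp) = 1"
proof -
  have "trace idem = diag_sum {[]} idem" by (rule trace_eq_diag_sum) (use idem_bounded in auto)
  then show "trace idem = 1" by (simp add: diag_sum_def idem_def)
  have "trace (idem * nilp) = diag_sum {[]} (idem * nilp)"
    by (rule trace_eq_diag_sum) (use idem_bounded in \<open>auto simp: app_simps\<close>)
  then show "trace (idem * nilp) = 1" by (simp add: diag_sum_def idem_def nilp_def app_simps)
qed

section \<open>Expansion in a basis\<close>

definition bas :: "'v::complex_vector set" where "bas = cvs.extend_basis {}"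

abbreviation coord :: "'v::complex_vector \<Rightarrow> 'v \<Rightarrow> complex" where
  "coord v b \<equiv> cvs.representation bas v b"

lemma bas_independent: "cvs.independent bas" and bas_span: "cvs.span bas = UNIV"
  by (auto simp: bas_def cvs.independent_extend_basis cvs.span_extend_basis cvs.independent_empty)

definition expand :: "'v::complex_vector \<Rightarrow> ('v \<Rightarrow> 'u::complex_vector) \<Rightarrow> 'u" where
  "expand v F = (\<Sum>b | coord v b \<noteq> 0. coord v b *\<^sub>C F b)"

lemma expand_superset:
  assumes "finite K" "{b. coord v b \<noteq> 0} \<subseteq> K"
  shows "expand v F = (\<Sum>b\<in>K. coord v b *\<^sub>C F b)"
  unfolding expand_def using assms by (intro sum.mono_neutral_left) auto

lemma finite_coord: "finite {b. coord v b \<noteq> 0}"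
  by (rule cvs.finite_representation)

lemma expand_lin: "lin (\<lambda>v. expand v F)"
proof (rule linI)
  fix v w :: 'a and k
  have add: "coord (v + w) b = coord v b + coord w b" for b
    by (simp add: cvs.representation_add[OF bas_independent] bas_span)
  have scale: "coord (k *\<^sub>C v) b = k * coord v b" for b
    by (simp add: cvs.representation_scale[OF bas_independent] bas_span)
  let ?K = "{b. coord v b \<noteq> 0} \<union> {b. coord w b \<noteq> 0}"
  have K: "finite ?K" using finite_coord by blast
  show "expand (v + w) F = expand v F + expand w F"
    unfolding expand_superset[OF K, of v, OF Un_upper1] expand_superset[OF K, of w, OF Un_upper2]
    by (subst expand_superset[OF K]) (auto simp: add scaleC_add_left sum.distrib)
  have "expand (k *\<^sub>C v) F = (\<Sum>b | coord v b \<noteq> 0. coord (k *\<^sub>C v) b *\<^sub>C F b)"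
    by (rule expand_superset[OF finite_coord]) (auto simp: scale)
  also have "\<dots> = (\<Sum>b | coord v b \<noteq> 0. k *\<^sub>C (coord v b *\<^sub>C F b))"
    by (simp add: scale scaleC_scaleC)
  also have "\<dots> = k *\<^sub>C expand v F" unfolding expand_def cvs.scale_sum_right ..
  finally show "expand (k *\<^sub>C v) F = k *\<^sub>C expand v F" .
qed

lemma expand_comp: "lin h \<Longrightarrow> h (expand v F) = expand v (\<lambda>b. h (F b))"
  by (simp add: expand_def lin_sum lin_scale)

lemma expand_eq: "lin F \<Longrightarrow> expand v F = F v"
proof -
  assume F: "lin F"
  have "(\<Sum>b | coord v b \<noteq> 0. coord v b *\<^sub>C b) = v"
    by (rule cvs.sum_nonzero_representation_eq[OF bas_independent]) (simp add: bas_span)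
  then show ?thesis
    using F unfolding expand_def by (metis (no_types, lifting) lin_scale lin_sum sum.cong)
qed

fun expand_word :: "'v::complex_vector list \<Rightarrow> ('v list \<Rightarrow> 'u::complex_vector) \<Rightarrow> 'u" where
  "expand_word [] F = F []"
| "expand_word (a # as) F = expand a (\<lambda>b. expand_word as (\<lambda>bs. F (b # bs)))"

lemma expand_word_comp: "lin h \<Longrightarrow> h (expand_word as F) = expand_word as (\<lambda>bs. h (F bs))"
  by (induction as arbitrary: F) (simp_all add: expand_comp)

lemma expand_lin_arg: "(\<And>b. lin (\<lambda>z. F z b)) \<Longrightarrow> lin (\<lambda>z. expand v (F z))"
  unfolding expand_def by (intro lin_sum' lin_scaleC)

lemma expand_word_lin: "lin (\<lambda>a. expand_word (us @ a # vs) F)"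
  by (induction us arbitrary: F) (simp_all add: expand_lin expand_lin_arg)

lemma expand_word_eq:
  assumes "\<And>us vs. lin (\<lambda>a. F (us @ a # vs))"
  shows "expand_word as F = F as"
  using assms
proof (induction as arbitrary: F)
  case (Cons a as)
  have "expand_word as (\<lambda>bs. F (b # bs)) = F (b # as)" for b
    by (rule Cons(1)) (use Cons(2)[of "b # us" for us] in simp)
  moreover have "lin (\<lambda>b. F (b # as))" using Cons(2)[of "[]"] by simp
  ultimately show ?case by (simp add: expand_eq)
qed simp

section \<open>Words\<close>

definition multilin :: "('x::complex_vector \<Rightarrow> 'a::complex_vector list \<Rightarrow> 'u::complex_vector) \<Rightarrow> bool" where
  "multilin F \<longleftrightarrow> (\<forall>as. lin (\<lambda>x. F x as)) \<and> (\<forall>x us vs. lin (\<lambda>a. F x (us @ a # vs)))"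

lemma multilinI:
  assumes "\<And>as. lin (\<lambda>x. F x as)" "\<And>x us vs. lin (\<lambda>a. F x (us @ a # vs))"
  shows "multilin F"
  using assms by (auto simp: multilin_def)

lemma multilinD:
  assumes "multilin F"
  shows "lin (\<lambda>x. F x as)" "lin (\<lambda>a. F x (us @ a # vs))" "lin (\<lambda>a. F x (a # vs))"
proof -
  show "lin (\<lambda>x. F x as)" and *: "lin (\<lambda>a. F x (us @ a # vs))" for us
    using assms unfolding multilin_def by blast+
  show "lin (\<lambda>a. F x (a # vs))" using *[of "[]"] by simp
qed

text \<open>Expansion in bases realises the tensors \<open>x \<otimes> a\<^sub>0 \<otimes> \<dots> \<otimes> a\<^sub>m\<close> in any free vector space with enough
generators.  The universal property is \<open>lift_word\<close>.\<close>

locale words =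
  fixes enc :: "'x::complex_vector \<times> 'a::complex_vector list \<Rightarrow> 'k"
  assumes enc: "inj enc"
begin

definition word :: "'x \<Rightarrow> 'a list \<Rightarrow> 'k \<Rightarrow>\<^sub>0 complex" where
  "word x as = expand x (\<lambda>y. expand_word as (\<lambda>bs. bv (enc (y, bs))))"

definition lift :: "('x \<Rightarrow> 'a list \<Rightarrow> 'u::complex_vector) \<Rightarrow> ('k \<Rightarrow>\<^sub>0 complex) \<Rightarrow> 'u" where
  "lift F = lext (\<lambda>k. case inv enc k of (y, bs) \<Rightarrow> F y bs)"

lemma lin_lift: "lin (lift F)"
  unfolding lift_def by (rule lin_lext)

lemma multilin_word: "multilin word"
  unfolding word_def
  by (intro multilinI expand_lin expand_lin_arg expand_word_lin)

lemma lift_word: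
  assumes F: "multilin F"
  shows "lift F (word x as) = F x as"
proof -
  have "lift F (word x as) = expand x (\<lambda>y. expand_word as (\<lambda>bs. lift F (bv (enc (y, bs)))))"
    unfolding word_def by (simp only: expand_comp[OF lin_lift] expand_word_comp[OF lin_lift])
  also have "\<dots> = expand x (\<lambda>y. expand_word as (F y))"
    by (simp add: lift_def inv_f_f[OF enc])
  also have "\<dots> = expand x (\<lambda>y. F y as)"
    by (simp only: expand_word_eq[OF multilinD(2)[OF F]])
  also have "\<dots> = F x as" by (rule expand_eq[OF multilinD(1)[OF F]])
  finally show ?thesis .
qed

lemma lin_lift_arg: "(\<And>x as. lin (\<lambda>z. F z x as)) \<Longrightarrow> lin (\<lambda>z. lift (F z) p)"
  unfolding lift_def by (rule lin_lext_arg) (simp add: case_prod_beta)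

end

section \<open>Moving a coalgebra element through a word\<close>

text \<open>In Sweedler notation \<open>pass \<psi> c [a\<^sub>1, \<dots>, a\<^sub>m] F\<close> is \<open>F [a\<^sub>1\<^sub>\<psi>, \<dots>, a\<^sub>m\<^sub>\<psi>] c\<^sup>\<psi>\<close>, where \<open>c\<close> has been moved past all
letters from left to right.\<close>
fun pass :: "(('c::complex_vector, 'a::complex_vector) tensor \<Rightarrow> ('a, 'c) tensor) \<Rightarrow> 'c \<Rightarrow> 'a list
    \<Rightarrow> ('a list \<Rightarrow> 'c \<Rightarrow> 'u::complex_vector) \<Rightarrow> 'u" where
  "pass \<psi> c [] F = F [] c"
| "pass \<psi> c (a # as) F = sweedler (\<lambda>a' c'. pass \<psi> c' as (\<lambda>as'. F (a' # as'))) (\<psi> (c \<otimes> a))"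

definition mlin :: "('a::complex_vector list \<Rightarrow> 'c::complex_vector \<Rightarrow> 'u::complex_vector) \<Rightarrow> bool" where
  "mlin F \<longleftrightarrow> (\<forall>as. lin (F as)) \<and> (\<forall>us vs c. lin (\<lambda>a. F (us @ a # vs) c))"

lemma mlinI:
  assumes "\<And>as. lin (F as)" "\<And>us vs c. lin (\<lambda>a. F (us @ a # vs) c)"
  shows "mlin F"
  using assms by (auto simp: mlin_def)

lemma mlinD:
  assumes "mlin F"
  shows "lin (F as)" "lin (\<lambda>a. F (us @ a # vs) c)" "lin (\<lambda>a. F (a # vs) c)"
proof -
  show "lin (F as)" and *: "lin (\<lambda>a. F (us @ a # vs) c)" for us
    using assms unfolding mlin_def by blast+
  show "lin (\<lambda>a. F (a # vs) c)" using *[of "[]"] by simp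
qed

lemma mlin_Cons: "mlin F \<Longrightarrow> mlin (\<lambda>as. F (a # as))"
proof (rule mlinI)
  assume F: "mlin F"
  show "lin (F (a # as))" for as by (rule mlinD(1)[OF F])
  show "lin (\<lambda>b. F (a # us @ b # vs) c)" for us vs c using mlinD(2)[OF F, of "a # us"] by simp
qed

lemma mlin_append: "mlin F \<Longrightarrow> mlin (\<lambda>as. F (us @ as))"
proof (rule mlinI)
  assume F: "mlin F"
  show "lin (F (us @ as))" for as by (rule mlinD(1)[OF F])
  show "lin (\<lambda>b. F (us @ ws @ b # vs) c)" for ws vs c using mlinD(2)[OF F, of "us @ ws"] by simp
qed

lemma mlin_bil: "mlin F \<Longrightarrow> bil (\<lambda>a c. F (us @ a # vs) c)"
  by (rule bilI) (erule mlinD)+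

lemma pass_append: "pass \<psi> c (as @ bs) F = pass \<psi> c as (\<lambda>as' c'. pass \<psi> c' bs (\<lambda>bs'. F (as' @ bs')))"
  by (induction as arbitrary: c F) simp_all

lemma pass_cong:
  "(\<And>as' c'. length as' = length as \<Longrightarrow> F as' c' = G as' c') \<Longrightarrow> pass \<psi> c as F = pass \<psi> c as G"
proof (induction as arbitrary: c F G)
  case (Cons a as)
  have "pass \<psi> c' as (\<lambda>as'. F (a' # as')) = pass \<psi> c' as (\<lambda>as'. G (a' # as'))" for a' c'
    by (rule Cons(1)) (use Cons(2) in auto)
  then show ?case by simp
qed simp

locale linear_swap =
  fixes \<psi> :: "('c::complex_vector, 'a::complex_vector) tensor \<Rightarrow> ('a, 'c) tensor"
  assumes \<psi>_lin: "lin \<psi>"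
begin

lemma \<psi>_lin1: "lin (\<lambda>c. \<psi> (c \<otimes> a))" and \<psi>_lin2: "lin (\<lambda>a. \<psi> (c \<otimes> a))"
  by (rule lin_comp[OF \<psi>_lin lin_tens1[OF lin_id]], rule lin_comp[OF \<psi>_lin lin_tens2[OF lin_id]])

text \<open>Linearity in \<open>c\<close> and in a parameter of \<open>F\<close> are proved together: after the first letter has been
passed, it has become a parameter.\<close>
lemma pass_lin_aux:
  fixes as :: "'a list"
  shows "(\<forall>F :: 'a list \<Rightarrow> 'c \<Rightarrow> 'u::complex_vector. mlin F \<longrightarrow> lin (\<lambda>c. pass \<psi> c as F)) \<and>
   (\<forall>F c. (\<forall>z :: 'a. mlin (F z :: 'a list \<Rightarrow> 'c \<Rightarrow> 'u)) \<longrightarrow> (\<forall>as c. lin (\<lambda>z. F z as c)) \<longrightarrow> lin (\<lambda>z. pass \<psi> c as (F z)))"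
proof (induction as)
  case Nil
  then show ?case by (auto intro: mlinD)
next
  case (Cons a as)
  have b: "bil (\<lambda>a' c'. pass \<psi> c' as (\<lambda>as'. F (a' # as')))" if F: "mlin F" for F :: "'a list \<Rightarrow> 'c \<Rightarrow> 'u"
  proof (rule bilI)
    show "lin (\<lambda>a'. pass \<psi> c' as (\<lambda>as'. F (a' # as')))" for c'
      using Cons mlin_Cons[OF F] mlinD(3)[OF F] by simp
    show "lin (\<lambda>c'. pass \<psi> c' as (\<lambda>as'. F (a' # as')))" for a'
      using Cons mlin_Cons[OF F] by simp
  qed
  show ?case
  proof (intro conjI allI impI)
    fix F :: "'a list \<Rightarrow> 'c \<Rightarrow> 'u" assume F: "mlin F"
    show "lin (\<lambda>c. pass \<psi> c (a # as) F)"
      unfolding pass.simps by (rule lin_comp[OF lin_sweedler[OF b[OF F]] \<psi>_lin1])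
  next
    fix F :: "'a \<Rightarrow> 'a list \<Rightarrow> 'c \<Rightarrow> 'u" and c
    assume F: "\<forall>z. mlin (F z)" and z: "\<forall>as c. lin (\<lambda>z. F z as c)"
    have "lin (\<lambda>z. pass \<psi> c' as (\<lambda>as'. F z (a' # as')))" for a' c'
    proof -
      have 1: "\<forall>z. mlin (\<lambda>as'. F z (a' # as'))" using F mlin_Cons by blast
      have 2: "\<forall>as c. lin (\<lambda>z. F z (a' # as) c)" using z by blast
      from spec[OF spec[OF conjunct2[OF Cons], of "\<lambda>z as'. F z (a' # as')"], of c'] 1 2
      show ?thesis by blast
    qed
    then show "lin (\<lambda>z. pass \<psi> c (a # as) (F z))"
      unfolding pass.simps using F by (intro lin_sweedler_arg b) blast+
  qed
qed

lemma pass_lin: "mlin F \<Longrightarrow> lin (\<lambda>c. pass \<psi> c as F)"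
  using pass_lin_aux by blast

lemma pass_bil:
  assumes F: "mlin F"
  shows "bil (\<lambda>a' c'. pass \<psi> c' as (\<lambda>as'. F (a' # as')))"
proof (rule bilI)
  have 1: "\<forall>z. mlin (\<lambda>as'. F (z # as'))" using mlin_Cons[OF F] by blast
  have 2: "\<forall>as c. lin (\<lambda>z. F (z # as) c)" using mlinD(3)[OF F] by blast
  show "lin (\<lambda>a'. pass \<psi> c' as (\<lambda>as'. F (a' # as')))" for c'
    using spec[OF spec[OF conjunct2[OF pass_lin_aux[of as]], of "\<lambda>z as'. F (z # as')"], of c'] 1 2 by blast
qed (rule pass_lin[OF mlin_Cons[OF F]])

lemma pass_lin_param:
  assumes "\<And>z. mlin (F z)" "\<And>as c. lin (\<lambda>z. F z as c)"
  shows "lin (\<lambda>z. pass \<psi> c as (F z))"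
  using assms
proof (induction as arbitrary: c F)
  case (Cons a as)
  have "lin (\<lambda>z. pass \<psi> c' as (\<lambda>as'. F z (a' # as')))" for a' c'
    by (rule Cons(1)) (rule mlin_Cons[OF Cons(2)], rule Cons(3))
  then show ?case
    unfolding pass.simps by (intro lin_sweedler_arg pass_bil Cons(2))
qed simp

lemma pass_lin_letter:
  assumes F: "mlin F"
  shows "lin (\<lambda>a. pass \<psi> c (us @ a # vs) F)"
  using F
proof (induction us arbitrary: c F)
  case Nil
  then show ?case by (simp add: lin_comp[OF lin_sweedler[OF pass_bil] \<psi>_lin2])
next
  case (Cons u us)
  then show ?case by (simp add: lin_sweedler_arg pass_bil mlin_Cons)
qed

lemma pass_comp:
  assumes h: "lin h" and F: "mlin F"
  shows "h (pass \<psi> c as F) = pass \<psi> c as (\<lambda>as c. h (F as c))"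
  using F
proof (induction as arbitrary: c F)
  case (Cons a as)
  show ?case
    using Cons(1)[OF mlin_Cons[OF Cons(2)]] lin_comp_sweedler[OF h pass_bil[OF Cons(2)]] by simp
qed simp

lemma pass_in_subspace:
  assumes S: "cvs.subspace S" and F: "mlin F"
    and "\<And>as' c'. length as' = length as \<Longrightarrow> F as' c' \<in> S"
  shows "pass \<psi> c as F \<in> S"
  using F assms(3)
proof (induction as arbitrary: c F)
  case (Cons a as)
  show ?case
    unfolding pass.simps
    by (rule sweedler_in_subspace[OF S subspace_UNIV subspace_UNIV pass_bil[OF Cons(2)] Cons(1)[OF mlin_Cons[OF Cons(2)]]])
      (auto simp: Cons(3) tensor_on_UNIV)
qed simp

lemma sweedler_pass_commute:
  assumes F: "\<And>x y. mlin (\<lambda>as c. F as c x y)" and F2: "\<And>as c. bil (F as c)"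
  shows "pass \<psi> c as (\<lambda>as' c'. sweedler (\<lambda>x y. F as' c' x y) t) = sweedler (\<lambda>x y. pass \<psi> c as (\<lambda>as' c'. F as' c' x y)) t"
  using F F2
proof (induction as arbitrary: c F)
  case (Cons a as)
  have b1: "bil (\<lambda>v w. pass \<psi> w as (\<lambda>as' c'. F (v # as') c' x y))" for x y
    by (rule pass_bil[OF Cons(2)])
  have b2: "bil (\<lambda>x y. pass \<psi> w as (\<lambda>as' c'. F (v # as') c' x y))" for v w
  proof (rule bilI)
    show "lin (\<lambda>x. pass \<psi> w as (\<lambda>as' c'. F (v # as') c' x y))" for y
      by (rule pass_lin_param[OF mlin_Cons[OF Cons(2)] bilD1[OF Cons(3)]])
    show "lin (\<lambda>y. pass \<psi> w as (\<lambda>as' c'. F (v # as') c' x y))" for x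
      by (rule pass_lin_param[OF mlin_Cons[OF Cons(2)] bilD2[OF Cons(3)]])
  qed
  have "pass \<psi> c' as (\<lambda>as' c''. sweedler (\<lambda>x y. F (a' # as') c'' x y) t)
     = sweedler (\<lambda>x y. pass \<psi> c' as (\<lambda>as' c''. F (a' # as') c'' x y)) t" for a' c'
    by (rule Cons(1)) (rule mlin_Cons[OF Cons(2)], rule Cons(3))
  then show ?case
    unfolding pass.simps using sweedler_commute[OF b1 b2] by simp
qed simp

end

section \<open>Passing through products, units and coproducts\<close>

text \<open>The product of words, in which the two letters at the junction are multiplied.\<close>
definition merge :: "'a::times list \<Rightarrow> 'a list \<Rightarrow> 'a list" where
  "merge as bs = butlast as @ (last as * hd bs) # tl bs"

lemma merge_snoc: "merge (us @ [a]) bs = us @ (a * hd bs) # tl bs"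
  by (simp add: merge_def)

lemma merge_Cons2: "merge (a # b # as) bs = a # merge (b # as) bs"
  by (simp add: merge_def)

lemma merge_append: "as \<noteq> [] \<Longrightarrow> merge (us @ as) bs = us @ merge as bs"
  by (simp add: merge_def butlast_append)

lemma merge_append_right: "bs \<noteq> [] \<Longrightarrow> merge as (bs @ vs) = merge as bs @ vs"
  by (cases bs) (simp_all add: merge_def)

lemma length_merge: "as \<noteq> [] \<Longrightarrow> bs \<noteq> [] \<Longrightarrow> Suc (length (merge as bs)) = length as + length bs"
  by (cases as; cases bs) (simp_all add: merge_def)

lemma merge_assoc:
  fixes as :: "'a::semigroup_mult list"
  shows "bs \<noteq> [] \<Longrightarrow> merge (merge as bs) cs = merge as (merge bs cs)"
proof (cases bs rule: rev_cases)
  case (snoc bs' b)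
  then show ?thesis by (cases bs') (simp_all add: merge_def butlast_append mult.assoc)
qed simp

lemma lin_merge_left:
  fixes F :: "'a::complex_algebra_1 list \<Rightarrow> 'u::complex_vector"
  assumes "\<And>us vs. lin (\<lambda>a. F (us @ a # vs))"
  shows "lin (\<lambda>a. F (merge (us @ a # vs) bs))"
proof (cases vs)
  case Nil
  have "lin (\<lambda>a. F (us @ (a * hd bs) # tl bs))"
    by (rule lin_comp[OF assms lin_mult_const[OF lin_id]])
  then show ?thesis by (simp add: Nil merge_snoc)
next
  case (Cons v vs')
  have "merge (us @ a # vs) bs = us @ a # merge vs bs" for a
    unfolding Cons by (simp add: merge_append merge_Cons2)
  then show ?thesis by (simp add: assms)
qed

lemma lin_merge_right:
  fixes F :: "'a::complex_algebra_1 list \<Rightarrow> 'u::complex_vector"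
  assumes "\<And>us vs. lin (\<lambda>a. F (us @ a # vs))"
  shows "lin (\<lambda>b. F (merge as (us @ b # vs)))"
proof (cases us)
  case Nil
  have "lin (\<lambda>b. F (butlast as @ (last as * b) # vs))"
    by (rule lin_comp[OF assms lin_const_mult[OF lin_id]])
  then show ?thesis by (simp add: Nil merge_def)
next
  case (Cons u us')
  have "lin (\<lambda>b. F ((butlast as @ (last as * u) # us') @ b # vs))" by (rule assms)
  then show ?thesis by (simp add: Cons merge_def)
qed

locale entwined_algebra =
  fixes \<Delta> :: "'c::complex_vector \<Rightarrow> ('c, 'c) tensor" and \<epsilon> :: "'c \<Rightarrow> complex"
    and \<psi> :: "('c, 'a::complex_algebra_1) tensor \<Rightarrow> ('a, 'c) tensor"
  assumes ent: "entwining_structure \<Delta> \<epsilon> \<psi>"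
begin

lemma ent': "entwining UNIV (*) \<Delta> \<epsilon> \<psi>" and \<psi>_one: "\<psi> (c \<otimes> 1) = 1 \<otimes> c"
  using ent by (simp_all add: entwining_structure_def)

lemma coalg: "coalgebra \<Delta> \<epsilon>"
  using ent' unfolding entwining_def by (elim conjE)

lemma \<Delta>_lin: "lin \<Delta>" and \<epsilon>_lin: "lin \<epsilon>"
proof -
  show "lin \<Delta>" using coalg unfolding coalgebra_def by (elim conjE)
  show "lin \<epsilon>" using coalg unfolding coalgebra_def by (elim conjE)
qed

sublocale linear_swap \<psi>
proof
  have "clinear_on (tensor_on UNIV UNIV) \<psi>" using ent' unfolding entwining_def by (elim conjE)
  then show "lin \<psi>" by (simp add: tensor_on_UNIV)
qed

lemma bil_mult_tens: "bil (\<lambda>b' c''. (a' * b' :: 'a) \<otimes> (c'' :: 'c))"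
  by (rule bil_tens_comp[OF lin_const_mult[OF lin_id]])

lemma \<psi>_mult: "\<psi> (c \<otimes> (a * b)) = sweedler (\<lambda>a' c'. sweedler (\<lambda>b' c''. (a' * b') \<otimes> c'') (\<psi> (c' \<otimes> b))) (\<psi> (c \<otimes> a))"
proof -
  have "\<forall>c. \<forall>a\<in>UNIV. \<forall>b\<in>UNIV. \<psi> (c \<otimes> (a * b)) =
      sweedler (\<lambda>a' c'. sweedler (\<lambda>b' c''. (a' * b') \<otimes> c'') (\<psi> (c' \<otimes> b))) (\<psi> (c \<otimes> a))"
    using ent' unfolding entwining_def by (elim conjE)
  then show ?thesis by simp
qed

lemma sweedler_\<psi>_mult:
  assumes F: "bil F"
  shows "sweedler F (\<psi> (c \<otimes> (a * b))) = sweedler (\<lambda>a' c'. sweedler (\<lambda>b' c''. F (a' * b') c'') (\<psi> (c' \<otimes> b))) (\<psi> (c \<otimes> a))"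
proof -
  have b: "bil (\<lambda>a' c'. sweedler (\<lambda>b' c''. (a' * b' :: 'a) \<otimes> (c'' :: 'c)) (\<psi> (c' \<otimes> b)))"
    by (intro bilI lin_sweedler_arg bil_mult_tens lin_tens1 lin_mult_const lin_id
        lin_comp[OF lin_sweedler[OF bil_mult_tens] \<psi>_lin1])
  show ?thesis
    unfolding \<psi>_mult lin_comp_sweedler[OF lin_sweedler[OF F] b]
      lin_comp_sweedler[OF lin_sweedler[OF F] bil_mult_tens] sweedler_tens[OF F] ..
qed

lemma pass_mult_letter:
  assumes F: "mlin F"
  shows "pass \<psi> c ((a * b) # vs) F = pass \<psi> c (a # b # vs) (\<lambda>l. F (merge [hd l] (tl l)))"
  unfolding pass.simps sweedler_\<psi>_mult[OF pass_bil[OF F]] by (simp add: merge_def)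

lemma pass_merge:
  assumes F: "mlin F" and as: "as \<noteq> []" and bs: "bs \<noteq> []"
  shows "pass \<psi> c (merge as bs) F = pass \<psi> c as (\<lambda>as' c'. pass \<psi> c' bs (\<lambda>bs'. F (merge as' bs')))"
proof -
  obtain us a where as: "as = us @ [a]" using as by (cases as rule: rev_cases) auto
  obtain b vs where bs: "bs = b # vs" using bs by (cases bs) auto
  show ?thesis
    unfolding as bs merge_snoc list.sel pass_append
    by (simp only: pass_mult_letter[OF mlin_append[OF F]]) (simp add: merge_def)
qed

lemma pass_one:
  assumes F: "mlin F"
  shows "pass \<psi> c (us @ 1 # vs) F = pass \<psi> c us (\<lambda>us' c'. pass \<psi> c' vs (\<lambda>vs'. F (us' @ 1 # vs')))"
  unfolding pass_append pass.simps \<psi>_one sweedler_tens[OF pass_bil[OF mlin_append[OF F]]] ..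

lemma pass_counit:
  assumes F: "\<And>us vs. lin (\<lambda>a. F (us @ a # vs))"
  shows "pass \<psi> c as (\<lambda>as' c'. \<epsilon> c' *\<^sub>C F as') = \<epsilon> c *\<^sub>C F as"
  using F
proof (induction as arbitrary: c F)
  case (Cons a as)
  have F1: "lin (\<lambda>a. F (a # as))" using Cons(2)[of "[]"] by simp
  have "\<forall>c. \<forall>a\<in>UNIV. sweedler (\<lambda>a' c'. \<epsilon> c' *\<^sub>C a') (\<psi> (c \<otimes> a)) = \<epsilon> c *\<^sub>C a"
    using ent' unfolding entwining_def by (elim conjE)
  then have eq: "sweedler (\<lambda>a' c'. \<epsilon> c' *\<^sub>C a') (\<psi> (c \<otimes> a)) = \<epsilon> c *\<^sub>C a" by simp
  have b: "bil (\<lambda>a' c'. \<epsilon> c' *\<^sub>C (a' :: 'a))"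
    by (intro bilI lin_scaleC lin_id lin_scaleC_left \<epsilon>_lin)
  have "pass \<psi> c' as (\<lambda>as' c'. \<epsilon> c' *\<^sub>C F (a' # as')) = \<epsilon> c' *\<^sub>C F (a' # as)" for a' c'
    by (rule Cons(1)) (use Cons(2)[of "a' # us" for us] in simp)
  then have "pass \<psi> c (a # as) (\<lambda>as' c'. \<epsilon> c' *\<^sub>C F as') = sweedler (\<lambda>a' c'. F (\<epsilon> c' *\<^sub>C a' # as)) (\<psi> (c \<otimes> a))"
    by (simp add: lin_scale[OF F1])
  also have "\<dots> = F (\<epsilon> c *\<^sub>C a # as)"
    unfolding lin_comp_sweedler[OF F1 b, symmetric] eq ..
  finally show ?case by (simp add: lin_scale[OF F1])
qed simp

text \<open>The compatibility of \<open>\<psi>\<close> with the coproduct is applied to the first letter; then the passage of \<open>c\<^sub>2\<close>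
through the remaining letters is exchanged with that of \<open>c\<^sub>1\<close> through the first one.\<close>
lemma pass_coproduct:
  fixes F :: "'a list \<Rightarrow> ('c, 'c) tensor \<Rightarrow> 'u::complex_vector"
  assumes F: "mlin F"
  shows "pass \<psi> c as (\<lambda>as' c'. F as' (\<Delta> c')) =
    sweedler (\<lambda>c1 c2. pass \<psi> c2 as (\<lambda>as' c2'. pass \<psi> c1 as' (\<lambda>as'' c1'. F as'' (c1' \<otimes> c2')))) (\<Delta> c)"
  using F
proof (induction as arbitrary: c F)
  case Nil
  have "F [] (\<Delta> c) = F [] (sweedler (\<otimes>) (\<Delta> c))" by (simp add: sweedler_id)
  also have "\<dots> = sweedler (\<lambda>c1 c2. F [] (c1 \<otimes> c2)) (\<Delta> c)"
    by (rule lin_comp_sweedler[OF mlinD(1)[OF Nil] bil_tens])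
  finally show ?case by simp
next
  case (Cons a as)
  note F = Cons(2)
  have m1: "mlin (\<lambda>as'' c1'. H as'' (c1' \<otimes> c2'))" if H: "mlin H" for H :: "'a list \<Rightarrow> ('c, 'c) tensor \<Rightarrow> 'u" and c2'
    by (rule mlinI) (rule lin_comp[OF mlinD(1)[OF H] lin_tens1[OF lin_id]], rule mlinD(2)[OF H])
  have l2: "lin (\<lambda>c2'. H as'' (c1' \<otimes> c2'))" if H: "mlin H" for H :: "'a list \<Rightarrow> ('c, 'c) tensor \<Rightarrow> 'u" and as'' c1'
    by (rule lin_comp[OF mlinD(1)[OF H] lin_tens2[OF lin_id]])
  have m2: "mlin (\<lambda>as' c2'. pass \<psi> c1 as' (\<lambda>as'' c1'. F (a' # as'') (c1' \<otimes> c2')))" for a' c1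
  proof (rule mlinI)
    note Fa = mlin_Cons[OF F, of a']
    show "lin (\<lambda>c2'. pass \<psi> c1 as' (\<lambda>as'' c1'. F (a' # as'') (c1' \<otimes> c2')))" for as'
      by (rule pass_lin_param[OF m1[OF Fa] l2[OF Fa]])
    show "lin (\<lambda>b. pass \<psi> c1 (us @ b # vs) (\<lambda>as'' c1'. F (a' # as'') (c1' \<otimes> c2')))" for us vs c2'
      by (rule pass_lin_letter[OF m1[OF Fa]])
  qed
  have b3: "bil (\<lambda>a' c1. pass \<psi> c1 as' (\<lambda>as'' c1'. F (a' # as'') (c1' \<otimes> c2')))" for as' c2'
    by (rule pass_bil[OF m1[OF F]])
  define B where "B a' c1 c2 = pass \<psi> c2 as (\<lambda>as' c2'. pass \<psi> c1 as' (\<lambda>as'' c1'. F (a' # as'') (c1' \<otimes> c2')))" for a' c1 c2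
  have B12: "bil (B a')" for a'
  proof (rule bilI)
    show "lin (\<lambda>c1. B a' c1 c2)" for c2
      unfolding B_def by (rule pass_lin_param[OF m2 bilD2[OF b3]])
    show "lin (B a' c1)" for c1
      unfolding B_def by (rule pass_lin[OF m2])
  qed
  have Ba: "lin (\<lambda>a'. B a' c1 c2)" for c1 c2
    unfolding B_def by (rule pass_lin_param[OF m2 bilD1[OF b3]])
  have \<Phi>b: "bil (\<lambda>a' t. sweedler (B a') t)"
    by (intro bilI lin_sweedler_arg B12 Ba lin_sweedler)
  define \<Phi> where "\<Phi> = sweedler (\<lambda>a' t. sweedler (B a') t)"
  have \<Phi>_lin: "lin \<Phi>" unfolding \<Phi>_def by (rule lin_sweedler[OF \<Phi>b])
  have \<Phi>_tens: "\<Phi> (a' \<otimes> t) = sweedler (B a') t" for a' t unfolding \<Phi>_def by (rule sweedler_tens[OF \<Phi>b])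
  have bD: "bil (\<lambda>a' c'. (a' :: 'a) \<otimes> \<Delta> c')"
    by (intro bilI lin_tens1 lin_tens2 lin_id \<Delta>_lin)
  have bT: "bil (\<lambda>a'' c1'. (a'' :: 'a) \<otimes> ((c1' :: 'c) \<otimes> (c2' :: 'c)))" for c2'
    by (intro bilI lin_tens1 lin_id lin_tens2)
  have bT2: "bil (\<lambda>a' c2'. sweedler (\<lambda>a'' c1'. (a'' :: 'a) \<otimes> ((c1' :: 'c) \<otimes> (c2' :: 'c))) (\<psi> (c1 \<otimes> a')))" for c1
    by (intro bilI lin_comp[OF lin_sweedler[OF bT] \<psi>_lin2] lin_sweedler_arg bT lin_tens2 lin_id)
  have bT3: "bil (\<lambda>c1 c2. sweedler (\<lambda>a' c2'. sweedler (\<lambda>a'' c1'. (a'' :: 'a) \<otimes> ((c1' :: 'c) \<otimes> (c2' :: 'c))) (\<psi> (c1 \<otimes> a'))) (\<psi> (c2 \<otimes> a)))"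
    by (intro bilI lin_sweedler_arg bT2 lin_comp[OF lin_sweedler[OF bT] \<psi>_lin1] lin_comp[OF lin_sweedler[OF bT2] \<psi>_lin1])
  have "\<forall>c. \<forall>a\<in>UNIV. tensor_map UNIV UNIV id \<Delta> (\<psi> (c \<otimes> a)) =
        sweedler (\<lambda>c1 c2. sweedler (\<lambda>a' c2'. sweedler (\<lambda>a'' c1'. a'' \<otimes> (c1' \<otimes> c2'))
          (\<psi> (c1 \<otimes> a'))) (\<psi> (c2 \<otimes> a))) (\<Delta> c)"
    using ent' unfolding entwining_def by (elim conjE)
  then have ax: "sweedler (\<lambda>a' c'. a' \<otimes> \<Delta> c') (\<psi> (c \<otimes> a)) =
        sweedler (\<lambda>c1 c2. sweedler (\<lambda>a' c2'. sweedler (\<lambda>a'' c1'. a'' \<otimes> (c1' \<otimes> c2'))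
          (\<psi> (c1 \<otimes> a'))) (\<psi> (c2 \<otimes> a))) (\<Delta> c)"
    by (simp add: tensor_map_def)
  have comm: "sweedler (\<lambda>a'' c1'. B a'' c1' c2') t
     = pass \<psi> c2' as (\<lambda>as' c2''. sweedler (\<lambda>a'' c1'. pass \<psi> c1' as' (\<lambda>as'' c1''. F (a'' # as'') (c1'' \<otimes> c2''))) t)" for c2' and t :: "('a, 'c) tensor"
    unfolding B_def by (rule sweedler_pass_commute[OF m2 b3, symmetric])
  have "pass \<psi> c (a # as) (\<lambda>as' c'. F as' (\<Delta> c')) = sweedler (\<lambda>a' c'. sweedler (B a') (\<Delta> c')) (\<psi> (c \<otimes> a))"
    unfolding pass.simps B_def Cons(1)[OF mlin_Cons[OF F]] ..
  also have "\<dots> = \<Phi> (sweedler (\<lambda>a' c'. a' \<otimes> \<Delta> c') (\<psi> (c \<otimes> a)))"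
    unfolding lin_comp_sweedler[OF \<Phi>_lin bD] \<Phi>_tens ..
  also have "\<dots> = sweedler (\<lambda>c1 c2. sweedler (\<lambda>a' c2'. sweedler (\<lambda>a'' c1'. B a'' c1' c2')
          (\<psi> (c1 \<otimes> a'))) (\<psi> (c2 \<otimes> a))) (\<Delta> c)"
    unfolding ax lin_comp_sweedler[OF \<Phi>_lin bT3] lin_comp_sweedler[OF \<Phi>_lin bT2]
      lin_comp_sweedler[OF \<Phi>_lin bT] \<Phi>_tens sweedler_tens[OF B12] ..
  finally show ?case unfolding comm by simp
qed

end

section \<open>The differential graded algebra of words\<close>

lemma bilinear_in_subspace_on_span:
  assumes "p \<in> cvs.span A" "q \<in> cvs.span B" and f: "bil f" and S: "cvs.subspace S"
    and "\<And>a b. a \<in> A \<Longrightarrow> b \<in> B \<Longrightarrow> f a b \<in> S"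
  shows "f p q \<in> S"
proof (rule lin_in_subspace_on_span[OF assms(1) bilD1[OF f] S])
  fix a assume a: "a \<in> A"
  show "f a q \<in> S"
    by (rule lin_in_subspace_on_span[OF assms(2) bilD2[OF f] S]) (rule assms(5)[OF a])
qed

lemma (in linear_swap) pass_linear_combination:
  assumes F: "mlin F" and G: "mlin G"
  shows "pass \<psi> c as (\<lambda>as' c'. F as' c' + k *\<^sub>C G as' c') = pass \<psi> c as F + k *\<^sub>C pass \<psi> c as G"
  using F G
proof (induction as arbitrary: c F G)
  case (Cons a as)
  show ?case
    unfolding pass.simps Cons(1)[OF mlin_Cons[OF Cons(2)] mlin_Cons[OF Cons(3)]]
    by (simp only: sweedler_fun_plus[OF pass_bil[OF Cons(2)] bil_scaleC[OF pass_bil[OF Cons(3)]]]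
        sweedler_fun_scale[OF pass_bil[OF Cons(3)]])
qed simp

text \<open>The word \<open>a\<^sub>0 F a\<^sub>1 F \<dots> F a\<^sub>m\<close> with coefficient \<open>x\<close> is represented by \<open>word x [a\<^sub>0, \<dots>, a\<^sub>m]\<close>, and \<open>F\<close> itself
by \<open>word nilp [1, 1]\<close>.\<close>
locale cone_dga = words enc + entwined_algebra \<Delta> \<epsilon> \<psi>
  for enc :: "cone \<times> 'a::complex_algebra_1 list \<Rightarrow> 'k"
    and \<Delta> :: "'c::complex_vector \<Rightarrow> ('c, 'c) tensor" and \<epsilon> :: "'c \<Rightarrow> complex"
    and \<psi> :: "('c, 'a) tensor \<Rightarrow> ('a, 'c) tensor"
begin

definition mul_word :: "cone \<Rightarrow> 'a list \<Rightarrow> cone \<Rightarrow> 'a list \<Rightarrow> 'k \<Rightarrow>\<^sub>0 complex" where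
  "mul_word x as y bs = word (x * y) (merge as bs)"

definition wmul :: "('k \<Rightarrow>\<^sub>0 complex) \<Rightarrow> ('k \<Rightarrow>\<^sub>0 complex) \<Rightarrow> 'k \<Rightarrow>\<^sub>0 complex" where
  "wmul p q = lift (\<lambda>x as. lift (\<lambda>y bs. mul_word x as y bs) q) p"

lemma word_lin1: "lin (\<lambda>x. word x as)" and word_lin2: "lin (\<lambda>a. word x (us @ a # vs))"
  by (rule multilinD[OF multilin_word])+

lemma mul_word_lin1: "lin (\<lambda>x. mul_word x as y bs)" and mul_word_lin2: "lin (\<lambda>y. mul_word x as y bs)"
  unfolding mul_word_def
  by (rule lin_comp[OF word_lin1 lin_mult_const[OF lin_id]], rule lin_comp[OF word_lin1 lin_const_mult[OF lin_id]])

lemma mul_word_lin3: "lin (\<lambda>a. mul_word x (us @ a # vs) y bs)"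
  unfolding mul_word_def by (rule lin_merge_left[of "word (x * y)", OF word_lin2])

lemma mul_word_lin4: "lin (\<lambda>b. mul_word x as y (us @ b # vs))"
  unfolding mul_word_def by (rule lin_merge_right[of "word (x * y)", OF word_lin2])

lemma wmul_bil: "bil wmul"
  unfolding wmul_def by (intro bilI lin_lift lin_lift_arg)

lemma wmul_word: "wmul (word x as) (word y bs) = word (x * y) (merge as bs)"
proof -
  have m: "multilin (mul_word x as)" for x as
    by (rule multilinI) (rule mul_word_lin2, rule mul_word_lin4)
  have "multilin (\<lambda>x as. lift (mul_word x as) (word y bs))"
    unfolding lift_word[OF m] by (rule multilinI) (rule mul_word_lin1, rule mul_word_lin3)
  then show ?thesis
    unfolding wmul_def by (simp only: lift_word lift_word[OF m]) (simp add: mul_word_def)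
qed

text \<open>The graded commutator with \<open>F\<close>.\<close>
definition diff_word :: "cone \<Rightarrow> 'a list \<Rightarrow> 'k \<Rightarrow>\<^sub>0 complex" where
  "diff_word x as = word (nilp * x) (1 # as) + (- 1) ^ length as *\<^sub>C word (x * nilp) (as @ [1])"

definition wdiff :: "('k \<Rightarrow>\<^sub>0 complex) \<Rightarrow> 'k \<Rightarrow>\<^sub>0 complex" where
  "wdiff = lift diff_word"

lemma wdiff_lin: "lin wdiff"
  unfolding wdiff_def by (rule lin_lift)

lemma multilin_diff_word: "multilin diff_word"
proof (rule multilinI)
  show "lin (\<lambda>x. diff_word x as)" for as
    unfolding diff_word_def
    by (intro lin_plus lin_scaleC lin_comp[OF word_lin1] lin_mult_const lin_const_mult lin_id)
  fix x and us vs :: "'a list"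
  have a: "lin (\<lambda>a. word (nilp * x) (1 # us @ a # vs))" using word_lin2[of "nilp * x" "1 # us" vs] by simp
  have b: "lin (\<lambda>a. word (x * nilp) ((us @ a # vs) @ [1]))" using word_lin2[of "x * nilp" us "vs @ [1]"] by simp
  show "lin (\<lambda>a. diff_word x (us @ a # vs))"
    unfolding diff_word_def length_append list.size by (rule lin_plus[OF a lin_scaleC[OF b]])
qed

lemma wdiff_word: "wdiff (word x as) = diff_word x as"
  unfolding wdiff_def by (rule lift_word[OF multilin_diff_word])

text \<open>Degree zero contains all endomorphisms, which makes the cycle vanishing; in positive degree the
coefficients must have a trace.\<close>
definition gens :: "nat \<Rightarrow> ('k \<Rightarrow>\<^sub>0 complex) set" where
  "gens i = {word x as | x as. length as = Suc i \<and> (i \<noteq> 0 \<longrightarrow> x \<in> finite_rank)}"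

lemma gensI: "length as = Suc i \<Longrightarrow> (i \<noteq> 0 \<Longrightarrow> x \<in> finite_rank) \<Longrightarrow> word x as \<in> gens i"
  unfolding gens_def by blast

lemma gensE:
  assumes "w \<in> gens i"
  obtains x as where "w = word x as" "length as = Suc i" "as \<noteq> []" "i \<noteq> 0 \<Longrightarrow> x \<in> finite_rank"
  using assms unfolding gens_def by fastforce

definition wdga :: "('k \<Rightarrow>\<^sub>0 complex) dga" where
  "wdga = \<lparr>piece = \<lambda>i. cvs.span (gens i), mul = wmul, diff = wdiff\<rparr>"

lemma wdga_simps [simp]: "piece wdga = (\<lambda>i. cvs.span (gens i))" "mul wdga = wmul" "diff wdga = wdiff"
  by (simp_all add: wdga_def)

abbreviation V :: "('k \<Rightarrow>\<^sub>0 complex) set" where "V \<equiv> total wdga"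

lemma total_eq: "V = cvs.span (\<Union>i. gens i)"
proof
  show "cvs.span (\<Union>i. gens i) \<subseteq> V"
    unfolding total_def by (rule cvs.span_mono) (auto intro: cvs.span_base)
  have "cvs.span (gens i) \<subseteq> cvs.span (\<Union>i. gens i)" for i
    by (rule cvs.span_mono) blast
  then show "V \<subseteq> cvs.span (\<Union>i. gens i)"
    unfolding total_def by (intro cvs.span_minimal) auto
qed

lemma V_sub: "cvs.subspace V"
  by (simp add: total_def)

lemma piece_V: "p \<in> cvs.span (gens i) \<Longrightarrow> p \<in> V"
  unfolding total_def by (rule cvs.span_base) auto

lemma wmul_piece:
  assumes "p \<in> cvs.span (gens i)" "q \<in> cvs.span (gens j)"
  shows "wmul p q \<in> cvs.span (gens (i + j))"
proof (rule bilinear_in_subspace_on_span[OF assms wmul_bil cvs.subspace_span])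
  fix v w assume v: "v \<in> gens i" and w: "w \<in> gens j"
  obtain x as where x: "v = word x as" "length as = Suc i" "as \<noteq> []" "i \<noteq> 0 \<Longrightarrow> x \<in> finite_rank" using gensE[OF v] by blast
  obtain y bs where y: "w = word y bs" "length bs = Suc j" "bs \<noteq> []" "j \<noteq> 0 \<Longrightarrow> y \<in> finite_rank" using gensE[OF w] by blast
  have "x * y \<in> finite_rank" if "i + j \<noteq> 0"
    using that x(4) y(4) finite_rank_mult_left finite_rank_mult_right by (cases "i = 0") auto
  moreover have "length (merge as bs) = Suc (i + j)" using length_merge[OF x(3) y(3)] x(2) y(2) by simp
  ultimately show "wmul v w \<in> cvs.span (gens (i + j))"
    unfolding x(1) y(1) wmul_word by (intro cvs.span_base gensI) auto
qed

lemma wdiff_piece: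
  assumes "p \<in> cvs.span (gens i)"
  shows "wdiff p \<in> cvs.span (gens (Suc i))"
proof (rule lin_in_subspace_on_span[OF assms wdiff_lin cvs.subspace_span])
  fix v assume "v \<in> gens i"
  then obtain x as where x: "v = word x as" "length as = Suc i" by (rule gensE)
  show "wdiff v \<in> cvs.span (gens (Suc i))"
    unfolding x(1) wdiff_word diff_word_def
    by (intro cvs.span_add cvs.span_scale cvs.span_base gensI)
      (auto simp: x(2) finite_rank_mult_right finite_rank_mult_left nilp_finite_rank)
qed

lemma V_words: "w \<in> (\<Union>i. gens i) \<Longrightarrow> \<exists>x as. w = word x as \<and> as \<noteq> []"
  by (auto elim!: gensE)

lemma wmul_assoc:
  assumes p: "p \<in> V" and q: "q \<in> V" and r: "r \<in> V"
  shows "wmul (wmul p q) r = wmul p (wmul q r)"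
proof (rule lin_eq_on_span[OF p[unfolded total_eq]])
  show "lin (\<lambda>p. wmul (wmul p q) r)" by (rule lin_comp[OF bilD1 bilD1]; rule wmul_bil)
  show "lin (\<lambda>p. wmul p (wmul q r))" by (rule bilD1[OF wmul_bil])
  fix u assume u: "u \<in> (\<Union>i. gens i)"
  show "wmul (wmul u q) r = wmul u (wmul q r)"
  proof (rule lin_eq_on_span[OF q[unfolded total_eq]])
    show "lin (\<lambda>q. wmul (wmul u q) r)" by (rule lin_comp[OF bilD1 bilD2]; rule wmul_bil)
    show "lin (\<lambda>q. wmul u (wmul q r))" by (rule lin_comp[OF bilD2 bilD1]; rule wmul_bil)
    fix v assume v: "v \<in> (\<Union>i. gens i)"
    show "wmul (wmul u v) r = wmul u (wmul v r)"
    proof (rule lin_eq_on_span[OF r[unfolded total_eq]])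
      show "lin (\<lambda>r. wmul (wmul u v) r)" by (rule bilD2[OF wmul_bil])
      show "lin (\<lambda>r. wmul u (wmul v r))" by (rule lin_comp[OF bilD2 bilD2]; rule wmul_bil)
      fix w assume w: "w \<in> (\<Union>i. gens i)"
      from V_words[OF u] V_words[OF v] V_words[OF w]
      show "wmul (wmul u v) w = wmul u (wmul v w)"
        by (auto simp: wmul_word mult.assoc merge_assoc)
    qed
  qed
qed

lemma wdiff_wdiff: "wdiff (wdiff p) = 0" if p: "p \<in> V"
proof (rule lin_eq_on_span[OF p[unfolded total_eq]])
  show "lin (\<lambda>p. wdiff (wdiff p))" by (rule lin_comp[OF wdiff_lin wdiff_lin])
  fix u assume "u \<in> (\<Union>i. gens i)"
  then obtain x as where u: "u = word x as" using V_words by blast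
  have 0: "nilp * (nilp * x) = 0" "x * nilp * nilp = 0"
    by (simp_all add: mult.assoc[symmetric] idem_nilp) (simp add: mult.assoc idem_nilp)
  show "wdiff (wdiff u) = 0"
    unfolding u wdiff_word diff_word_def lin_add[OF wdiff_lin] lin_scale[OF wdiff_lin]
    by (simp add: 0 idem_nilp(4) lin_zero[OF word_lin1] mult.assoc cvs.scale_minus_left)
qed (rule lin_const0)

lemma wdiff_wmul:
  assumes p: "p \<in> cvs.span (gens i)" and q: "q \<in> cvs.span (gens j)"
  shows "wdiff (wmul p q) = wmul (wdiff p) q + (- 1) ^ i *\<^sub>C wmul p (wdiff q)"
proof (rule lin_eq_on_span[OF p])
  note l = lin_plus lin_scaleC lin_comp[OF wdiff_lin] lin_comp[OF bilD1[OF wmul_bil]] lin_comp[OF bilD2[OF wmul_bil]]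
    wdiff_lin
  show "lin (\<lambda>p. wdiff (wmul p q))" by (rule lin_comp[OF wdiff_lin bilD1[OF wmul_bil]])
  show "lin (\<lambda>p. wmul (wdiff p) q + (- 1) ^ i *\<^sub>C wmul p (wdiff q))"
    by (intro lin_plus lin_scaleC lin_comp[OF bilD1[OF wmul_bil] wdiff_lin] bilD1[OF wmul_bil])
  fix u assume u: "u \<in> gens i"
  show "wdiff (wmul u q) = wmul (wdiff u) q + (- 1) ^ i *\<^sub>C wmul u (wdiff q)"
  proof (rule lin_eq_on_span[OF q])
    show "lin (\<lambda>q. wdiff (wmul u q))" by (rule lin_comp[OF wdiff_lin bilD2[OF wmul_bil]])
    show "lin (\<lambda>q. wmul (wdiff u) q + (- 1) ^ i *\<^sub>C wmul u (wdiff q))"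
      by (intro lin_plus lin_scaleC lin_comp[OF bilD2[OF wmul_bil] wdiff_lin] bilD2[OF wmul_bil])
    fix v assume v: "v \<in> gens j"
    obtain x as where x: "u = word x as" "length as = Suc i" "as \<noteq> []" using gensE[OF u] by blast
    obtain y bs where y: "v = word y bs" "length bs = Suc j" "bs \<noteq> []" using gensE[OF v] by blast
    have len: "length (merge as bs) = Suc (i + j)" using length_merge[OF x(3) y(3)] x(2) y(2) by simp
    have 1: "merge (1 # as) bs = 1 # merge as bs" "merge as (bs @ [1]) = merge as bs @ [1]"
      using x(3) y(3) by (simp_all add: merge_append_right merge_def)
    have 2: "merge (as @ [1]) bs = as @ bs" "merge as (1 # bs) = as @ bs"
      using x(3) y(3) by (simp_all add: merge_def)
    note s = lin_add[OF bilD1[OF wmul_bil]] lin_add[OF bilD2[OF wmul_bil]]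
      lin_scale[OF bilD1[OF wmul_bil]] lin_scale[OF bilD2[OF wmul_bil]]
    show "wdiff (wmul u v) = wmul (wdiff u) v + (- 1) ^ i *\<^sub>C wmul u (wdiff v)"
      unfolding x(1) y(1) wmul_word wdiff_word diff_word_def s len x(2) y(2) 1 2
      by (simp add: mult.assoc scaleC_add_right scaleC_scaleC cvs.scale_minus_left cvs.scale_right_diff_distrib
          power_add)
  qed
qed

definition grade :: "nat \<Rightarrow> ('k \<Rightarrow>\<^sub>0 complex) \<Rightarrow> 'k \<Rightarrow>\<^sub>0 complex" where
  "grade i = lift (\<lambda>x as. if length as = Suc i then word x as else 0)"

lemma grade_piece:
  assumes p: "p \<in> cvs.span (gens j)"
  shows "grade i p = (if i = j then p else 0)"
proof (rule lin_eq_on_span[OF p])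
  show "lin (grade i)" unfolding grade_def by (rule lin_lift)
  show "lin (\<lambda>p. if i = j then p else 0)" by (cases "i = j") (auto intro: lin_id lin_const0)
  fix u assume "u \<in> gens j"
  then obtain x as where x: "u = word x as" "length as = Suc j" by (rule gensE)
  have "multilin (\<lambda>x as. if length as = Suc i then word x as else 0)"
  proof (rule multilinI)
    show "lin (\<lambda>x. if length as = Suc i then word x as else 0)" for as
      by (cases "length as = Suc i") (auto intro: word_lin1 lin_const0)
    show "lin (\<lambda>a. if length (us @ a # vs) = Suc i then word x (us @ a # vs) else 0)" for x us vs
      by (cases "length us + length vs = i") (auto intro: word_lin2 lin_const0)
  qed
  then show "grade i u = (if i = j then u else 0)"
    unfolding grade_def x(1) by (subst lift_word) (auto simp: x(2))
qed

lemma dg_algebra_wdga: "dg_algebra wdga"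
  unfolding dg_algebra_def wdga_simps
proof (intro conjI allI ballI impI)
  show "cvs.subspace (cvs.span (gens n))" for n by simp
  show "x i = 0" if x: "\<forall>i\<le>N. x i \<in> cvs.span (gens i)" and s: "(\<Sum>i\<le>N. x i) = 0" and i: "i \<le> N" for N x i
  proof -
    have g: "lin (grade i)" unfolding grade_def by (rule lin_lift)
    have "0 = grade i (\<Sum>i\<le>N. x i)" by (simp add: s lin_zero[OF g])
    also have "\<dots> = (\<Sum>j\<le>N. if j = i then x i else 0)"
      unfolding lin_sum[OF g] using x by (intro sum.cong refl) (auto simp: grade_piece)
    also have "\<dots> = x i" using i by (simp add: sum.delta)
    finally show ?thesis by simp
  qed
  show "algebra_on V wmul"
    unfolding algebra_on_def
  proof (intro conjI ballI V_sub wmul_assoc)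
    show "cbilinear_on V V wmul" using cbilinear_on_subset[OF wmul_bil] by blast
    fix p q assume p: "p \<in> V" and q: "q \<in> V"
    show "wmul p q \<in> V"
    proof (rule bilinear_in_subspace_on_span[OF p[unfolded total_eq] q[unfolded total_eq] wmul_bil V_sub])
      fix a b assume "a \<in> (\<Union>i. gens i)" "b \<in> (\<Union>i. gens i)"
      then obtain i j where "a \<in> cvs.span (gens i)" "b \<in> cvs.span (gens j)" using cvs.span_base by blast
      from wmul_piece[OF this] show "wmul a b \<in> V" by (rule piece_V)
    qed
  qed
  show "clinear_on V wdiff" using wdiff_lin by (auto simp: clinear_on_def)
qed (use wmul_piece wdiff_piece wdiff_wdiff wdiff_wmul in auto)

section \<open>Its entwining\<close>

definition wpass :: "'c \<Rightarrow> ('k \<Rightarrow>\<^sub>0 complex) \<Rightarrow> ('k \<Rightarrow>\<^sub>0 complex, 'c) tensor" where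
  "wpass c = lift (\<lambda>x as. pass \<psi> c as (\<lambda>as' c'. word x as' \<otimes> c'))"

definition wpsi :: "('c, 'k \<Rightarrow>\<^sub>0 complex) tensor \<Rightarrow> ('k \<Rightarrow>\<^sub>0 complex, 'c) tensor" where
  "wpsi = sweedler wpass"

lemma mlin_word: "mlin (\<lambda>as' c'. word x as' \<otimes> c')"
  by (rule mlinI) (rule lin_tens2[OF lin_id], rule lin_tens1[OF word_lin2])

lemma multilin_pass_word: "multilin (\<lambda>x as. pass \<psi> c as (\<lambda>as' c'. word x as' \<otimes> c'))"
  by (rule multilinI) (rule pass_lin_param[OF mlin_word lin_tens1[OF word_lin1]], rule pass_lin_letter[OF mlin_word])

lemma wpass_word: "wpass c (word x as) = pass \<psi> c as (\<lambda>as' c'. word x as' \<otimes> c')"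
  unfolding wpass_def by (rule lift_word[OF multilin_pass_word])

lemma wpass_bil: "bil wpass"
  unfolding wpass_def by (intro bilI lin_lift lin_lift_arg pass_lin mlin_word)

lemma wpsi_tens: "wpsi (c \<otimes> p) = wpass c p"
  unfolding wpsi_def by (rule sweedler_tens[OF wpass_bil])

lemma wpsi_lin: "lin wpsi"
  unfolding wpsi_def by (rule lin_sweedler[OF wpass_bil])

lemma wpass_piece:
  assumes p: "p \<in> cvs.span (gens i)"
  shows "wpass c p \<in> tensor_on (cvs.span (gens i)) UNIV"
proof (rule lin_in_subspace_on_span[OF p bilD2[OF wpass_bil] subspace_tensor_on])
  fix u assume "u \<in> gens i"
  then obtain x as where x: "u = word x as" "length as = Suc i" "i \<noteq> 0 \<Longrightarrow> x \<in> finite_rank" using gensE by metis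
  show "wpass c u \<in> tensor_on (cvs.span (gens i)) UNIV"
    unfolding x(1) wpass_word
    by (rule pass_in_subspace[OF subspace_tensor_on mlin_word]) (auto intro!: tens_in cvs.span_base gensI x simp: x(2))
qed

lemma tensor_on_mono: "S \<subseteq> S' \<Longrightarrow> W \<subseteq> W' \<Longrightarrow> tensor_on S W \<subseteq> tensor_on S' W'"
  unfolding tensor_on_def by (rule cvs.span_mono) blast

lemma wpass_V:
  assumes p: "p \<in> V"
  shows "wpass c p \<in> tensor_on V UNIV"
proof (rule lin_in_subspace_on_span[OF p[unfolded total_eq] bilD2[OF wpass_bil] subspace_tensor_on])
  fix u assume "u \<in> (\<Union>i. gens i)"
  then obtain i where "u \<in> cvs.span (gens i)" using cvs.span_base by blast
  moreover have "tensor_on (cvs.span (gens i)) UNIV \<subseteq> tensor_on V (UNIV :: 'c set)"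
    by (rule tensor_on_mono) (auto intro: piece_V)
  ultimately show "wpass c u \<in> tensor_on V UNIV" using wpass_piece by blast
qed

lemma sweedler_wpass_word:
  assumes F: "bil F"
  shows "sweedler F (wpass c (word x as)) = pass \<psi> c as (\<lambda>as' c'. F (word x as') c')"
  unfolding wpass_word pass_comp[OF lin_sweedler[OF F] mlin_word] sweedler_tens[OF F] ..

lemma wmul_tens_bil: "bil (\<lambda>q c. wmul p q \<otimes> c)"
  by (rule bil_tens_comp[OF bilD2[OF wmul_bil]])

lemma wpass_wmul:
  assumes p: "p \<in> V" and q: "q \<in> V"
  shows "wpass c (wmul p q) = sweedler (\<lambda>p' c'. sweedler (\<lambda>q' c''. wmul p' q' \<otimes> c'') (wpass c' q)) (wpass c p)"
proof -
  have b: "bil (\<lambda>p' c'. sweedler (\<lambda>q' c''. wmul p' q' \<otimes> c'') (wpass c' q))" for q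
    by (intro bilI lin_sweedler_arg wmul_tens_bil lin_tens1 bilD1[OF wmul_bil]
        lin_comp[OF lin_sweedler[OF wmul_tens_bil] bilD1[OF wpass_bil]])
  show ?thesis
  proof (rule lin_eq_on_span[OF p[unfolded total_eq]])
    show "lin (\<lambda>p. wpass c (wmul p q))" by (rule lin_comp[OF bilD2[OF wpass_bil] bilD1[OF wmul_bil]])
    show "lin (\<lambda>p. sweedler (\<lambda>p' c'. sweedler (\<lambda>q' c''. wmul p' q' \<otimes> c'') (wpass c' q)) (wpass c p))"
      by (rule lin_comp[OF lin_sweedler[OF b] bilD2[OF wpass_bil]])
    fix u assume u: "u \<in> (\<Union>i. gens i)"
    show "wpass c (wmul u q) = sweedler (\<lambda>p' c'. sweedler (\<lambda>q' c''. wmul p' q' \<otimes> c'') (wpass c' q)) (wpass c u)"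
    proof (rule lin_eq_on_span[OF q[unfolded total_eq]])
      show "lin (\<lambda>q. wpass c (wmul u q))" by (rule lin_comp[OF bilD2[OF wpass_bil] bilD2[OF wmul_bil]])
      show "lin (\<lambda>q. sweedler (\<lambda>p' c'. sweedler (\<lambda>q' c''. wmul p' q' \<otimes> c'') (wpass c' q)) (wpass c u))"
        by (intro lin_sweedler_arg b lin_comp[OF lin_sweedler[OF wmul_tens_bil] bilD2[OF wpass_bil]])
      fix v assume v: "v \<in> (\<Union>i. gens i)"
      obtain x as where x: "u = word x as" "as \<noteq> []" using V_words[OF u] by blast
      obtain y bs where y: "v = word y bs" "bs \<noteq> []" using V_words[OF v] by blast
      have "wpass c (wmul u v) = pass \<psi> c as (\<lambda>as' c'. pass \<psi> c' bs (\<lambda>bs' c''. word (x * y) (merge as' bs') \<otimes> c''))"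
        unfolding x(1) y(1) wmul_word wpass_word by (rule pass_merge[OF mlin_word x(2) y(2)])
      also have "\<dots> = sweedler (\<lambda>p' c'. sweedler (\<lambda>q' c''. wmul p' q' \<otimes> c'') (wpass c' v)) (wpass c u)"
      proof -
        have "sweedler (\<lambda>p' c'. sweedler (\<lambda>q' c''. wmul p' q' \<otimes> c'') (wpass c' v)) (wpass c u)
          = pass \<psi> c as (\<lambda>as' c'. sweedler (\<lambda>q' c''. wmul (word x as') q' \<otimes> c'') (wpass c' v))"
          unfolding x(1) by (rule sweedler_wpass_word[OF b])
        then show ?thesis unfolding y(1) sweedler_wpass_word[OF wmul_tens_bil] wmul_word by simp
      qed
      finally show "wpass c (wmul u v) = sweedler (\<lambda>p' c'. sweedler (\<lambda>q' c''. wmul p' q' \<otimes> c'') (wpass c' v)) (wpass c u)" .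
    qed
  qed
qed

lemma wpass_coproduct:
  assumes p: "p \<in> V"
  shows "sweedler (\<lambda>p' c'. p' \<otimes> \<Delta> c') (wpass c p) =
    sweedler (\<lambda>c1 c2. sweedler (\<lambda>p' c2'. sweedler (\<lambda>p'' c1'. p'' \<otimes> (c1' \<otimes> c2')) (wpass c1 p')) (wpass c2 p)) (\<Delta> c)"
proof -
  have bD: "bil (\<lambda>p' c'. (p' :: 'k \<Rightarrow>\<^sub>0 complex) \<otimes> \<Delta> c')"
    by (intro bilI lin_tens1 lin_tens2 lin_id \<Delta>_lin)
  have b1: "bil (\<lambda>p'' c1'. (p'' :: 'k \<Rightarrow>\<^sub>0 complex) \<otimes> ((c1' :: 'c) \<otimes> (c2' :: 'c)))" for c2'
    by (intro bilI lin_tens1 lin_id lin_tens2)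
  have b2: "bil (\<lambda>p' c2'. sweedler (\<lambda>p'' c1'. (p'' :: 'k \<Rightarrow>\<^sub>0 complex) \<otimes> ((c1' :: 'c) \<otimes> (c2' :: 'c))) (wpass c1 p'))" for c1
    by (intro bilI lin_comp[OF lin_sweedler[OF b1] bilD2[OF wpass_bil]] lin_sweedler_arg b1 lin_tens2 lin_id)
  have b3: "bil (\<lambda>c1 c2. sweedler (\<lambda>p' c2'. sweedler (\<lambda>p'' c1'. (p'' :: 'k \<Rightarrow>\<^sub>0 complex) \<otimes> ((c1' :: 'c) \<otimes> (c2' :: 'c))) (wpass c1 p')) (wpass c2 p))" for p
    by (intro bilI lin_sweedler_arg b2 lin_comp[OF lin_sweedler[OF b1] bilD1[OF wpass_bil]]
        lin_comp[OF lin_sweedler[OF b2] bilD1[OF wpass_bil]])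
  show ?thesis
  proof (rule lin_eq_on_span[OF p[unfolded total_eq]])
    show "lin (\<lambda>p. sweedler (\<lambda>p' c'. p' \<otimes> \<Delta> c') (wpass c p))"
      by (rule lin_comp[OF lin_sweedler[OF bD] bilD2[OF wpass_bil]])
    show "lin (\<lambda>p. sweedler (\<lambda>c1 c2. sweedler (\<lambda>p' c2'. sweedler (\<lambda>p'' c1'. p'' \<otimes> (c1' \<otimes> c2')) (wpass c1 p')) (wpass c2 p)) (\<Delta> c))"
      by (intro lin_sweedler_arg b3 lin_comp[OF lin_sweedler[OF b2] bilD2[OF wpass_bil]])
    fix u assume "u \<in> (\<Union>i. gens i)"
    then obtain x as where u: "u = word x as" using V_words by blast
    have m: "mlin (\<lambda>as' t. word x as' \<otimes> (t :: ('c, 'c) tensor))"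
      by (rule mlinI) (rule lin_tens2[OF lin_id], rule lin_tens1[OF word_lin2])
    show "sweedler (\<lambda>p' c'. p' \<otimes> \<Delta> c') (wpass c u) =
      sweedler (\<lambda>c1 c2. sweedler (\<lambda>p' c2'. sweedler (\<lambda>p'' c1'. p'' \<otimes> (c1' \<otimes> c2')) (wpass c1 p')) (wpass c2 u)) (\<Delta> c)"
    proof -
      have "sweedler (\<lambda>p' c2'. sweedler (\<lambda>p'' c1'. p'' \<otimes> (c1' \<otimes> c2')) (wpass c1 p')) (wpass c2 u)
        = pass \<psi> c2 as (\<lambda>as' c2'. sweedler (\<lambda>p'' c1'. p'' \<otimes> (c1' \<otimes> c2')) (wpass c1 (word x as')))" for c1 c2
        unfolding u by (rule sweedler_wpass_word[OF b2])
      then show ?thesis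
        unfolding u sweedler_wpass_word[OF bD] sweedler_wpass_word[OF b1] using pass_coproduct[OF m] by simp
    qed
  qed
qed

lemma wpass_counit:
  assumes p: "p \<in> V"
  shows "sweedler (\<lambda>p' c'. \<epsilon> c' *\<^sub>C p') (wpass c p) = \<epsilon> c *\<^sub>C p"
proof -
  have b: "bil (\<lambda>p' c'. \<epsilon> c' *\<^sub>C (p' :: 'k \<Rightarrow>\<^sub>0 complex))"
    by (intro bilI lin_scaleC lin_id lin_scaleC_left \<epsilon>_lin)
  show ?thesis
  proof (rule lin_eq_on_span[OF p[unfolded total_eq]])
    show "lin (\<lambda>p. sweedler (\<lambda>p' c'. \<epsilon> c' *\<^sub>C p') (wpass c p))"
      by (rule lin_comp[OF lin_sweedler[OF b] bilD2[OF wpass_bil]])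
    show "lin (\<lambda>p. \<epsilon> c *\<^sub>C (p :: 'k \<Rightarrow>\<^sub>0 complex))" by (rule lin_scaleC[OF lin_id])
    fix u assume "u \<in> (\<Union>i. gens i)"
    then obtain x as where u: "u = word x as" using V_words by blast
    show "sweedler (\<lambda>p' c'. \<epsilon> c' *\<^sub>C p') (wpass c u) = \<epsilon> c *\<^sub>C u"
      unfolding u sweedler_wpass_word[OF b] by (rule pass_counit[OF word_lin2])
  qed
qed

lemma wpass_wdiff:
  assumes p: "p \<in> V"
  shows "wpass c (wdiff p) = sweedler (\<lambda>p' c'. wdiff p' \<otimes> c') (wpass c p)"
proof -
  have b: "bil (\<lambda>p' c'. wdiff p' \<otimes> (c' :: 'c))" by (rule bil_tens_comp[OF wdiff_lin])
  show ?thesis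
  proof (rule lin_eq_on_span[OF p[unfolded total_eq]])
    show "lin (\<lambda>p. wpass c (wdiff p))" by (rule lin_comp[OF bilD2[OF wpass_bil] wdiff_lin])
    show "lin (\<lambda>p. sweedler (\<lambda>p' c'. wdiff p' \<otimes> c') (wpass c p))"
      by (rule lin_comp[OF lin_sweedler[OF b] bilD2[OF wpass_bil]])
    fix u assume "u \<in> (\<Union>i. gens i)"
    then obtain x as where u: "u = word x as" using V_words by blast
    let ?f1 = "\<lambda>as' c'. word (nilp * x) (1 # as') \<otimes> c'" and ?f2 = "\<lambda>as' c'. word (x * nilp) (as' @ [1]) \<otimes> c'"
    have m1: "mlin ?f1" by (rule mlin_Cons[OF mlin_word])
    have m2: "mlin ?f2"
    proof (rule mlinI)
      show "lin (\<lambda>a. word (x * nilp) ((us @ a # vs) @ [1]) \<otimes> c)" for us vs c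
        using lin_tens1[OF word_lin2[of "x * nilp" us "vs @ [1]"]] by simp
    qed (rule lin_tens2[OF lin_id])
    have "wpass c (wdiff u) = pass \<psi> c as ?f1 + (- 1) ^ length as *\<^sub>C pass \<psi> c as ?f2"
      unfolding u wdiff_word diff_word_def lin_add[OF bilD2[OF wpass_bil]] lin_scale[OF bilD2[OF wpass_bil]] wpass_word
      using pass_one[OF mlin_word, of c "[]" as "nilp * x"] pass_one[OF mlin_word, of c as "[]" "x * nilp"] by simp
    also have "\<dots> = pass \<psi> c as (\<lambda>as' c'. ?f1 as' c' + (- 1) ^ length as *\<^sub>C ?f2 as' c')"
      by (rule pass_linear_combination[OF m1 m2, symmetric])
    also have "\<dots> = pass \<psi> c as (\<lambda>as' c'. wdiff (word x as') \<otimes> c')"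
      by (rule pass_cong) (simp add: wdiff_word diff_word_def tens_bilinear)
    finally show "wpass c (wdiff u) = sweedler (\<lambda>p' c'. wdiff p' \<otimes> c') (wpass c u)"
      unfolding u sweedler_wpass_word[OF b] .
  qed
qed

lemma dg_entwining_wdga: "dg_entwining wdga \<Delta> \<epsilon> wpsi"
proof -
  have bD: "bil (\<lambda>p' c'. (p' :: 'k \<Rightarrow>\<^sub>0 complex) \<otimes> \<Delta> c')"
    by (intro bilI lin_tens1 lin_tens2 lin_id \<Delta>_lin)
  have b1: "bil (\<lambda>p'' c1'. (p'' :: 'k \<Rightarrow>\<^sub>0 complex) \<otimes> ((c1' :: 'c) \<otimes> (c2' :: 'c)))" for c2'
    by (intro bilI lin_tens1 lin_id lin_tens2)
  have b2: "bil (\<lambda>p' c2'. sweedler (\<lambda>p'' c1'. (p'' :: 'k \<Rightarrow>\<^sub>0 complex) \<otimes> ((c1' :: 'c) \<otimes> (c2' :: 'c))) (wpass c1 p'))" for c1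
    by (intro bilI lin_comp[OF lin_sweedler[OF b1] bilD2[OF wpass_bil]] lin_sweedler_arg b1 lin_tens2 lin_id)
  have b: "bil (\<lambda>p' c'. sweedler (\<lambda>q' c''. wmul p' q' \<otimes> c'') (wpass c' q))" for q
    by (intro bilI lin_sweedler_arg wmul_tens_bil lin_tens1 bilD1[OF wmul_bil]
        lin_comp[OF lin_sweedler[OF wmul_tens_bil] bilD1[OF wpass_bil]])
  have be: "bil (\<lambda>p' c'. \<epsilon> c' *\<^sub>C (p' :: 'k \<Rightarrow>\<^sub>0 complex))"
    by (intro bilI lin_scaleC lin_id lin_scaleC_left \<epsilon>_lin)
  have bd: "bil (\<lambda>p' c'. wdiff p' \<otimes> (c' :: 'c))" by (rule bil_tens_comp[OF wdiff_lin])
  have bd': "bil (\<lambda>c p'. (c :: 'c) \<otimes> wdiff p')" by (intro bilI lin_tens1 lin_tens2 lin_id wdiff_lin)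
  have img: "wpsi ` tensor_on UNIV S \<subseteq> tensor_on S UNIV"
    if S: "cvs.subspace S" and "\<And>c p. p \<in> S \<Longrightarrow> wpass c p \<in> tensor_on S UNIV" for S
  proof
    fix t assume "t \<in> wpsi ` tensor_on UNIV S"
    then obtain s where s: "t = wpsi s" "s \<in> tensor_on UNIV S" by blast
    show "t \<in> tensor_on S UNIV"
      unfolding s(1) wpsi_def
      by (rule sweedler_in_subspace[OF subspace_tensor_on subspace_UNIV S wpass_bil that(2) s(2)])
  qed
  have "entwining V wmul \<Delta> \<epsilon> wpsi"
    unfolding entwining_def
  proof (intro conjI allI ballI)
    show "algebra_on V wmul" using dg_algebra_wdga by (simp add: dg_algebra_def)
    show "coalgebra \<Delta> \<epsilon>" by (rule coalg)
    show "clinear_on (tensor_on UNIV V) wpsi" using wpsi_lin by (auto simp: clinear_on_def)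
    show "wpsi ` tensor_on UNIV V \<subseteq> tensor_on V UNIV" by (rule img[OF V_sub wpass_V])
    fix c p assume p: "p \<in> V"
    show "tlift V UNIV (\<lambda>a' c'. \<epsilon> c' *\<^sub>C a') (wpsi (c \<otimes> p)) = \<epsilon> c *\<^sub>C p"
      unfolding wpsi_tens tlift_eq_sweedler[OF V_sub subspace_UNIV be refl wpass_V[OF p]]
      by (rule wpass_counit[OF p])
    show "tensor_map V UNIV id \<Delta> (wpsi (c \<otimes> p)) =
        sweedler (\<lambda>c1 c2. tlift V UNIV (\<lambda>a' c2'. tlift V UNIV (\<lambda>a'' c1'. a'' \<otimes> (c1' \<otimes> c2'))
          (wpsi (c1 \<otimes> a'))) (wpsi (c2 \<otimes> p))) (\<Delta> c)"
    proof -
      have i1: "tlift V UNIV (\<lambda>a'' c1'. a'' \<otimes> (c1' \<otimes> c2')) (wpsi (c1 \<otimes> a'))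
        = sweedler (\<lambda>p'' c1'. p'' \<otimes> (c1' \<otimes> c2')) (wpass c1 a')" if "a' \<in> V" for c1 a' and c2' :: 'c
        unfolding wpsi_tens by (rule tlift_eq_sweedler[OF V_sub subspace_UNIV b1 _ wpass_V[OF that]]) (rule refl)
      have i2: "tlift V UNIV (\<lambda>a' c2'. tlift V UNIV (\<lambda>a'' c1'. a'' \<otimes> (c1' \<otimes> c2')) (wpsi (c1 \<otimes> a'))) (wpsi (c2 \<otimes> p))
        = sweedler (\<lambda>p' c2'. sweedler (\<lambda>p'' c1'. p'' \<otimes> (c1' \<otimes> c2')) (wpass c1 p')) (wpass c2 p)" for c1 c2
        unfolding wpsi_tens[of c2 p] by (rule tlift_eq_sweedler[OF V_sub subspace_UNIV b2 i1 wpass_V[OF p]])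
      have i3: "tensor_map V UNIV id \<Delta> (wpsi (c \<otimes> p)) = sweedler (\<lambda>p' c'. p' \<otimes> \<Delta> c') (wpass c p)"
        unfolding tensor_map_def wpsi_tens
        by (rule tlift_eq_sweedler[OF V_sub subspace_UNIV bD _ wpass_V[OF p]]) simp
      show ?thesis unfolding i2 i3 by (rule wpass_coproduct[OF p])
    qed
    fix q assume q: "q \<in> V"
    show "wpsi (c \<otimes> wmul p q) = tlift V UNIV (\<lambda>a' c'. tlift V UNIV (\<lambda>b' c''. wmul a' b' \<otimes> c'') (wpsi (c' \<otimes> q))) (wpsi (c \<otimes> p))"
    proof -
      have i1: "tlift V UNIV (\<lambda>b' c''. wmul a' b' \<otimes> c'') (wpsi (c' \<otimes> q)) = sweedler (\<lambda>q' c''. wmul a' q' \<otimes> c'') (wpass c' q)" for a' c'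
        unfolding wpsi_tens by (rule tlift_eq_sweedler[OF V_sub subspace_UNIV wmul_tens_bil _ wpass_V[OF q]]) (rule refl)
      show ?thesis
        unfolding wpsi_tens[of c] i1 wpass_wmul[OF p q]
        by (rule tlift_eq_sweedler[OF V_sub subspace_UNIV b _ wpass_V[OF p], symmetric]) (rule refl)
    qed
  qed
  moreover have "tensor_map V UNIV wdiff id (wpsi t) = wpsi (tensor_map UNIV V id wdiff t)"
    if t: "t \<in> tensor_on UNIV V" for t
  proof -
    have "wpsi t \<in> tensor_on V UNIV" using img[OF V_sub wpass_V] t by blast
    then have 1: "tensor_map V UNIV wdiff id (wpsi t) = sweedler (\<lambda>p' c'. wdiff p' \<otimes> c') (wpsi t)"
      unfolding tensor_map_def by (intro tlift_eq_sweedler[OF V_sub subspace_UNIV bd]) auto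
    have 2: "tensor_map UNIV V id wdiff t = sweedler (\<lambda>c p. c \<otimes> wdiff p) t"
      unfolding tensor_map_def using t by (intro tlift_eq_sweedler[OF subspace_UNIV V_sub bd']) auto
    show ?thesis
      unfolding 1 2 using t
    proof (induction rule: tensor_on_induct)
      case (tens c p)
      then show ?case by (simp add: sweedler_tens[OF bd'] wpsi_tens wpass_wdiff)
    next
      case (add s t)
      then show ?case by (simp add: lin_add[OF wpsi_lin] lin_add[OF lin_sweedler[OF bd]] lin_add[OF lin_sweedler[OF bd']])
    next
      case (scale k s)
      then show ?case by (simp add: lin_scale[OF wpsi_lin] lin_scale[OF lin_sweedler[OF bd]] lin_scale[OF lin_sweedler[OF bd']])
    qed (use cvs.subspace_0[OF V_sub] in auto)
  qed
  ultimately show ?thesis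
    unfolding dg_entwining_def wdga_simps using dg_algebra_wdga img[OF cvs.subspace_span wpass_piece] by blast
qed

definition wrho :: "'a \<Rightarrow> 'k \<Rightarrow>\<^sub>0 complex" where
  "wrho a = word idem [a]"

lemma wrho_lin: "lin wrho"
  unfolding wrho_def using word_lin2[of idem "[]" "[]"] by simp

lemma dg_entwining_over_wdga: "dg_entwining_over \<psi> wdga \<Delta> \<epsilon> wpsi wrho"
  unfolding dg_entwining_over_def
proof (intro conjI allI dg_entwining_wdga)
  show "algebra_hom_on UNIV (*) (piece wdga 0) (mul wdga) wrho"
    unfolding algebra_hom_on_def
    by (auto simp: wrho_lin wrho_def wmul_word idem_nilp merge_def intro!: cvs.span_base gensI)
  have b: "bil (\<lambda>v w. v \<otimes> wrho w :: ('c, _) tensor)"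
    by (intro bilI lin_tens1 lin_tens2 lin_id wrho_lin)
  have b': "bil (\<lambda>v w. wrho v \<otimes> w :: (_, 'c) tensor)"
    by (intro bilI lin_tens1 lin_tens2 lin_id wrho_lin)
  show "tensor_map UNIV UNIV wrho id (\<psi> t) = wpsi (tensor_map UNIV UNIV id wrho t)" for t
  proof (induction t rule: tensor_induct)
    case (tens c a)
    have "wpsi (c \<otimes> wrho a) = sweedler (\<lambda>a' c'. wrho a' \<otimes> c') (\<psi> (c \<otimes> a))"
      by (simp add: wpsi_tens wrho_def wpass_word)
    then show ?case by (simp add: tensor_map_def sweedler_tens[OF b])
  next
    case (add s t)
    then show ?case
      by (simp add: tensor_map_def lin_add[OF \<psi>_lin] lin_add[OF wpsi_lin] lin_add[OF lin_sweedler[OF b]] lin_add[OF lin_sweedler[OF b']])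
  next
    case (scale k s)
    then show ?case
      by (simp add: tensor_map_def lin_scale[OF \<psi>_lin] lin_scale[OF wpsi_lin] lin_scale[OF lin_sweedler[OF b]] lin_scale[OF lin_sweedler[OF b']])
  qed
qed

end

section \<open>The trace\<close>

lemma sweedler_cmult: "bil F \<Longrightarrow> sweedler (\<lambda>v w. (z::complex) * F v w) t = z * sweedler F t"
  using sweedler_fun_scale[of F z t] by (simp add: scaleC_complex_def)

locale cone_cycle = cone_dga enc \<Delta> \<epsilon> \<psi>
  for enc :: "cone \<times> 'a::complex_algebra_1 list \<Rightarrow> 'k"
    and \<Delta> :: "'c::complex_vector \<Rightarrow> ('c, 'c) tensor" and \<epsilon> :: "'c \<Rightarrow> complex"
    and \<psi> :: "('c, 'a) tensor \<Rightarrow> ('a, 'c) tensor" +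
  fixes h :: "'c \<Rightarrow> 'a list \<Rightarrow> complex" and k :: nat and \<tau> :: "cone \<Rightarrow> complex"
  assumes h: "h \<in> cyclic_cochains \<psi> k"
    and \<tau>_lin: "lin \<tau>" and \<tau>: "\<And>x. x \<in> finite_rank \<Longrightarrow> \<tau> x = trace x"
begin

lemma h_cochain: "h \<in> cochains k"
  using h unfolding cyclic_cochains_def by blast

lemma h_zero: "length as \<noteq> Suc k \<Longrightarrow> h c as = 0"
  using h_cochain by (simp add: cochains_def)

lemma h_mlin: "mlin (\<lambda>as c. h c as)"
proof (rule mlinI)
  show "lin (\<lambda>c. h c as)" for as
  proof (cases as)
    case (Cons a l)
    then show ?thesis using bilD2[OF cochain_bil[OF h_cochain], of "[]" a l] by simp
  qed (simp add: h_zero lin_const0)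
  show "lin (\<lambda>a. h c (us @ a # vs))" for us vs c
    by (rule bilD1[OF cochain_bil[OF h_cochain]])
qed

lemma h_cyclic:
  assumes "length as = k"
  shows "h c (a # as) = (- 1) ^ k * sweedler (\<lambda>a' c'. h c' (as @ [a'])) (\<psi> (c \<otimes> a))"
proof -
  have "\<forall>c as. length as = k + 1 \<longrightarrow>
      h c as = (- 1) ^ k * sweedler (\<lambda>a' c'. h c' (tl as @ [a'])) (\<psi> (c \<otimes> hd as))"
    using h unfolding cyclic_cochains_def by blast
  from spec[OF spec[OF this, of c], of "a # as"] show ?thesis using assms by simp
qed

lemma h_rotate:
  "length us + length vs = Suc k \<Longrightarrow>
     h c (us @ vs) = (- 1) ^ (k * length us) * pass \<psi> c us (\<lambda>us' c'. h c' (vs @ us'))"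
proof (induction us arbitrary: c vs)
  case (Cons u us)
  have b: "bil (\<lambda>u' c'. pass \<psi> c' us (\<lambda>us' c''. h c'' (vs @ u' # us')))"
    by (rule pass_bil[OF mlin_append[OF h_mlin]])
  have len: "length (us @ vs) = k" "length us + length (vs @ [u']) = Suc k" for u' using Cons(2) by auto
  have "h c ((u # us) @ vs) = (- 1) ^ k * sweedler (\<lambda>u' c'. h c' (us @ (vs @ [u']))) (\<psi> (c \<otimes> u))"
    using h_cyclic[OF len(1), of c u] by simp
  also have "sweedler (\<lambda>u' c'. h c' (us @ (vs @ [u']))) (\<psi> (c \<otimes> u))
    = sweedler (\<lambda>u' c'. (- 1) ^ (k * length us) * pass \<psi> c' us (\<lambda>us' c''. h c'' (vs @ u' # us'))) (\<psi> (c \<otimes> u))"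
    unfolding Cons(1)[OF len(2)] by simp
  also have "\<dots> = (- 1) ^ (k * length us) * pass \<psi> c (u # us) (\<lambda>us' c''. h c'' (vs @ us'))"
    unfolding sweedler_cmult[OF b] pass.simps ..
  finally show ?case by (simp add: power_add mult.assoc)
qed simp

text \<open>Read cyclically, the word \<open>a\<^sub>0 F a\<^sub>1 \<dots> F a\<^sub>n\<close> has the \<open>n\<close> letters \<open>a\<^sub>1, \<dots>, a\<^sub>n a\<^sub>0\<close> between its
\<open>n\<close> symbols \<open>F\<close>; on them \<open>h\<close> is evaluated, once \<open>c\<close> has passed \<open>a\<^sub>0\<close>.\<close>
definition closing :: "'c \<Rightarrow> 'a list \<Rightarrow> complex" where
  "closing c as = (if length as = Suc (Suc k)
     then sweedler (\<lambda>a' c'. h c' (merge (tl as) [a'])) (\<psi> (c \<otimes> hd as)) else 0)"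

lemma h_merge_bil: "bil (\<lambda>a' c'. h c' (merge l [a']))"
  unfolding merge_def list.sel by (rule bil_comp1[OF cochain_bil[OF h_cochain] lin_const_mult[OF lin_id]])

lemma closing_mlin: "mlin (\<lambda>as c. closing c as)"
proof (rule mlinI)
  show "lin (\<lambda>c. closing c as)" for as
    unfolding closing_def
    by (cases "length as = Suc (Suc k)") (auto intro: lin_const0 lin_comp[OF lin_sweedler[OF h_merge_bil] \<psi>_lin1])
  show "lin (\<lambda>a. closing c (us @ a # vs))" for us vs c
  proof (cases "length us + length vs = Suc k")
    case True
    have "lin (\<lambda>a. sweedler (\<lambda>a' c'. h c' (merge (tl (us @ a # vs)) [a'])) (\<psi> (c \<otimes> hd (us @ a # vs))))"
    proof (cases us)
      case Nil
      then show ?thesis by (simp add: lin_comp[OF lin_sweedler[OF h_merge_bil] \<psi>_lin2])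
    next
      case (Cons u us')
      have "lin (\<lambda>a. h c' (merge (us' @ a # vs) [a']))" for a' c'
        by (rule lin_merge_left[of "h c'", OF mlinD(2)[OF h_mlin]])
      then show ?thesis unfolding Cons by (simp add: lin_sweedler_arg h_merge_bil)
    qed
    then show ?thesis using True by (simp add: closing_def)
  qed (simp add: closing_def lin_const0)
qed

lemma closing_one:
  assumes "length as = Suc k"
  shows "closing c (1 # as) = h c as"
proof -
  have "merge as [1] = as" using assms by (cases as rule: rev_cases) (simp_all add: merge_def)
  then show ?thesis using assms by (simp add: closing_def \<psi>_one sweedler_tens[OF h_merge_bil])
qed

lemma closing_snoc_one:
  assumes "length as = Suc k"
  shows "closing c (as @ [1]) = (- 1) ^ k * h c as"
proof -
  obtain a l where as: "as = a # l" "length l = k" using assms by (cases as) auto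
  have "(- 1) ^ k * (- 1) ^ k = (1 :: complex)" by (simp add: power_mult_distrib[symmetric])
  then show ?thesis
    unfolding as(1) h_cyclic[OF as(2)] mult.assoc[symmetric]
    by (simp add: closing_def as(2) merge_def)
qed

lemma h_merge_closing:
  assumes us: "length us = i" "us \<noteq> []" and vs: "length vs = Suc j" and ij: "i + j = Suc k"
  shows "h c (merge us vs) = (- 1) ^ (i * j) * pass \<psi> c us (\<lambda>us' c'. closing c' (vs @ us'))"
proof -
  obtain v vs' where v: "vs = v # vs'" "length vs' = j" using vs by (cases vs) auto
  have m: "merge us vs = merge us [v] @ vs'"
    unfolding v(1) using merge_append_right[of "[v]" us vs'] by simp
  have len: "length (merge us [v]) = i" using length_merge[OF us(2), of "[v]"] us(1) by simp
  have "pass \<psi> c (merge us [v]) (\<lambda>l c'. h c' (vs' @ l))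
      = pass \<psi> c us (\<lambda>us' c'. pass \<psi> c' [v] (\<lambda>l c''. h c'' (vs' @ merge us' l)))"
    by (rule pass_merge[OF mlin_append[OF h_mlin] us(2)]) simp
  also have "\<dots> = pass \<psi> c us (\<lambda>us' c'. closing c' (vs @ us'))"
  proof (rule pass_cong)
    fix us' :: "'a list" and c' assume l: "length us' = length us"
    then have "us' \<noteq> []" using us(2) by auto
    then show "pass \<psi> c' [v] (\<lambda>l c''. h c'' (vs' @ merge us' l)) = closing c' (vs @ us')"
      using l us(1) v ij by (simp add: closing_def merge_append)
  qed
  finally have eq: "pass \<psi> c (merge us [v]) (\<lambda>l c'. h c' (vs' @ l)) = pass \<psi> c us (\<lambda>us' c'. closing c' (vs @ us'))" .
  have "even (i * (i - 1))" by (cases i) auto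
  moreover have "k * i = i * (i - 1) + i * j" using ij us
    by (cases i) (auto simp: algebra_simps)
  ultimately have sgn: "(- 1) ^ (k * i) = ((- 1) ^ (i * j) :: complex)" by (simp add: power_add)
  show ?thesis
    unfolding m using h_rotate[of "merge us [v]" vs' c] len v(2) ij by (simp add: eq sgn)
qed

text \<open>Both orders of the two words give the same cyclic word, so the two sides are values of \<open>h\<close> that
differ by a rotation through \<open>i\<close> places.  Its sign \<open>(-1)\<^sup>k\<^sup>i\<close> is \<open>(-1)\<^sup>i\<^sup>j\<close> since \<open>k i = i (i - 1) + i j\<close>.\<close>
lemma closing_merge:
  assumes as: "length as = Suc i" and bs: "length bs = Suc j" and ij: "i + j = Suc k"
  shows "closing c (merge as bs) = (- 1) ^ (i * j) * pass \<psi> c as (\<lambda>as' c'. closing c' (merge bs as'))"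
proof -
  obtain a us where a: "as = a # us" "length us = i" using as by (cases as) auto
  have bs_ne: "bs \<noteq> []" using bs by auto
  show ?thesis
  proof (cases "us = []")
    case True
    then have i: "i = 0" using a by simp
    obtain b vs where b': "bs = b # vs" "length vs = Suc k" using bs ij i by (cases bs) auto
    then have b: "bs = b # vs" "length vs = Suc k" "vs \<noteq> []" by auto
    have "closing c (merge as bs) = sweedler (\<lambda>a' c'. h c' (merge vs [a'])) (\<psi> (c \<otimes> (a * b)))"
      unfolding a(1) True b(1) by (simp add: closing_def merge_def b(2))
    also have "\<dots> = sweedler (\<lambda>a' c'. sweedler (\<lambda>b' c''. h c'' (merge vs [a' * b'])) (\<psi> (c' \<otimes> b))) (\<psi> (c \<otimes> a))"
      by (rule sweedler_\<psi>_mult[OF h_merge_bil])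
    also have "\<dots> = sweedler (\<lambda>a' c'. closing c' (merge bs [a'])) (\<psi> (c \<otimes> a))"
    proof -
      have "merge bs [a'] = b # merge vs [a']" for a'
        unfolding b(1) using merge_append[OF b(3), of "[b]"] by simp
      moreover have "merge (merge vs [a']) [b'] = merge vs [a' * b']" for a' b'
        by (simp add: merge_assoc) (simp add: merge_def)
      moreover have "length (merge vs [a']) = Suc k" for a' using length_merge[OF b(3), of "[a']"] b(2) by simp
      ultimately show ?thesis by (simp add: closing_def)
    qed
    finally show ?thesis by (simp add: a(1) True i)
  next
    case False
    have len: "length (merge us bs) = Suc k" using length_merge[OF False bs_ne] a(2) bs ij by simp
    have b: "bil (\<lambda>a' c'. pass \<psi> c' us (\<lambda>us' c''. closing c'' (merge bs (a' # us'))))"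
    proof -
      have "mlin (\<lambda>as' c'. closing c' (merge bs as'))"
        by (rule mlinI) (rule mlinD(1)[OF closing_mlin],
            rule lin_merge_right[of "closing c" for c, OF mlinD(2)[OF closing_mlin]])
      from pass_bil[OF this] show ?thesis .
    qed
    have "closing c (merge as bs) = sweedler (\<lambda>a' c'. h c' (merge us (merge bs [a']))) (\<psi> (c \<otimes> a))"
      using merge_append[OF False, of "[a]" bs] len unfolding a(1)
      by (simp add: closing_def merge_assoc[OF bs_ne])
    also have "\<dots> = sweedler (\<lambda>a' c'. (- 1) ^ (i * j) * pass \<psi> c' us (\<lambda>us' c''. closing c'' (merge bs (a' # us')))) (\<psi> (c \<otimes> a))"
    proof -
      have "length (merge bs [a']) = Suc j" for a' using length_merge[OF bs_ne, of "[a']"] bs by simp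
      moreover have "merge bs [a'] @ us' = merge bs (a' # us')" for a' us'
        using merge_append_right[of "[a']" bs us'] by simp
      ultimately show ?thesis
        using h_merge_closing[OF a(2) False _ ij] by simp
    qed
    also have "\<dots> = (- 1) ^ (i * j) * sweedler (\<lambda>a' c'. pass \<psi> c' us (\<lambda>us' c''. closing c'' (merge bs (a' # us')))) (\<psi> (c \<otimes> a))"
      by (rule sweedler_cmult[OF b])
    finally show ?thesis by (simp add: a(1))
  qed
qed

definition wtrace :: "('c, 'k \<Rightarrow>\<^sub>0 complex) tensor \<Rightarrow> complex" where
  "wtrace = sweedler (\<lambda>c. lift (\<lambda>x as. \<tau> x * closing c as))"

lemma lin_complex_mult: "lin f \<Longrightarrow> lin (\<lambda>x. f x * (z :: complex))"
  using lin_cmult[of f z] by (simp add: mult.commute)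

lemma multilin_closing: "multilin (\<lambda>x as. \<tau> x * closing c as)"
  by (rule multilinI) (rule lin_complex_mult[OF \<tau>_lin], rule lin_cmult[OF mlinD(2)[OF closing_mlin]])

lemma wtrace_bil: "bil (\<lambda>c. lift (\<lambda>x as. \<tau> x * closing c as))"
  by (intro bilI lin_lift lin_lift_arg lin_cmult mlinD(1)[OF closing_mlin])

lemma wtrace_lin: "lin wtrace"
  unfolding wtrace_def by (rule lin_sweedler[OF wtrace_bil])

lemma wtrace_word: "wtrace (c \<otimes> word x as) = \<tau> x * closing c as"
  unfolding wtrace_def sweedler_tens[OF wtrace_bil] lift_word[OF multilin_closing] ..

lemma \<tau>_commute: "x \<in> finite_rank \<or> y \<in> finite_rank \<Longrightarrow> \<tau> (x * y) = \<tau> (y * x)"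
  using trace_commute[of x y] trace_commute[of y x] finite_rank_mult_left finite_rank_mult_right \<tau> by metis

lemma wtrace_closed:
  assumes p: "p \<in> cvs.span (gens k)"
  shows "wtrace (c \<otimes> wdiff p) = 0"
proof (rule lin_eq_on_span[OF p])
  show "lin (\<lambda>p. wtrace (c \<otimes> wdiff p))" by (rule lin_comp[OF wtrace_lin lin_tens2[OF wdiff_lin]])
  fix u assume "u \<in> gens k"
  then obtain x as where x: "u = word x as" "length as = Suc k" by (rule gensE)
  have "wtrace (c \<otimes> wdiff u) = \<tau> (nilp * x) * closing c (1 # as) + (- 1) ^ Suc k * (\<tau> (x * nilp) * closing c (as @ [1]))"
    unfolding x(1) wdiff_word diff_word_def tens_bilinear lin_add[OF wtrace_lin] lin_scale[OF wtrace_lin]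
      wtrace_word x(2) scaleC_complex_def ..
  also have "\<dots> = 0"
  proof -
    have "(- 1) ^ k * (- 1) ^ k = (1 :: complex)" by (simp add: power_mult_distrib[symmetric])
    then have "(- 1) ^ Suc k * (t * ((- 1) ^ k * y)) = - (t * y)" for t y :: complex
      by (simp add: mult.left_commute mult.assoc[symmetric])
    then show ?thesis
      unfolding closing_one[OF x(2)] closing_snoc_one[OF x(2)]
      using \<tau>_commute[of nilp x] nilp_finite_rank by simp
  qed
  finally show "wtrace (c \<otimes> wdiff u) = 0" .
qed (rule lin_const0)

lemma wtrace_wmul:
  assumes p: "p \<in> cvs.span (gens i)" and q: "q \<in> cvs.span (gens j)" and ij: "i + j = Suc k"
  shows "wtrace (c \<otimes> wmul p q) = (- 1) ^ (i * j) * sweedler (\<lambda>s c'. wtrace (c' \<otimes> wmul q s)) (wpass c p)"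
proof -
  have b: "bil (\<lambda>s c'. wtrace (c' \<otimes> wmul q s))" for q
    by (intro bilI lin_comp[OF wtrace_lin] lin_tens1 lin_tens2 lin_id bilD2[OF wmul_bil])
  show ?thesis
  proof (rule lin_eq_on_span[OF p])
    show "lin (\<lambda>p. wtrace (c \<otimes> wmul p q))" by (rule lin_comp[OF wtrace_lin lin_tens2[OF bilD1[OF wmul_bil]]])
    show "lin (\<lambda>p. (- 1) ^ (i * j) * sweedler (\<lambda>s c'. wtrace (c' \<otimes> wmul q s)) (wpass c p))"
      by (rule lin_cmult[OF lin_comp[OF lin_sweedler[OF b] bilD2[OF wpass_bil]]])
    fix u assume u: "u \<in> gens i"
    show "wtrace (c \<otimes> wmul u q) = (- 1) ^ (i * j) * sweedler (\<lambda>s c'. wtrace (c' \<otimes> wmul q s)) (wpass c u)"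
    proof (rule lin_eq_on_span[OF q])
      show "lin (\<lambda>q. wtrace (c \<otimes> wmul u q))" by (rule lin_comp[OF wtrace_lin lin_tens2[OF bilD2[OF wmul_bil]]])
      show "lin (\<lambda>q. (- 1) ^ (i * j) * sweedler (\<lambda>s c'. wtrace (c' \<otimes> wmul q s)) (wpass c u))"
        by (intro lin_cmult lin_sweedler_arg b lin_comp[OF wtrace_lin] lin_tens2 bilD1[OF wmul_bil])
      fix v assume v: "v \<in> gens j"
      obtain x as where x: "u = word x as" "length as = Suc i" "i \<noteq> 0 \<Longrightarrow> x \<in> finite_rank" using gensE[OF u] by metis
      obtain y bs where y: "v = word y bs" "length bs = Suc j" "j \<noteq> 0 \<Longrightarrow> y \<in> finite_rank" using gensE[OF v] by metis
      have xy: "\<tau> (x * y) = \<tau> (y * x)" using \<tau>_commute[of x y] x(3) y(3) ij by (cases "i = 0") auto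
      have m: "mlin (\<lambda>as' c'. closing c' (merge bs as'))"
        by (rule mlinI) (rule mlinD(1)[OF closing_mlin],
            rule lin_merge_right[of "closing c" for c, OF mlinD(2)[OF closing_mlin]])
      have "sweedler (\<lambda>s c'. wtrace (c' \<otimes> wmul v s)) (wpass c u)
         = pass \<psi> c as (\<lambda>as' c'. \<tau> (y * x) * closing c' (merge bs as'))"
        unfolding x(1) sweedler_wpass_word[OF b] unfolding y(1) wmul_word wtrace_word ..
      also have "\<dots> = \<tau> (y * x) * pass \<psi> c as (\<lambda>as' c'. closing c' (merge bs as'))"
        by (rule pass_comp[OF lin_cmult[OF lin_id] m, symmetric])
      finally have r: "sweedler (\<lambda>s c'. wtrace (c' \<otimes> wmul v s)) (wpass c u)
        = \<tau> (y * x) * pass \<psi> c as (\<lambda>as' c'. closing c' (merge bs as'))" .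
      show "wtrace (c \<otimes> wmul u v) = (- 1) ^ (i * j) * sweedler (\<lambda>s c'. wtrace (c' \<otimes> wmul v s)) (wpass c u)"
        unfolding r unfolding x(1) y(1) wmul_word wtrace_word xy closing_merge[OF x(2) y(2) ij] by simp
    qed
  qed
qed

lemma closed_trace_wtrace: "closed_graded_entwined_trace (Suc k) wdga wpsi wtrace"
  unfolding closed_graded_entwined_trace_def wdga_simps
proof (intro conjI allI ballI impI)
  show "clinear_on (tensor_on UNIV (cvs.span (gens (Suc k)))) wtrace"
    using wtrace_lin by (auto simp: clinear_on_def)
  show "wtrace (c \<otimes> wdiff r) = 0" if "r \<in> cvs.span (gens m)" "m + 1 = Suc k" for m c r
    using wtrace_closed that by simp
  fix i j c r r' assume r: "r \<in> cvs.span (gens i)" and r': "r' \<in> cvs.span (gens j)" and ij: "i + j = Suc k"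
  have b: "bil (\<lambda>s c'. wtrace (c' \<otimes> wmul r' s))"
    by (intro bilI lin_comp[OF wtrace_lin] lin_tens1 lin_tens2 lin_id bilD2[OF wmul_bil])
  have "tlift (cvs.span (gens i)) UNIV (\<lambda>s c'. wtrace (c' \<otimes> wmul r' s)) (wpsi (c \<otimes> r))
      = sweedler (\<lambda>s c'. wtrace (c' \<otimes> wmul r' s)) (wpass c r)"
    unfolding wpsi_tens by (rule tlift_eq_sweedler[OF cvs.subspace_span subspace_UNIV b _ wpass_piece[OF r]]) (rule refl)
  then show "wtrace (c \<otimes> wmul r r') =
      (- 1) ^ (i * j) * tlift (cvs.span (gens i)) UNIV (\<lambda>s c'. wtrace (c' \<otimes> wmul r' s)) (wpsi (c \<otimes> r))"
    using wtrace_wmul[OF r r' ij] by simp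
qed

section \<open>The character\<close>

text \<open>Induction on the last letter: multiplication by \<open>[F, b]\<close> extends a word that ends in a letter by \<open>F b\<close>
or multiplies \<open>b\<close> into its last letter and appends \<open>F\<close>; a word that ends in \<open>F\<close> can, by \<open>F\<^sup>2 = 0\<close>,
only be extended by \<open>b F\<close>.\<close>
lemma form_word:
  "foldl wmul (wrho a) (map (\<lambda>a. wdiff (wrho a)) as) = word idem (a # as)
     + (- 1) ^ Suc (length as) *\<^sub>C alt_faces (\<lambda>q. word (idem * nilp) (q @ [1])) (a # as)"
proof (induction as rule: rev_induct)
  case Nil
  then show ?case by (simp add: wrho_def)
next
  case (snoc b as)
  let ?l = "a # as" and ?F = "\<lambda>q. word (idem * nilp) (q @ [1])" and ?n = "length as"
  define db where "db = wdiff (wrho b)"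
  have db: "db = word (nilp * idem) [1, b] - word (idem * nilp) [b, 1]"
    by (simp add: db_def wrho_def wdiff_word diff_word_def cvs.scale_minus_left scaleC_one)
  have r: "idem * (nilp * idem) = idem" "idem * (idem * nilp) = idem * nilp"
    "idem * nilp * (nilp * idem) = 0" "idem * nilp * (idem * nilp) = idem * nilp"
    using idem_nilp by (simp_all add: mult.assoc[symmetric]) (simp add: mult.assoc)
  have 1: "wmul (word idem ?l) db = word idem (?l @ [b]) - ?F (butlast ?l @ [last ?l * b])"
  proof -
    have "merge ?l [1, b] = ?l @ [b]" by (cases as rule: rev_cases) (simp_all add: merge_def)
    moreover have "merge ?l [b, 1] = (butlast ?l @ [last ?l * b]) @ [1]" by (simp add: merge_def)
    ultimately show ?thesis
      unfolding db lin_diff[OF bilD2[OF wmul_bil]] wmul_word r by (simp only:)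
  qed
  have 2: "wmul (?F q) db = - ?F (q @ [b])" for q
    unfolding db lin_diff[OF bilD2[OF wmul_bil]] wmul_word r
    by (simp add: merge_def lin_zero[OF word_lin1])
  have 3: "wmul (alt_faces ?F ?l) db = - alt_faces (\<lambda>q. ?F (q @ [b])) ?l"
    using alt_faces_lin[OF bilD1[OF wmul_bil], of ?F ?l db]
      alt_faces_lin[OF lin_uminus[OF lin_id], of "\<lambda>q. ?F (q @ [b])" ?l] by (simp add: 2)
  have "foldl wmul (wrho a) (map (\<lambda>a. wdiff (wrho a)) (as @ [b]))
      = wmul (word idem ?l + (- 1) ^ Suc ?n *\<^sub>C alt_faces ?F ?l) db"
    using snoc by (simp add: db_def)
  also have "\<dots> = word idem (?l @ [b]) - ?F (butlast ?l @ [last ?l * b])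
      - (- 1) ^ Suc ?n *\<^sub>C alt_faces (\<lambda>q. ?F (q @ [b])) ?l"
    unfolding lin_add[OF bilD1[OF wmul_bil]] lin_scale[OF bilD1[OF wmul_bil]] 1 3 by simp
  also have "\<dots> = word idem (?l @ [b]) + (- 1) ^ Suc (Suc ?n) *\<^sub>C alt_faces ?F (a # as @ [b])"
  proof -
    have "(- 1) ^ Suc (Suc ?n) * (- 1) ^ Suc ?n = (- 1 :: complex)"
      by (simp add: power_mult_distrib[symmetric])
    then have s: "(- 1) ^ Suc (Suc ?n) *\<^sub>C (- 1) ^ Suc ?n *\<^sub>C y = - y" for y :: "'k \<Rightarrow>\<^sub>0 complex"
      unfolding scaleC_scaleC by (simp add: cvs.scale_minus_left scaleC_one)
    have s': "(- 1) ^ Suc (Suc ?n) *\<^sub>C y = - ((- 1) ^ Suc ?n *\<^sub>C y)" for y :: "'k \<Rightarrow>\<^sub>0 complex"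
      by (simp add: cvs.scale_minus_left)
    show ?thesis unfolding alt_faces_snoc scaleC_add_right s by (simp only: s') simp
  qed
  finally show ?case by simp
qed

lemma character_eq: "cycle_character (Suc k) wdga wtrace wrho = coboundary_map \<psi> k h"
proof (intro ext)
  fix c and as :: "'a list"
  show "cycle_character (Suc k) wdga wtrace wrho c as = coboundary_map \<psi> k h c as"
  proof (cases "length as = Suc (Suc k)")
    case True
    then obtain a l where as: "as = a # l" "length l = Suc k" by (cases as) auto
    note T = lin_comp[OF wtrace_lin lin_tens2[OF lin_id], of c]
    have \<tau>1: "\<tau> idem = 1" "\<tau> (idem * nilp) = 1"
      using \<tau>[OF idem_finite_rank] \<tau>[OF finite_rank_mult_right[OF idem_finite_rank]] trace_idem by simp_all
    have "cycle_character (Suc k) wdga wtrace wrho c as = wtrace (c \<otimes> (word idem (a # l)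
        + (- 1) ^ Suc (length l) *\<^sub>C alt_faces (\<lambda>q. word (idem * nilp) (q @ [1])) (a # l)))"
      unfolding form_word[symmetric] by (simp add: cycle_character_def as)
    also have "\<dots> = closing c (a # l) + (- 1) ^ k * alt_faces (\<lambda>q. closing c (q @ [1])) (a # l)"
      unfolding lin_add[OF T] lin_scale[OF T] alt_faces_lin[OF T] wtrace_word \<tau>1
      by (simp add: as(2) scaleC_complex_def)
    also have "alt_faces (\<lambda>q. closing c (q @ [1])) (a # l) = alt_faces (\<lambda>q. (- 1) ^ k * h c q) (a # l)"
      by (rule alt_faces_cong) (simp add: closing_snoc_one as(2))
    also have "\<dots> = (- 1) ^ k * alt_faces (h c) (a # l)"
      by (rule alt_faces_lin[OF lin_cmult[OF lin_id], symmetric])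
    also have "closing c (a # l) + (- 1) ^ k * ((- 1) ^ k * alt_faces (h c) (a # l)) = coboundary_map \<psi> k h c as"
    proof -
      have "(- 1) ^ k * ((- 1) ^ k * y) = y" for y :: complex
        unfolding mult.assoc[symmetric] by (simp add: power_mult_distrib[symmetric])
      then show ?thesis unfolding as(1) coboundary_map_eq[OF as(2)] by (simp add: closing_def as(2) merge_def)
    qed
    finally show ?thesis .
  qed (simp add: cycle_character_def coboundary_map_def)
qed

end

section \<open>The cycle is vanishing\<close>

lemma mat2_sum_units: "(\<Sum>i\<in>UNIV. \<Sum>j\<in>UNIV. mat2_unit i j (x $ i $ j)) = (x :: 'r::comm_monoid_add^2^2)"
  by (simp add: vec_eq_iff forall_2 sum_2 mat2_unit_def)

context cone_dga
begin

abbreviation V0 :: "('k \<Rightarrow>\<^sub>0 complex) set" where "V0 \<equiv> cvs.span (gens 0)"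

definition scalar :: "cone \<Rightarrow> 'k \<Rightarrow>\<^sub>0 complex" where "scalar x = word x [1]"

lemma scalar_V0: "scalar x \<in> V0"
  unfolding scalar_def by (intro cvs.span_base gensI) auto

lemma scalar_lin: "lin scalar"
  unfolding scalar_def by (rule word_lin1)

lemma scalar_mult: "wmul (scalar x) (scalar y) = scalar (x * y)"
  by (simp add: scalar_def wmul_word merge_def)

lemma wpsi_scalar: "wpsi (c \<otimes> scalar x) = scalar x \<otimes> c"
proof -
  have "bil (\<lambda>a' (c' :: 'c). word x [a'] \<otimes> c')" using mlin_bil[OF mlin_word, of x "[]" "[]"] by simp
  then show ?thesis by (simp add: wpsi_tens scalar_def wpass_word \<psi>_one sweedler_tens)
qed

definition wamp :: "('k \<Rightarrow>\<^sub>0 complex) \<Rightarrow> 'k \<Rightarrow>\<^sub>0 complex" where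
  "wamp = lift (\<lambda>x as. word (ampliation x) as)"

lemma wamp_word: "wamp (word x as) = word (ampliation x) as"
  unfolding wamp_def
  by (rule lift_word) (rule multilinI, rule lin_comp[OF word_lin1 ampliation_lin], rule word_lin2)

lemma wamp_lin: "lin wamp"
  unfolding wamp_def by (rule lin_lift)

lemma wpsi_tensor_on: "t \<in> tensor_on UNIV V0 \<Longrightarrow> wpsi t \<in> tensor_on V0 UNIV"
  unfolding wpsi_def
  by (rule sweedler_in_subspace[OF subspace_tensor_on subspace_UNIV cvs.subspace_span wpass_bil wpass_piece])

lemma V0_words: "u \<in> gens 0 \<Longrightarrow> \<exists>x a. u = word x [a]"
  unfolding gens_def by (auto simp: length_Suc_conv)

lemma wamp_entwined:
  assumes t: "t \<in> tensor_on UNIV V0"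
  shows "tensor_map V0 UNIV wamp id (wpsi t) = wpsi (tensor_map UNIV V0 id wamp t)"
proof -
  have b: "bil (\<lambda>p c. wamp p \<otimes> (c :: 'c))" by (rule bil_tens_comp[OF wamp_lin])
  have b': "bil (\<lambda>(c :: 'c) p. c \<otimes> wamp p)" by (intro bilI lin_tens1 lin_tens2 lin_id wamp_lin)
  have 1: "tensor_map V0 UNIV wamp id (wpsi t) = sweedler (\<lambda>p c. wamp p \<otimes> c) (wpsi t)"
    unfolding tensor_map_def
    by (rule tlift_eq_sweedler[OF cvs.subspace_span subspace_UNIV b _ wpsi_tensor_on[OF t]]) simp
  have 2: "tensor_map UNIV V0 id wamp t = sweedler (\<lambda>c p. c \<otimes> wamp p) t"
    unfolding tensor_map_def by (rule tlift_eq_sweedler[OF subspace_UNIV cvs.subspace_span b' _ t]) simp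
  show ?thesis
    unfolding 1 2 using t
  proof (induction rule: tensor_on_induct)
    case (tens c p)
    have "sweedler (\<lambda>p c. wamp p \<otimes> c) (wpass c p) = wpass c (wamp p)"
    proof (rule lin_eq_on_span[OF tens(2)])
      show "lin (\<lambda>p. sweedler (\<lambda>p c. wamp p \<otimes> c) (wpass c p))"
        by (rule lin_comp[OF lin_sweedler[OF b] bilD2[OF wpass_bil]])
      show "lin (\<lambda>p. wpass c (wamp p))" by (rule lin_comp[OF bilD2[OF wpass_bil] wamp_lin])
      fix u assume "u \<in> gens 0"
      then obtain x a where u: "u = word x [a]" using V0_words by blast
      show "sweedler (\<lambda>p c. wamp p \<otimes> c) (wpass c u) = wpass c (wamp u)"
        unfolding u sweedler_wpass_word[OF b] unfolding wamp_word wpass_word ..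
    qed
    then show ?case by (simp add: sweedler_tens[OF b'] wpsi_tens)
  next
    case (add s t)
    then show ?case by (simp add: lin_add[OF wpsi_lin] lin_add[OF lin_sweedler[OF b]] lin_add[OF lin_sweedler[OF b']])
  next
    case (scale k s)
    then show ?case by (simp add: lin_scale[OF wpsi_lin] lin_scale[OF lin_sweedler[OF b]] lin_scale[OF lin_sweedler[OF b']])
  qed (use cvs.span_zero in auto)
qed

lemma wmul_scalar_word: "wmul (scalar x) (word y [a]) = word (x * y) [a]" "wmul (word y [a]) (scalar x) = word (y * x) [a]"
  by (simp_all add: scalar_def wmul_word merge_def)

lemma mat2_entwining_scalars:
  assumes X: "\<And>i j. X $ i $ j = scalar (x i j)"
  shows "mat2_entwining V0 wpsi (c \<otimes> X) = X \<otimes> c"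
proof -
  have XV: "X \<in> mat2 V0" by (simp add: mat2_def X scalar_V0)
  have unit_lin: "lin (mat2_unit i j :: ('k \<Rightarrow>\<^sub>0 complex) \<Rightarrow> ('k \<Rightarrow>\<^sub>0 complex)^2^2)" for i j
    by (auto intro!: linI simp: mat2_unit_def vec_eq_iff scaleC_vec_def)
  have unit_bil: "bil (\<lambda>v w. (mat2_unit i j v :: ('k \<Rightarrow>\<^sub>0 complex)^2^2) \<otimes> (w :: 'c))" for i j
    by (rule bil_tens_comp[OF unit_lin])
  have sub: "cvs.subspace (mat2 V0)"
    by (rule cvs.subspaceI) (auto simp: mat2_def scaleC_vec_def cvs.span_zero cvs.span_add cvs.span_scale)
  define F where "F c x = (\<Sum>i\<in>UNIV. \<Sum>j\<in>UNIV. sweedler (\<lambda>v w. mat2_unit i j v \<otimes> w) (wpass c (x $ i $ j)))"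
    for c and x :: "('k \<Rightarrow>\<^sub>0 complex)^2^2"
  have nth_lin: "lin (\<lambda>x :: ('k \<Rightarrow>\<^sub>0 complex)^2^2. x $ i $ j)" for i j
    by (auto intro!: linI simp: scaleC_vec_def)
  have F: "bil F"
    unfolding F_def
    by (intro bilI lin_sum' lin_comp[OF lin_sweedler[OF unit_bil]] bilD1[OF wpass_bil]
        lin_comp[OF bilD2[OF wpass_bil] nth_lin])
  have "mat2_entwining V0 wpsi (c \<otimes> X) = sweedler F (c \<otimes> X)"
    unfolding mat2_entwining_def
  proof (rule tlift_eq_sweedler[OF subspace_UNIV sub F _ tens_in[OF UNIV_I XV]])
    fix c and x :: "('k \<Rightarrow>\<^sub>0 complex)^2^2" assume "x \<in> mat2 V0"
    then have x: "x $ i $ j \<in> V0" for i j by (simp add: mat2_def)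
    have "tensor_map V0 UNIV (mat2_unit i j) id (wpsi (c \<otimes> x $ i $ j))
       = sweedler (\<lambda>v w. mat2_unit i j v \<otimes> w) (wpass c (x $ i $ j))" for i j
      unfolding tensor_map_def wpsi_tens
      by (rule tlift_eq_sweedler[OF cvs.subspace_span subspace_UNIV unit_bil _ wpass_piece[OF x]]) simp
    then show "(\<Sum>i\<in>UNIV. \<Sum>j\<in>UNIV. tensor_map V0 UNIV (mat2_unit i j) id (wpsi (c \<otimes> x $ i $ j))) = F c x"
      unfolding F_def by simp
  qed
  also have "\<dots> = (\<Sum>i\<in>UNIV. \<Sum>j\<in>UNIV. mat2_unit i j (X $ i $ j) \<otimes> c)"
    unfolding sweedler_tens[OF F] F_def X wpsi_tens[symmetric] wpsi_scalar sweedler_tens[OF unit_bil] ..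
  also have "\<dots> = (\<Sum>i\<in>UNIV. \<Sum>j\<in>UNIV. mat2_unit i j (X $ i $ j)) \<otimes> c"
    by (simp add: sum_2 tens_bilinear)
  also have "\<dots> = X \<otimes> c" unfolding mat2_sum_units ..
  finally show ?thesis .
qed

text \<open>The space underlying the endomorphisms is the direct sum of its copies numbered by \<open>i \<ge> 0\<close>, on which the
ampliation acts, and a rest that contains the copies with \<open>i < 0\<close>.  The matrix \<open>X\<close> acts on two summands, the
first of which is inserted as copy \<open>0\<close> of the second, while the copies of the second are translated
and its copy \<open>-1\<close> becomes the first summand.  So \<open>X\<close> carries \<open>x\<close> together with its ampliation to
the ampliation alone.\<close>
lemma vanishing_wdga: "vanishing wdga wpsi"
proof -
  define s where "s = shift 0"
  define s' where "s' = unshift"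
  define U where "U = bump 1"
  define U' where "U' = bump (- 1)"
  define q where "q = 1 - s * s'"
  note rel = cone_relations[folded s_def s'_def U_def U'_def]
  have s's: "s' * (s * z) = z" "U * (U' * z) = z" "U' * (U * z) = z" for z
    using rel(1-3) by (metis mult.assoc mult_1_left)+
  have qs: "q * s = 0" "s' * q = 0" "q * q = q" "q * (s * z) = 0" "s' * (q * z) = 0" "q * (q * z) = q * z" for z
    using rel(1) by (simp_all add: q_def algebra_simps s's)
  define x where "x i j = (if i = 1 then (if j = 1 then 0 else s' * U) else if j = 1 then s else q * U)" for i j :: 2
  define y where "y i j = (if i = 1 then (if j = 1 then 0 else s') else if j = 1 then U' * s else U' * q)" for i j :: 2
  define X where "X = (\<chi> i j. scalar (x i j))"
  define Y where "Y = (\<chi> i j. scalar (y i j))"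
  have X: "X $ i $ j = scalar (x i j)" and Y: "Y $ i $ j = scalar (y i j)" for i j
    by (simp_all add: X_def Y_def)
  note scalar_simps = lin_add[OF scalar_lin, symmetric] lin_zero[OF scalar_lin] scalar_mult
  have two: "(2::2) \<noteq> 1" by simp
  have XY: "mat2_mult wmul X Y = mat2_diag (scalar 1) (scalar 1)"
  proof -
    have "s * s' + q * U * (U' * q) = 1"
      by (simp add: mult.assoc s's qs) (simp add: q_def)
    moreover have "s' * U * (U' * s) = 1" "s' * U * (U' * q) = 0" "q * U * (U' * s) = 0"
      by (simp_all add: mult.assoc s's qs rel)
    ultimately show ?thesis
      by (simp add: vec_eq_iff forall_2 mat2_mult_def sum_2 X Y scalar_simps x_def y_def mat2_diag_def)
  qed
  have YX: "mat2_mult wmul Y X = mat2_diag (scalar 1) (scalar 1)"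
  proof -
    have "U' * s * (s' * U) + U' * q * (q * U) = U' * (s * s' + q) * U"
      by (simp add: mult.assoc qs algebra_simps)
    also have "\<dots> = 1" by (simp add: q_def rel)
    finally have "U' * s * (s' * U) + U' * q * (q * U) = 1" .
    moreover have "s' * s = 1" "s' * (q * U) = 0" "U' * q * s = 0"
      by (simp_all add: mult.assoc s's qs rel)
    ultimately show ?thesis
      by (simp add: vec_eq_iff forall_2 mat2_mult_def sum_2 X Y scalar_simps x_def y_def mat2_diag_def)
  qed
  have inv: "mat2_inverse_pair V0 wmul (scalar 1) X Y"
    unfolding mat2_inverse_pair_def using XY YX by (auto simp: mat2_def X Y scalar_V0)
  have unit: "unit_on V0 wmul (scalar 1)"
    unfolding unit_on_def
  proof (intro conjI ballI scalar_V0)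
    fix p assume p: "p \<in> V0"
    show "wmul (scalar 1) p = p"
      by (rule lin_eq_on_span[OF p bilD2[OF wmul_bil] lin_id]) (auto dest!: V0_words simp: wmul_scalar_word)
    show "wmul p (scalar 1) = p"
      by (rule lin_eq_on_span[OF p bilD1[OF wmul_bil] lin_id]) (auto dest!: V0_words simp: wmul_scalar_word)
  qed
  have amp_in: "wamp p \<in> V0" if p: "p \<in> V0" for p
    by (rule lin_in_subspace_on_span[OF p wamp_lin cvs.subspace_span])
      (auto dest!: V0_words simp: wamp_word intro!: cvs.span_base gensI)
  have amp_mult: "wamp (wmul p r) = wmul (wamp p) (wamp r)" if p: "p \<in> V0" and r: "r \<in> V0" for p r
  proof (rule lin_eq_on_span[OF p])
    show "lin (\<lambda>p. wamp (wmul p r))" by (rule lin_comp[OF wamp_lin bilD1[OF wmul_bil]])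
    show "lin (\<lambda>p. wmul (wamp p) (wamp r))" by (rule lin_comp[OF bilD1[OF wmul_bil] wamp_lin])
    fix u assume u: "u \<in> gens 0"
    show "wamp (wmul u r) = wmul (wamp u) (wamp r)"
    proof (rule lin_eq_on_span[OF r])
      show "lin (\<lambda>r. wamp (wmul u r))" by (rule lin_comp[OF wamp_lin bilD2[OF wmul_bil]])
      show "lin (\<lambda>r. wmul (wamp u) (wamp r))" by (rule lin_comp[OF bilD2[OF wmul_bil] wamp_lin])
      fix v assume v: "v \<in> gens 0"
      from V0_words[OF u] V0_words[OF v] show "wamp (wmul u v) = wmul (wamp u) (wamp v)"
        by (auto simp: wmul_word wamp_word ampliation_mult)
    qed
  qed
  have conj: "mat2_mult wmul (mat2_mult wmul X (mat2_diag p (wamp p))) Y = mat2_diag 0 (wamp p)" if p: "p \<in> V0" for p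
  proof -
    note wl = lin_zero[OF bilD1[OF wmul_bil]] lin_zero[OF bilD2[OF wmul_bil]]
    have ent: "mat2_mult wmul (mat2_mult wmul X (mat2_diag p (wamp p))) Y $ i $ j
       = wmul (wmul (X $ i $ 1) p) (Y $ 1 $ j) + wmul (wmul (X $ i $ 2) (wamp p)) (Y $ 2 $ j)" for p i j
      by (simp add: mat2_mult_def sum_2 mat2_diag_def wl)
    have l: "lin (\<lambda>p. wmul (wmul (X $ i $ 1) p) (Y $ 1 $ j) + wmul (wmul (X $ i $ 2) (wamp p)) (Y $ 2 $ j))" for i j
      by (intro lin_plus lin_comp[OF bilD1[OF wmul_bil]] bilD2[OF wmul_bil] lin_comp[OF bilD2[OF wmul_bil] wamp_lin])
    have amp: "s' * U * ampliation z = 0" "q * U * ampliation z = ampliation z * q * U" for z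
    proof -
      have szs: "s * z * s' = ampliation z * s * s'" by (simp add: rel)
      have U: "U * ampliation z = ampliation z * q * U"
        unfolding rel(6) szs by (simp add: q_def algebra_simps)
      have "s' * ampliation z * q = 0" by (simp add: rel(5) mult.assoc qs)
      then show 1: "s' * U * ampliation z = 0"
        using U by (metis mult.assoc mult_zero_left)
      have "q * U * ampliation z = U * ampliation z - s * (s' * U * ampliation z)"
        by (simp add: q_def algebra_simps)
      then show "q * U * ampliation z = ampliation z * q * U" unfolding 1 U by simp
    qed
    have "wmul (wmul (X $ i $ 1) p) (Y $ 1 $ j) + wmul (wmul (X $ i $ 2) (wamp p)) (Y $ 2 $ j)
        = (if i = 2 \<and> j = 2 then wamp p else 0)" for i j
    proof (rule lin_eq_on_span[OF p l])
      show "lin (\<lambda>p. if i = 2 \<and> j = 2 then wamp p else 0)"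
        by (cases "i = 2 \<and> j = 2") (auto intro: wamp_lin lin_const0)
      fix u assume "u \<in> gens 0"
      then obtain z a where u: "u = word z [a]" using V0_words by blast
      have "x i 1 * z * y 1 j + x i 2 * ampliation z * y 2 j = (if i = 2 \<and> j = 2 then ampliation z else 0)"
      proof -
        have "s * z * s' + q * U * ampliation z * (U' * q) = ampliation z"
        proof -
          have "q * U * ampliation z * (U' * q) = ampliation z * q"
            unfolding amp by (simp add: mult.assoc s's qs)
          moreover have "s * z * s' = ampliation z * s * s'" by (simp add: rel)
          ultimately show ?thesis by (simp add: q_def algebra_simps)
        qed
        moreover have "q * U * ampliation z * (U' * s) = 0"
          unfolding amp by (simp add: mult.assoc s's qs)
        ultimately show ?thesis
          using exhaust_2[of i] exhaust_2[of j] by (auto simp: x_def y_def amp)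
      qed
      then show "wmul (wmul (X $ i $ 1) u) (Y $ 1 $ j) + wmul (wmul (X $ i $ 2) (wamp u)) (Y $ 2 $ j)
          = (if i = 2 \<and> j = 2 then wamp u else 0)"
        unfolding u X Y wamp_word wmul_scalar_word lin_add[OF word_lin1, symmetric]
        by (simp add: lin_zero[OF word_lin1])
    qed
    then show ?thesis
      unfolding vec_eq_iff ent by (simp add: forall_2 mat2_diag_def)
  qed
  have amp_hom: "algebra_hom_on V0 wmul V0 wmul wamp"
    unfolding algebra_hom_on_def using amp_in amp_mult wamp_lin by (auto simp: clinear_on_def)
  show ?thesis
    unfolding vanishing_def wdga_simps
  proof (intro exI conjI allI ballI)
    show "unit_on V0 wmul (scalar 1)" by (rule unit)
    show "wpsi (c \<otimes> scalar 1) = scalar 1 \<otimes> c" for c by (rule wpsi_scalar)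
    show "algebra_hom_on V0 wmul V0 wmul wamp" by (rule amp_hom)
    show "tensor_map V0 UNIV wamp id (wpsi t) = wpsi (tensor_map UNIV V0 id wamp t)"
      if "t \<in> tensor_on UNIV V0" for t by (rule wamp_entwined[OF that])
    show "X \<in> mat2_entwined_units V0 wmul (scalar 1) wpsi"
      unfolding mat2_entwined_units_def using inv mat2_entwining_scalars[OF X] by blast
    show "mat2_inverse_pair V0 wmul (scalar 1) X Y" by (rule inv)
    show "mat2_mult wmul (mat2_mult wmul X (mat2_diag a (wamp a))) Y = mat2_diag 0 (wamp a)" if "a \<in> V0" for a
      by (rule conj[OF that])
  qed
qed

end

section \<open>The zero cycle\<close>

lemma tlift_zero_carrier:
  assumes "\<And>w. \<beta> 0 w = 0"
  shows "tlift {0} UNIV \<beta> 0 = 0"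
proof -
  have "cbilinear_on {0} UNIV \<beta>"
    using assms by (auto simp: cbilinear_on_def clinear_on_def)
  from tlift_eq[OF cvs.subspace_single_0 subspace_UNIV this, of "[]"] show ?thesis by simp
qed

text \<open>All graded pieces of the cycle are zero.  It serves for cochains of degree zero, and for the zero
algebra, into which the scalars do not embed.\<close>
lemma zero_is_vanishing_character:
  fixes \<psi> :: "('c::complex_vector, 'a::complex_algebra_1) tensor \<Rightarrow> ('a, 'c) tensor"
  assumes ent: "entwining_structure \<Delta> \<epsilon> \<psi>"
  shows "is_vanishing_character TYPE('r::complex_vector) n \<Delta> \<epsilon> \<psi> (\<lambda>c as. 0)"
proof -
  define R :: "'r dga" where "R = \<lparr>piece = \<lambda>_. {0}, mul = \<lambda>_ _. 0, diff = \<lambda>_. 0\<rparr>"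
  define \<Psi> :: "('c, 'r) tensor \<Rightarrow> ('r, 'c) tensor" where "\<Psi> = (\<lambda>_. 0)"
  have R: "piece R = (\<lambda>_. {0})" "mul R = (\<lambda>_ _. 0)" "diff R = (\<lambda>_. 0)" by (simp_all add: R_def)
  have tot: "total R = {0}" by (simp add: total_def R)
  have sub: "cvs.subspace {0 :: 'r}" by (rule cvs.subspace_single_0)
  have zero_in: "0 \<in> tensor_on S W" for S :: "'r set" and W :: "'c set"
    by (rule cvs.subspace_0[OF subspace_tensor_on])
  have sw0: "sweedler (\<lambda>_ _. 0) t = 0" for t :: "('c, 'c) tensor"
    using sweedler_fun_scale[of "\<lambda>_ _. 0" 0 t] by (simp add: bilI lin_const0)
  have coalg: "coalgebra \<Delta> \<epsilon>"
    using ent unfolding entwining_structure_def entwining_def by (elim conjE)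
  have alg: "algebra_on {0 :: 'r} (\<lambda>_ _. 0)"
    by (simp add: algebra_on_def sub cbilinear_on_def clinear_on_def)
  have dga: "dg_algebra R"
    unfolding dg_algebra_def R tot using alg sub by (auto simp: clinear_on_def)
  have e: "entwining {0} (\<lambda>_ _. 0) \<Delta> \<epsilon> \<Psi>"
    unfolding entwining_def tensor_map_def \<Psi>_def
    using alg coalg zero_in by (auto simp: clinear_on_def tlift_zero_carrier sw0)
  have dg: "dg_entwining R \<Delta> \<epsilon> \<Psi>"
    unfolding dg_entwining_def tot R using dga e zero_in
    by (auto simp: \<Psi>_def tensor_map_def tlift_zero_carrier)
  have rho: "tensor_map UNIV UNIV (\<lambda>_. 0) id t = (0 :: ('r, 'c) tensor)" for t :: "('a, 'c) tensor"
    using sweedler_fun_scale[of "\<lambda>_ _. 0 :: ('r, 'c) tensor" 0 t] by (simp add: bilI lin_const0 tensor_map_def)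
  have over: "dg_entwining_over \<psi> R \<Delta> \<epsilon> \<Psi> (\<lambda>_. 0)"
    unfolding dg_entwining_over_def R using dg rho by (auto simp: algebra_hom_on_def clinear_on_def \<Psi>_def)
  have tr: "closed_graded_entwined_trace n R \<Psi> (\<lambda>_. 0)"
    unfolding closed_graded_entwined_trace_def R
    by (auto simp: clinear_on_def \<Psi>_def tlift_zero_carrier)
  have mat0: "mat2_diag 0 0 = (0 :: 'r^2^2)" by (simp add: mat2_diag_def vec_eq_iff)
  have mult0: "mat2_mult (\<lambda>_ _. 0) x y = (0 :: 'r^2^2)" for x y by (simp add: mat2_mult_def vec_eq_iff)
  have pair: "mat2_inverse_pair {0} (\<lambda>_ _. 0) 0 0 (0 :: 'r^2^2)"
    by (simp add: mat2_inverse_pair_def mat0 mult0 mat2_def)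
  have mat20: "mat2 {0} = {0 :: 'r^2^2}" by (auto simp: mat2_def vec_eq_iff)
  have z: "c \<otimes> (0 :: 'r^2^2) = 0" for c :: 'c by simp
  have entX: "mat2_entwining {0} \<Psi> (c \<otimes> (0 :: 'r^2^2)) = 0 \<otimes> c" for c
  proof -
    have t0: "tensor_map {0} UNIV (mat2_unit i j) id 0 = (0 :: ('r^2^2, 'c) tensor)" for i j :: 2
      unfolding tensor_map_def
      by (rule tlift_zero_carrier) (simp add: mat2_unit_def if_distrib vec_eq_iff zero_vec_def[symmetric] cong: if_cong)
    have "cbilinear_on UNIV {0 :: 'r^2^2} (\<lambda>c x. \<Sum>i\<in>UNIV. \<Sum>j\<in>UNIV. tensor_map {0} UNIV (mat2_unit i j) id (\<Psi> (c \<otimes> x $ i $ j)))"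
      by (simp add: cbilinear_on_def clinear_on_def \<Psi>_def t0)
    from tlift_tens[OF subspace_UNIV cvs.subspace_single_0 this, of c 0]
    show ?thesis unfolding mat2_entwining_def mat20 by (simp add: \<Psi>_def t0)
  qed
  have van: "vanishing R \<Psi>"
    unfolding vanishing_def R
  proof (intro exI conjI allI ballI)
    show "unit_on {0} (\<lambda>_ _. 0) (0 :: 'r)" by (simp add: unit_on_def)
    show "\<Psi> (c \<otimes> 0) = 0 \<otimes> c" for c by (simp add: \<Psi>_def)
    show "algebra_hom_on {0} (\<lambda>_ _. 0) {0} (\<lambda>_ _. 0) (\<lambda>_. 0 :: 'r)" by (simp add: algebra_hom_on_def clinear_on_def)
    show "tensor_map {0} UNIV (\<lambda>_. 0) id (\<Psi> t) = \<Psi> (tensor_map UNIV {0} id (\<lambda>_. 0) t)" for t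
      by (simp add: \<Psi>_def tensor_map_def tlift_zero_carrier)
    show "0 \<in> mat2_entwined_units {0} (\<lambda>_ _. 0) 0 \<Psi>"
      unfolding mat2_entwined_units_def using pair entX by blast
    show "mat2_inverse_pair {0} (\<lambda>_ _. 0) 0 0 (0 :: 'r^2^2)" by (rule pair)
    show "mat2_mult (\<lambda>_ _. 0) (mat2_mult (\<lambda>_ _. 0) 0 (mat2_diag a 0)) 0 = mat2_diag 0 (0 :: 'r)" for a
      by (simp add: mult0 mat0)
  qed
  have "(\<lambda>c as. 0) = cycle_character n R (\<lambda>_. 0) (\<lambda>_ :: 'a. 0)"
    by (simp add: cycle_character_def fun_eq_iff)
  then show ?thesis
    unfolding is_vanishing_character_def entwined_cycle_def using over tr van by blast
qed

section \<open>Coboundaries are characters of vanishing cycles\<close>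

text \<open>The coefficient is recorded by its matrix entries, as multiples of the unit of the algebra; these
determine the entries unless \<open>1 = 0\<close>.\<close>
definition encode :: "cone \<times> 'a::complex_algebra_1 list \<Rightarrow> (nat \<Rightarrow> nat \<Rightarrow> 'a) option list" where
  "encode w = Some (\<lambda>i j. Poly_Mapping.lookup (app (fst w) (bv (from_nat j))) (from_nat i) *\<^sub>C 1)
     # map (\<lambda>a. Some (\<lambda>_ _. a)) (snd w)"

lemma inj_encode:
  assumes ne: "(1 :: 'a::complex_algebra_1) \<noteq> 0"
  shows "inj (encode :: cone \<times> 'a list \<Rightarrow> _)"
proof (rule injI)
  fix v w :: "cone \<times> 'a list" assume eq: "encode v = encode w"
  have "inj (\<lambda>a :: 'a. Some (\<lambda>_ _. a :: 'a) :: (nat \<Rightarrow> nat \<Rightarrow> 'a) option)"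
    by (auto intro!: injI dest: fun_cong)
  then have 2: "snd v = snd w" using eq by (simp add: encode_def inj_map_eq_map)
  have "app (fst v) (bv l) = app (fst w) (bv l)" for l :: "int list"
  proof (rule poly_mapping_eqI)
    fix i :: "int list"
    have "(\<lambda>i j. Poly_Mapping.lookup (app (fst v) (bv (from_nat j))) (from_nat i) *\<^sub>C (1 :: 'a))
      = (\<lambda>i j. Poly_Mapping.lookup (app (fst w) (bv (from_nat j))) (from_nat i) *\<^sub>C 1)"
      using eq by (simp add: encode_def)
    from fun_cong[OF fun_cong[OF this, of "to_nat i"], of "to_nat l"]
    show "Poly_Mapping.lookup (app (fst v) (bv l)) i = Poly_Mapping.lookup (app (fst w) (bv l)) i"
      using ne by (simp add: cvs.scale_cancel_right)
  qed
  then have "fst v = fst w" by (rule endo_eq_on_bv)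
  then show "v = w" using 2 by (simp add: prod_eq_iff)
qed

lemma trivial_algebra_coboundary:
  assumes triv: "(1 :: 'a::complex_algebra_1) = 0" and h: "h \<in> cochains k"
  shows "h c (as :: 'a list) = 0"
proof (cases "length as = Suc k")
  case True
  then obtain a l where as: "as = a # l" by (cases as) auto
  have "a = 0" using triv by (metis mult_1_left mult_zero_left)
  then show ?thesis
    using lin_zero[OF bilD1[OF cochain_bil[OF h], of c "[]" l]] by (simp add: as)
next
  case False
  then show ?thesis using h by (simp add: cochains_def)
qed

theorem coboundary_is_vanishing_character:
  fixes \<psi> :: "('c::complex_vector, 'a::complex_algebra_1) tensor \<Rightarrow> ('a, 'c) tensor"
  assumes ent: "entwining_structure \<Delta> \<epsilon> \<psi>" and g: "g \<in> cyclic_coboundaries \<psi> n"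
  shows "is_vanishing_character TYPE('a universe) n \<Delta> \<epsilon> \<psi> g"
proof (cases n)
  case 0
  then show ?thesis using g zero_is_vanishing_character[OF ent] by simp
next
  case (Suc k)
  then obtain h where h: "h \<in> cyclic_cochains \<psi> k" and g: "g = coboundary_map \<psi> k h" using g by auto
  have h_cochain: "h \<in> cochains k" using h unfolding cyclic_cochains_def by blast
  show ?thesis
  proof (cases "(1 :: 'a) = 0")
    case True
    have h0: "h = (\<lambda>c as. 0)"
      using trivial_algebra_coboundary[OF True h_cochain] by (intro ext)
    have "sweedler (\<lambda>_ _. 0 :: complex) t = 0" for t :: "('a, 'c) tensor"
      using sweedler_fun_scale[of "\<lambda>_ _. 0 :: complex" 0 t] by (simp add: bilI lin_const0)
    then have "g = (\<lambda>c as. 0)"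
      unfolding g h0 coboundary_map_def by (simp add: fun_eq_iff)
    then show ?thesis using zero_is_vanishing_character[OF ent] by simp
  next
    case False
    obtain P where P: "lin P" "\<And>x. P x \<in> finite_rank" "\<And>x :: cone. x \<in> finite_rank \<Longrightarrow> P x = x"
      using exists_linear_projection[OF subspace_finite_rank] by blast
    interpret cone_cycle "encode :: cone \<times> 'a list \<Rightarrow> _" \<Delta> \<epsilon> \<psi> h k "\<lambda>x. trace (P x)"
    proof unfold_locales
      show "inj (encode :: cone \<times> 'a list \<Rightarrow> _)" by (rule inj_encode[OF False])
      show "lin (\<lambda>x. trace (P x))" by (rule lin_of_clinear_on[OF clinear_on_trace P(1,2)])
      show "trace (P x) = trace x" if "x \<in> finite_rank" for x using P(3)[OF that] by simp
    qed (rule ent, rule h)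
    show ?thesis
      unfolding is_vanishing_character_def
    proof (intro exI conjI)
      show "entwined_cycle n \<psi> wdga \<Delta> \<epsilon> wpsi wtrace wrho"
        unfolding entwined_cycle_def Suc using dg_entwining_over_wdga closed_trace_wtrace by blast
      show "vanishing wdga wpsi" by (rule vanishing_wdga)
      show "g = cycle_character n wdga wtrace wrho" unfolding g Suc character_eq ..
    qed
  qed
qed

theorem theorem7p10:
  fixes \<Delta> :: "'c::complex_vector \<Rightarrow> ('c, 'c) tensor"
    and \<epsilon> :: "'c \<Rightarrow> complex"
    and \<psi> :: "('c, 'a::complex_algebra_1) tensor \<Rightarrow> ('a, 'c) tensor"
    and g :: "'c \<Rightarrow> 'a list \<Rightarrow> complex"
    and n :: nat
  assumes "entwining_structure \<Delta> \<epsilon> \<psi>"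
    and "g \<in> cyclic_cocycles \<psi> n"
  shows "(g \<in> cyclic_coboundaries \<psi> n \<longleftrightarrow>
            is_vanishing_character TYPE('a universe) n \<Delta> \<epsilon> \<psi> g) \<and>
         (is_vanishing_character TYPE('r::complex_vector) n \<Delta> \<epsilon> \<psi> g \<longrightarrow>
            g \<in> cyclic_coboundaries \<psi> n)"
proof -
  have "g \<in> cyclic_coboundaries \<psi> n \<Longrightarrow> is_vanishing_character TYPE('a universe) n \<Delta> \<epsilon> \<psi> g"
    by (rule coboundary_is_vanishing_character[OF assms(1)])
  moreover have "is_vanishing_character TYPE('a universe) n \<Delta> \<epsilon> \<psi> g \<Longrightarrow> g \<in> cyclic_coboundaries \<psi> n"
    by (rule vanishing_character_is_coboundary)
  moreover have "is_vanishing_character TYPE('r) n \<Delta> \<epsilon> \<psi> g \<Longrightarrow> g \<in> cyclic_coboundaries \<psi> n"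
    by (rule vanishing_character_is_coboundary)
  ultimately show ?thesis by blast
qed

end
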